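(* Let $X(\mathcal V,\Sigma,\lambda)$ be an $\mathcal S_{\mathcal R}(\mathfrak P,\mathcal E^-,\mathcal E^+)$-presentation. Then its zeta function is $$\zeta_{X(\mathcal V,\Sigma,\lambda)}(z)=\frac{\det\big(\mathbf 1-H^{(\mathcal C^0)}(z)\big)}{\det(\mathbf 1-A^-z)\,\det\big(\mathbf 1-H^{(\mathcal C^-)}(z)\big)\,\det\big(\mathbf 1-H^{(\mathcal C^+)}(z)\big)\,\det(\mathbf 1-A^+z)},$$ where $\mathcal C^0=\mathcal C^0(\mathcal V,\Sigma,\lambda)$, $\mathcal C^-=\mathcal C^-(\mathcal V,\Sigma,\lambda)$, $\mathcal C^+=\mathcal C^+(\mathcal V,\Sigma,\lambda)$ are the Markov codes and $A^-,A^+$ the transition matrices associated to $(\mathcal V,\Sigma,\lambda)$.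
   Context: **$\mathcal R$-graph semigroup.** A partitioned graph is a finite directed graph with vertex set $\mathfrak P$ and edge set $\mathcal E=\mathcal E^-\cup\mathcal E^+$ (disjoint). Set $\mathcal E^-(\mathfrak q,\mathfrak r)=\{e^-\in\mathcal E^-: s(e^-)=\mathfrak q, t(e^-)=\mathfrak r\}$, $\mathcal E^+(\mathfrak q,\mathfrak r)=\{e^+\in\mathcal E^+: s(e^+)=\mathfrak r, t(e^+)=\mathfrak q\}$ ($s$ = source, $t$ = target, also for paths); it is assumed that $\mathcal E^-(\mathfrak q,\mathfrak r)\ne\emptyset$ iff $\mathcal E^+(\mathfrak q,\mathfrak r)\neq\emptyset$ and that $(\mathfrak P,\mathcal E^-)$ is strongly connected. An $\mathcal R$-graph is a partitioned graph with relations $\mathcal R(\mathfrak q,\mathfrak r)\subset\mathcal E^-(\mathfrak q,\mathfrak r)\times\mathcal E^+(\mathfrak q,\mathfrak r)$. $\mathcal S=\mathcal S_{\mathcal R}(\mathfrak P,\mathcal E^-,\mathcal E^+)$ is the semigroup with zero generated by $\mathbf 1_{\mathfrak p}$ ($\mathfrak p\in\mathfrak P$) and $\mathcal E$ with defining relations $\mathbf 1_{\mathfrak p}^2=\mathbf 1_{\mathfrak p}$; $\mathbf 1_{\mathfrak q}\mathbf 1_{\mathfrak r}=0$ for $\mathfrak q\neq\mathfrak r$; $\mathbf 1_{\mathfrak q}e^-=e^-\mathbf 1_{\mathfrak r}=e^-$ for $e^-\in\mathcal E^-(\mathfrak q,\mathfrak r)$; $\mathbf 1_{\mathfrak r}e^+=e^+\mathbf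 1_{\mathfrak q}=e^+$ for $e^+\in\mathcal E^+(\mathfrak q,\mathfrak r)$; for $f^-\in\mathcal E^-(\mathfrak q,\mathfrak r)$, $g^+\in\mathcal E^+(\mathfrak q,\mathfrak r)$: $f^-g^+=\mathbf 1_{\mathfrak q}$ if $(f^-,g^+)\in\mathcal R(\mathfrak q,\mathfrak r)$ and $f^-g^+=0$ if $(f^-,g^+)\notin\mathcal R(\mathfrak q,\mathfrak r)$; and $f^-g^+=0$ for $f^-\in\mathcal E^-(\mathfrak q,\mathfrak r)$, $g^+\in\mathcal E^+(\mathfrak q',\mathfrak r)$ with $\mathfrak q\ne\mathfrak q'$. $\mathcal S^{\pm}$ denotes the set of non-zero elements of the subsemigroup generated by $\mathcal E^\pm$; $\mathbf 1_{\mathfrak P}=\{\mathbf 1_{\mathfrak p}:\mathfrak p\in\mathfrak P\}$. **$\mathcal S$-presentation.** A finite strongly connected directed graph $(\mathcal V,\Sigma)$ (vertex set $\mathcal V$, edge set $\Sigma$) with labels (G1) $\lambda(\sigma)\in\mathcal S^-\cup\mathbf 1_{\mathfrak P}\cup\mathcal S^+$ for $\sigma\in\Sigma$, extended to paths multiplicatively. $\mathcal V(\mathfrak p)$ is the set of $V\in\mathcal V$ for which there is a cycle from $V$ to $V$ with label $\mathbf 1_{\mathfrak p}$. Require: (G2) $\mathcal V(\mathfrak p)\ne\emptyset$ for all $\mathfrak p$; (G3) $\{\mathcal V(\mathfrak p):\mathfrak p\in\mathfrak P\}$ is a partition of $\mathcal V$; (G4) for $V\in\mathcal V(\mathfrak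 p)$, $\mathbf 1_{\mathfrak p}\lambda(e)\ne0$ for all edges $e$ leaving $V$ and $\lambda(e)\mathbf 1_{\mathfrak p}\neq0$ for all edges $e$ entering $V$; (G5) for $f\in\mathcal S$ with $\mathbf 1_{\mathfrak q}f\mathbf 1_{\mathfrak r}\ne0$, $U\in\mathcal V(\mathfrak q)$, $W\in\mathcal V(\mathfrak r)$ there is a path $b$ from $U$ to $W$ with $\lambda(b)=f$. $X(\mathcal V,\Sigma,\lambda)\subset\Sigma^{\mathbb Z}$ is the subshift whose admissible words, forming the set $\mathcal L$, are the finite non-empty paths $b$ with $\lambda(b)\ne0$. **Zeta function.** $\zeta_X(z)=\exp\sum_{n\ge1}\Pi_n(X)z^n/n$, $\Pi_n(X)$ the number of points of period $n$, i.e. fixed by the $n$-th power of the shift. **Transition matrices.** $\Sigma^-=\{\sigma\in\Sigma:\lambda(\sigma)\in\mathcal S^-\cup\mathbf 1_{\mathfrak P}\}$, $\Sigma^+=\{\sigma\in\Sigma:\lambda(\sigma)\in\mathbf 1_{\mathfrak P}\cup\mathcal S^+\}$; $A^{\pm}$ is the $0$-$1$ matrix indexed by $\Sigma^{\pm}$ with $A^\pm(\rho,\tau)=1$ iff $t(\rho)=s(\tau)$. **Codes.** $\mathcal C^0$ is the set of words $(\sigma_i)_{1\le i\le I}\in\mathcal L$, $I>1$, with $\lambda((\sigma_i)_{1\le i\le I})\in\mathbf 1_{\mathfrak P}$ and $\lambda((\sigma_i)_{1\le i\le J})\notin\mathbf 1_{\mathfrak P}$ for $1<J<I$. $\mathcal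 C^-_\circ$ is the set of words $(\sigma_i)_{1\le i\le I}\in\mathcal L$, $I>1$, with $\lambda((\sigma_i)_{1\le i\le I})\in\mathcal S^-\cup\mathbf 1_{\mathfrak P}$ and $\lambda((\sigma_i)_{J\le i\le I})\in\mathcal S^+$ for $1<J\le I$. $\mathcal C^+_\circ$ is the set of words $(\sigma_i)_{1\le i\le I}\in\mathcal L$, $I>1$, with $\lambda((\sigma_i)_{1\le i\le I})\in\mathbf 1_{\mathfrak P}\cup\mathcal S^+$ and $\lambda((\sigma_i)_{1\le i\le J})\in\mathcal S^-$ for $1\le J<I$. $\mathcal C^{-}$ (resp. $\mathcal C^+$) is the set of words that are in $\mathcal C^-_\circ$ (resp. $\mathcal C^+_\circ$) or that are paths that are concatenations of a word in $\mathcal C^-_\circ$ (resp. $\mathcal C_\circ^+$) and a non-empty word over $\Sigma^-$ (resp. $\Sigma^+$) allowed by the transition matrix $A^-$ (resp. $A^+$), in this order. Each of $\mathcal C^0,\mathcal C^-,\mathcal C^+$ is regarded as a Markov code over $\mathcal V$ by means of the source and target vertices $s(c),t(c)$ of its words $c$. **Generating matrices.** For $\mathcal C\in\{\mathcal C^0,\mathcal C^-,\mathcal C^+\}$, $H^{(\mathcal C)}(z)=\big(g_{u,v}(z)\big)_{u,v\in\mathcal V}$, $g_{u,v}(z)=\sum_{n}\operatorname{card}\{c\in\mathcal C:s(c)=u,\ t(c)=v,\ \text{length}(c)=n\}\,z^n$. $\mathbf 1$ is the identity matrix; $\det(\mathbf 1-A^{\pm}z)=1$ if the topological Markov shift with state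 space $\Sigma^\pm$ and transition matrix $A^\pm$ is empty.
   Formalization: C^0 is taken with I ≥ 1 and 1 ≤ J < I instead of I > 1 and 1 < J < I; as printed the formula fails for one vertex with one loop labelled 1_p (zeta is 1/(1-z), the right side (1+z)/(1-z)); the determinants agree unless some cycle has all its edges labelled in 1_P. *)

theory Defs
  imports
    Complex_Main
    "HOL-Library.Disjoint_Sets"
    "HOL-Combinatorics.Permutations"
    "HOL-Computational_Algebra.Formal_Power_Series"
    "Graph_Theory.Digraph"
    "Graph_Theory.Digraph_Component"
    "Graph_Theory.Arc_Walk"
begin

section \<open>Partitioned graphs and R-graphs\<close>

record ('p, 'e) r_graph =
  base :: "('p, 'e) pre_digraph"
  neg_arcs :: "'e set"
  pos_arcs :: "'e set"
  relns :: "'p \<Rightarrow> 'p \<Rightarrow> ('e \<times> 'e) set"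

definition Eneg :: "('p, 'e) r_graph \<Rightarrow> 'p \<Rightarrow> 'p \<Rightarrow> 'e set" where
  "Eneg Q q r = {e \<in> neg_arcs Q. tail (base Q) e = q \<and> head (base Q) e = r}"

text \<open>The arcs in \<open>Epos Q q r\<close> run from \<open>r\<close> to \<open>q\<close>, against the order of the arguments.\<close>

definition Epos :: "('p, 'e) r_graph \<Rightarrow> 'p \<Rightarrow> 'p \<Rightarrow> 'e set" where
  "Epos Q q r = {e \<in> pos_arcs Q. tail (base Q) e = r \<and> head (base Q) e = q}"

definition partitioned_graph :: "('p, 'e) r_graph \<Rightarrow> bool" where
  "partitioned_graph Q \<longleftrightarrow>
     fin_digraph (base Q) \<and>
     arcs (base Q) = neg_arcs Q \<union> pos_arcs Q \<and> neg_arcs Q \<inter> pos_arcs Q = {} \<and>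
     (\<forall>q\<in>verts (base Q). \<forall>r\<in>verts (base Q). Eneg Q q r \<noteq> {} \<longleftrightarrow> Epos Q q r \<noteq> {}) \<and>
     strongly_connected ((base Q)\<lparr>arcs := neg_arcs Q\<rparr>)"

definition R_graph :: "('p, 'e) r_graph \<Rightarrow> bool" where
  "R_graph Q \<longleftrightarrow> partitioned_graph Q \<and>
     (\<forall>q\<in>verts (base Q). \<forall>r\<in>verts (base Q). relns Q q r \<subseteq> Eneg Q q r \<times> Epos Q q r)"


section \<open>The R-graph semigroup\<close>

text \<open>
  The semigroup with zero given by generators and relations: words are the non-empty lists of
  generators, the zero is an additional generator \<open>GZero\<close> made absorbing by \<open>zero_l\<close> and
  \<open>zero_r\<close>, and the elements of the semigroup are the classes of words modulo the congruence
  generated by the defining relations.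
\<close>

datatype ('p, 'e) sgen = GZero | GOne 'p | GEdge 'e

type_synonym ('p, 'e) selem = "('p, 'e) sgen list set"

definition sgens :: "('p, 'e) r_graph \<Rightarrow> ('p, 'e) sgen set" where
  "sgens Q = insert GZero (GOne ` verts (base Q) \<union> GEdge ` arcs (base Q))"

definition swords :: "('p, 'e) r_graph \<Rightarrow> ('p, 'e) sgen list set" where
  "swords Q = lists (sgens Q) - {[]}"

inductive srel :: "('p, 'e) r_graph \<Rightarrow> ('p, 'e) sgen list \<Rightarrow> ('p, 'e) sgen list \<Rightarrow> bool"
  for Q where
  zero_l: "x \<in> sgens Q \<Longrightarrow> srel Q [GZero, x] [GZero]"
| zero_r: "x \<in> sgens Q \<Longrightarrow> srel Q [x, GZero] [GZero]"
| one_idem: "p \<in> verts (base Q) \<Longrightarrow> srel Q [GOne p, GOne p] [GOne p]"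
| one_orth: "q \<in> verts (base Q) \<Longrightarrow> r \<in> verts (base Q) \<Longrightarrow> q \<noteq> r \<Longrightarrow>
    srel Q [GOne q, GOne r] [GZero]"
| one_neg: "e \<in> Eneg Q q r \<Longrightarrow> srel Q [GOne q, GEdge e] [GEdge e]"
| neg_one: "e \<in> Eneg Q q r \<Longrightarrow> srel Q [GEdge e, GOne r] [GEdge e]"
| one_pos: "e \<in> Epos Q q r \<Longrightarrow> srel Q [GOne r, GEdge e] [GEdge e]"
| pos_one: "e \<in> Epos Q q r \<Longrightarrow> srel Q [GEdge e, GOne q] [GEdge e]"
| cancel: "f \<in> Eneg Q q r \<Longrightarrow> g \<in> Epos Q q r \<Longrightarrow> (f, g) \<in> relns Q q r \<Longrightarrow>
    srel Q [GEdge f, GEdge g] [GOne q]"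
| annihilate: "f \<in> Eneg Q q r \<Longrightarrow> g \<in> Epos Q q r \<Longrightarrow> (f, g) \<notin> relns Q q r \<Longrightarrow>
    srel Q [GEdge f, GEdge g] [GZero]"
| mismatch: "f \<in> Eneg Q q r \<Longrightarrow> g \<in> Epos Q q' r \<Longrightarrow> q \<noteq> q' \<Longrightarrow>
    srel Q [GEdge f, GEdge g] [GZero]"

inductive sstep :: "('p, 'e) r_graph \<Rightarrow> ('p, 'e) sgen list \<Rightarrow> ('p, 'e) sgen list \<Rightarrow> bool"
  for Q where
  "srel Q u v \<Longrightarrow> x \<in> lists (sgens Q) \<Longrightarrow> y \<in> lists (sgens Q) \<Longrightarrow> sstep Q (x @ u @ y) (x @ v @ y)"

definition scong :: "('p, 'e) r_graph \<Rightarrow> (('p, 'e) sgen list \<times> ('p, 'e) sgen list) set" where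
  "scong Q = {(u, v). u \<in> swords Q \<and> v \<in> swords Q \<and> equivclp (sstep Q) u v}"

definition scarrier :: "('p, 'e) r_graph \<Rightarrow> ('p, 'e) selem set" where
  "scarrier Q = swords Q // scong Q"

definition scls :: "('p, 'e) r_graph \<Rightarrow> ('p, 'e) sgen list \<Rightarrow> ('p, 'e) selem" where
  "scls Q u = scong Q `` {u}"

definition smult :: "('p, 'e) r_graph \<Rightarrow> ('p, 'e) selem \<Rightarrow> ('p, 'e) selem \<Rightarrow> ('p, 'e) selem" where
  "smult Q X Y = (\<Union>x\<in>X. \<Union>y\<in>Y. scls Q (x @ y))"

lemma equiv_scong: "equiv (swords Q) (scong Q)"
proof (rule equivI)
  show "scong Q \<subseteq> swords Q \<times> swords Q"
    by (auto simp: scong_def)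
  show "refl_on (swords Q) (scong Q)"
    by (auto simp: refl_on_def scong_def)
  show "sym (scong Q)"
    by (auto simp: sym_def scong_def equivclp_sym)
  show "trans (scong Q)"
    by (auto simp: trans_def scong_def intro: equivclp_trans)
qed

lemma equivclp_sstep_context:
  assumes "equivclp (sstep Q) u v" "x \<in> lists (sgens Q)" "y \<in> lists (sgens Q)"
  shows "equivclp (sstep Q) (x @ u @ y) (x @ v @ y)"
proof -
  have step: "sstep Q (x @ a @ y) (x @ b @ y)" if "sstep Q a b" for a b
    using that
  proof cases
    case (1 u v s t)
    then show ?thesis
      using sstep.intros[of Q u v "x @ s" "t @ y"] assms(2,3) by simp
  qed
  show ?thesis
    using assms(1)
  proof (induction rule: equivclp_induct)
    case base
    then show ?case by simp
  next
    case (step b c)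
    have "equivclp (sstep Q) (x @ b @ y) (x @ c @ y)"
      using step.hyps(2) \<open>\<And>a b. sstep Q a b \<Longrightarrow> sstep Q (x @ a @ y) (x @ b @ y)\<close>
      by (meson r_into_equivclp equivclp_sym)
    with step.IH show ?case by (rule equivclp_trans)
  qed
qed

lemma smult_scls:
  assumes "u \<in> swords Q" "v \<in> swords Q"
  shows "smult Q (scls Q u) (scls Q v) = scls Q (u @ v)"
proof -
  have "scls Q (x @ y) = scls Q (u @ v)" if "x \<in> scls Q u" "y \<in> scls Q v" for x y
  proof -
    have x: "x \<in> swords Q" "equivclp (sstep Q) u x" and y: "y \<in> swords Q" "equivclp (sstep Q) v y"
      using that by (auto simp: scls_def scong_def)
    have "equivclp (sstep Q) (u @ v) (x @ v)"
      using equivclp_sstep_context[OF x(2), of "[]" v] assms by (simp add: swords_def)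
    moreover have "equivclp (sstep Q) (x @ v) (x @ y)"
      using equivclp_sstep_context[OF y(2), of x "[]"] x by (simp add: swords_def)
    ultimately have "(u @ v, x @ y) \<in> scong Q"
      using assms x y by (auto simp: scong_def swords_def intro: equivclp_trans)
    then show ?thesis
      unfolding scls_def using equiv_class_eq[OF equiv_scong] by blast
  qed
  moreover have "u \<in> scls Q u" "v \<in> scls Q v"
    using assms by (auto simp: scls_def scong_def)
  ultimately show ?thesis
    unfolding smult_def by blast
qed

definition szero :: "('p, 'e) r_graph \<Rightarrow> ('p, 'e) selem" where
  "szero Q = scls Q [GZero]"

definition sone :: "('p, 'e) r_graph \<Rightarrow> 'p \<Rightarrow> ('p, 'e) selem" where
  "sone Q p = scls Q [GOne p]"

definition sedge :: "('p, 'e) r_graph \<Rightarrow> 'e \<Rightarrow> ('p, 'e) selem" where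
  "sedge Q e = scls Q [GEdge e]"

inductive_set subsemigroup :: "('p, 'e) r_graph \<Rightarrow> ('p, 'e) selem set \<Rightarrow> ('p, 'e) selem set"
  for Q A where
  incl: "a \<in> A \<Longrightarrow> a \<in> subsemigroup Q A"
| mult: "a \<in> subsemigroup Q A \<Longrightarrow> b \<in> subsemigroup Q A \<Longrightarrow> smult Q a b \<in> subsemigroup Q A"

definition Sneg :: "('p, 'e) r_graph \<Rightarrow> ('p, 'e) selem set" where
  "Sneg Q = subsemigroup Q (sedge Q ` neg_arcs Q) - {szero Q}"

definition Spos :: "('p, 'e) r_graph \<Rightarrow> ('p, 'e) selem set" where
  "Spos Q = subsemigroup Q (sedge Q ` pos_arcs Q) - {szero Q}"

definition Sone :: "('p, 'e) r_graph \<Rightarrow> ('p, 'e) selem set" where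
  "Sone Q = sone Q ` verts (base Q)"


section \<open>Presentations\<close>

text \<open>
  Paths of the graph \<open>G\<close> are lists of arcs satisfying \<open>pre_digraph.awalk\<close>, which also
  admits the empty list; labels are only defined on non-empty paths.
\<close>

fun plabel :: "('p, 'e) r_graph \<Rightarrow> ('s \<Rightarrow> ('p, 'e) selem) \<Rightarrow> 's list \<Rightarrow> ('p, 'e) selem" where
  "plabel Q lam [s] = lam s"
| "plabel Q lam (s # t # w) = smult Q (lam s) (plabel Q lam (t # w))"

definition is_path :: "('v, 's) pre_digraph \<Rightarrow> 'v \<Rightarrow> 's list \<Rightarrow> 'v \<Rightarrow> bool" where
  "is_path G u b v \<longleftrightarrow> b \<noteq> [] \<and> pre_digraph.awalk G u b v"

definition Vset ::
  "('p, 'e) r_graph \<Rightarrow> ('v, 's) pre_digraph \<Rightarrow> ('s \<Rightarrow> ('p, 'e) selem) \<Rightarrow> 'p \<Rightarrow> 'v set" where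
  "Vset Q G lam p = {V \<in> verts G. \<exists>b. is_path G V b V \<and> plabel Q lam b = sone Q p}"

definition S_presentation ::
  "('p, 'e) r_graph \<Rightarrow> ('v, 's) pre_digraph \<Rightarrow> ('s \<Rightarrow> ('p, 'e) selem) \<Rightarrow> bool" where
  "S_presentation Q G lam \<longleftrightarrow>
     R_graph Q \<and> fin_digraph G \<and> strongly_connected G \<and>
     (\<forall>s\<in>arcs G. lam s \<in> Sneg Q \<union> Sone Q \<union> Spos Q) \<and>
     (\<forall>p\<in>verts (base Q). Vset Q G lam p \<noteq> {}) \<and>
     partition_on (verts G) (Vset Q G lam ` verts (base Q)) \<and>
     (\<forall>p\<in>verts (base Q). \<forall>V\<in>Vset Q G lam p. \<forall>s\<in>arcs G.
        (tail G s = V \<longrightarrow> smult Q (sone Q p) (lam s) \<noteq> szero Q) \<and>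
        (head G s = V \<longrightarrow> smult Q (lam s) (sone Q p) \<noteq> szero Q)) \<and>
     (\<forall>f\<in>scarrier Q. \<forall>q\<in>verts (base Q). \<forall>r\<in>verts (base Q).
        smult Q (smult Q (sone Q q) f) (sone Q r) \<noteq> szero Q \<longrightarrow>
        (\<forall>U\<in>Vset Q G lam q. \<forall>W\<in>Vset Q G lam r. \<exists>b. is_path G U b W \<and> plabel Q lam b = f))"


section \<open>The subshift and its zeta function\<close>

definition admissible ::
  "('p, 'e) r_graph \<Rightarrow> ('v, 's) pre_digraph \<Rightarrow> ('s \<Rightarrow> ('p, 'e) selem) \<Rightarrow> 's list set" where
  "admissible Q G lam = {b. (\<exists>u v. is_path G u b v) \<and> plabel Q lam b \<noteq> szero Q}"

definition presented_subshift ::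
  "('p, 'e) r_graph \<Rightarrow> ('v, 's) pre_digraph \<Rightarrow> ('s \<Rightarrow> ('p, 'e) selem) \<Rightarrow> (int \<Rightarrow> 's) set" where
  "presented_subshift Q G lam =
     {x. \<forall>i. \<forall>n>0. map (\<lambda>k. x (i + int k)) [0..<n] \<in> admissible Q G lam}"

definition shift :: "(int \<Rightarrow> 's) \<Rightarrow> (int \<Rightarrow> 's)" where
  "shift x = (\<lambda>i. x (i + 1))"

definition num_periodic :: "(int \<Rightarrow> 's) set \<Rightarrow> nat \<Rightarrow> nat" where
  "num_periodic X n = card {x \<in> X. (shift ^^ n) x = x}"

definition zeta :: "(int \<Rightarrow> 's) set \<Rightarrow> complex fps" where
  "zeta X = fps_exp 1 oo
     Abs_fps (\<lambda>n. if n = 0 then 0 else of_nat (num_periodic X n) / of_nat n)"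


section \<open>Determinants of matrices indexed by finite sets\<close>

text \<open>
  The Leibniz formula, for index sets that may be empty (the determinant is then 1).
  If the topological Markov shift of a 0-1 matrix \<open>A\<close> is empty then \<open>A\<close> is nilpotent,
  so that \<open>det (1 - A z) = 1\<close> holds without a separate convention.
\<close>

definition det_on :: "'i set \<Rightarrow> ('i \<Rightarrow> 'i \<Rightarrow> 'r::comm_ring_1) \<Rightarrow> 'r" where
  "det_on I M = (\<Sum>\<pi> | \<pi> permutes I. of_int (sign \<pi>) * (\<Prod>i\<in>I. M i (\<pi> i)))"

definition mat_one :: "'i \<Rightarrow> 'i \<Rightarrow> 'r::comm_ring_1" where
  "mat_one i j = (if i = j then 1 else 0)"


section \<open>Transition matrices and Markov codes\<close>

definition Sigma_neg ::
  "('p, 'e) r_graph \<Rightarrow> ('v, 's) pre_digraph \<Rightarrow> ('s \<Rightarrow> ('p, 'e) selem) \<Rightarrow> 's set" where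
  "Sigma_neg Q G lam = {s \<in> arcs G. lam s \<in> Sneg Q \<union> Sone Q}"

definition Sigma_pos ::
  "('p, 'e) r_graph \<Rightarrow> ('v, 's) pre_digraph \<Rightarrow> ('s \<Rightarrow> ('p, 'e) selem) \<Rightarrow> 's set" where
  "Sigma_pos Q G lam = {s \<in> arcs G. lam s \<in> Sone Q \<union> Spos Q}"

text \<open>
  \<open>A\<^sup>-\<close> and \<open>A\<^sup>+\<close> are given by the same formula on the index sets
  \<open>Sigma_neg\<close> and \<open>Sigma_pos\<close>.
\<close>

definition transition :: "('v, 's) pre_digraph \<Rightarrow> 's \<Rightarrow> 's \<Rightarrow> complex" where
  "transition G s t = (if head G s = tail G t then 1 else 0)"

text \<open>
  Since word positions start at 1, \<open>take J w\<close> is the prefix ending at position \<open>J\<close>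
  and \<open>drop (J - 1) w\<close> is the suffix starting at position \<open>J\<close>.

  The neutral code has to contain the single arcs with label in \<open>Sone Q\<close> (word length 1
  allowed, no proper non-empty prefix neutral). In the printed definition the length of the words
  and of the tested prefixes is bounded by \<open>> 1\<close>, which makes the determinant formula fail as
  soon as there is a neutral loop: for one vertex and one loop labelled by an idempotent the zeta
  function is \<open>1 / (1 - z)\<close>, while the printed code consists of the single word of length 2 and
  would give \<open>(1 - z\<^sup>2) / (1 - z)\<^sup>2\<close>. If no arc has a neutral label the two definitions
  agree.
\<close>

definition code_zero ::
  "('p, 'e) r_graph \<Rightarrow> ('v, 's) pre_digraph \<Rightarrow> ('s \<Rightarrow> ('p, 'e) selem) \<Rightarrow> 's list set" where
  "code_zero Q G lam = {w \<in> admissible Q G lam.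
     length w \<ge> 1 \<and> plabel Q lam w \<in> Sone Q \<and>
     (\<forall>J. 1 \<le> J \<and> J < length w \<longrightarrow> plabel Q lam (take J w) \<notin> Sone Q)}"

definition code_neg_init ::
  "('p, 'e) r_graph \<Rightarrow> ('v, 's) pre_digraph \<Rightarrow> ('s \<Rightarrow> ('p, 'e) selem) \<Rightarrow> 's list set" where
  "code_neg_init Q G lam = {w \<in> admissible Q G lam.
     length w > 1 \<and> plabel Q lam w \<in> Sneg Q \<union> Sone Q \<and>
     (\<forall>J. 1 < J \<and> J \<le> length w \<longrightarrow> plabel Q lam (drop (J - 1) w) \<in> Spos Q)}"

definition code_pos_init ::
  "('p, 'e) r_graph \<Rightarrow> ('v, 's) pre_digraph \<Rightarrow> ('s \<Rightarrow> ('p, 'e) selem) \<Rightarrow> 's list set" where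
  "code_pos_init Q G lam = {w \<in> admissible Q G lam.
     length w > 1 \<and> plabel Q lam w \<in> Sone Q \<union> Spos Q \<and>
     (\<forall>J. 1 \<le> J \<and> J < length w \<longrightarrow> plabel Q lam (take J w) \<in> Sneg Q)}"

definition code_closure :: "('v, 's) pre_digraph \<Rightarrow> 's list set \<Rightarrow> 's set \<Rightarrow> 's list set" where
  "code_closure G C T = C \<union> {c @ w | c w.
     c \<in> C \<and> w \<noteq> [] \<and> set w \<subseteq> T \<and> successively (\<lambda>s t. transition G s t = 1) w \<and>
     (\<exists>u v. is_path G u (c @ w) v)}"

definition code_neg ::
  "('p, 'e) r_graph \<Rightarrow> ('v, 's) pre_digraph \<Rightarrow> ('s \<Rightarrow> ('p, 'e) selem) \<Rightarrow> 's list set" where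
  "code_neg Q G lam = code_closure G (code_neg_init Q G lam) (Sigma_neg Q G lam)"

definition code_pos ::
  "('p, 'e) r_graph \<Rightarrow> ('v, 's) pre_digraph \<Rightarrow> ('s \<Rightarrow> ('p, 'e) selem) \<Rightarrow> 's list set" where
  "code_pos Q G lam = code_closure G (code_pos_init Q G lam) (Sigma_pos Q G lam)"

definition gen_matrix :: "('v, 's) pre_digraph \<Rightarrow> 's list set \<Rightarrow> 'v \<Rightarrow> 'v \<Rightarrow> complex fps" where
  "gen_matrix G C u v = Abs_fps (\<lambda>n. of_nat (card {c \<in> C. is_path G u c v \<and> length c = n}))"

definition det_one_minus_gen :: "('v, 's) pre_digraph \<Rightarrow> 's list set \<Rightarrow> complex fps" where
  "det_one_minus_gen G C = det_on (verts G) (\<lambda>u v. mat_one u v - gen_matrix G C u v)"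

definition det_one_minus_transition :: "('v, 's) pre_digraph \<Rightarrow> 's set \<Rightarrow> complex fps" where
  "det_one_minus_transition G T =
     det_on T (\<lambda>s t. mat_one s t - fps_const (transition G s t) * fps_X)"

end

theory Submission
  imports Defs "Jordan_Normal_Form.Determinant"
begin

text \<open>
  Every non-zero element of the semigroup is a path of positive edges followed by a path of negative
  edges, both possibly empty, because a negative edge directly before a positive one cancels or annihilates
  (\<open>scls_reduce\<close>, which runs a word on a stack machine). The height of an arc is the number of positive
  minus the number of negative edges of its label. Cancellation preserves this number, so heights add
  up along paths with non-zero label, and for labels in \<open>Sneg\<close>, \<open>Sone\<close> and \<open>Spos\<close> the sign of the height
  tells which of the three cases occurs (\<open>label_height\<close>).

  The drift of a periodic point is the height of one period. Take a point with non-positive drift and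
  cut it at the positions from which no window has positive height. Such positions exist, and the
  word between two consecutive ones is a \<^emph>\<open>descent\<close>: an admissible word of non-positive height all of
  whose proper suffixes have positive height. No descent is a proper suffix of another one, so the
  factorization is unique. Conversely descents have labels in \<open>Sneg \<union> Sone\<close>, a set closed under
  composition along paths, so every closed path that is a concatenation of descents can be repeated
  periodically without the label becoming zero. Points of period \<open>n\<close> with non-positive drift
  therefore correspond to cyclic factorizations into descents, a factorization into \<open>k\<close> words being
  weighted by \<open>n / k\<close> (\<open>card_by_cuts\<close>, \<open>card_nonpositive_drift\<close>). Descents of height zero count the
  points with drift zero, and they form the code \<open>code_zero\<close> (\<open>code_zero_eq\<close>). Reading backwards turns
  non-negative drift into non-positive drift and descents into \<^emph>\<open>ascents\<close>. By inclusion and exclusion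
  the number of points of period \<open>n\<close> is the count for descents plus the count for ascents minus the
  count for \<open>code_zero\<close> (\<open>card_periodic_points\<close>).

  The weighted counts are the coefficients of the logarithmic derivative of \<open>1 / det (1 - H)\<close>, where
  \<open>H\<close> is the generating matrix of the code: this is Jacobi's formula together with
  \<open>H^k\<close> counting concatenations of \<open>k\<close> words (\<open>fps_deriv_det_one_minus\<close>,
  \<open>trace_log_deriv_gen_matrix_nth\<close>). Hence the zeta function is the determinant of \<open>code_zero\<close> divided
  by those of the descents and of the ascents, as both sides solve the same linear differential
  equation.

  It remains to split the last two determinants. Descents are the words of \<open>code_neg_init\<close> and the
  single arcs of \<open>Sigma_neg\<close> (\<open>descents_eq\<close>), while \<open>code_neg\<close> consists of the words of \<open>code_neg_init\<close>
  followed by arbitrary paths over \<open>Sigma_neg\<close>. With \<open>N\<close> the generating matrix of the single arcs this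
  gives \<open>1 - H(descents) = (1 - H(code_neg)) (1 - N)\<close>, and \<open>det (1 - N)\<close>, a determinant over the
  vertices, equals the determinant \<open>det (1 - A z)\<close> over the arcs
  (\<open>det_one_minus_gen_code_closure\<close>, \<open>det_one_minus_gen_letters\<close>). The positive side is the same.
\<close>

section \<open>Determinants over finite index sets\<close>

definition mat_prod :: "'j set \<Rightarrow> ('i \<Rightarrow> 'j \<Rightarrow> 'r::comm_ring_1) \<Rightarrow> ('j \<Rightarrow> 'k \<Rightarrow> 'r) \<Rightarrow> 'i \<Rightarrow> 'k \<Rightarrow> 'r" where
  "mat_prod J A B i k = (\<Sum>j\<in>J. A i j * B j k)"

primrec mat_pow :: "'i set \<Rightarrow> ('i \<Rightarrow> 'i \<Rightarrow> 'r::comm_ring_1) \<Rightarrow> nat \<Rightarrow> 'i \<Rightarrow> 'i \<Rightarrow> 'r" where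
  "mat_pow I M 0 = mat_one"
| "mat_pow I M (Suc k) = mat_prod I M (mat_pow I M k)"

definition trace_on :: "'i set \<Rightarrow> ('i \<Rightarrow> 'i \<Rightarrow> 'r::comm_ring_1) \<Rightarrow> 'r" where
  "trace_on I M = (\<Sum>i\<in>I. M i i)"

lemma mat_prod_assoc: "mat_prod K (mat_prod J A B) C = mat_prod J A (mat_prod K B C)"
proof (intro ext)
  fix i l
  have "mat_prod K (mat_prod J A B) C i l = (\<Sum>k\<in>K. \<Sum>j\<in>J. A i j * B j k * C k l)"
    by (simp add: mat_prod_def sum_distrib_right)
  also have "\<dots> = (\<Sum>j\<in>J. \<Sum>k\<in>K. A i j * B j k * C k l)"
    by (rule sum.swap)
  also have "\<dots> = mat_prod J A (mat_prod K B C) i l"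
    by (simp add: mat_prod_def sum_distrib_left mult.assoc)
  finally show "mat_prod K (mat_prod J A B) C i l = mat_prod J A (mat_prod K B C) i l" .
qed

lemma mat_prod_cong:
  "(\<And>j. j \<in> J \<Longrightarrow> A i j = A' i j) \<Longrightarrow> (\<And>j. j \<in> J \<Longrightarrow> B j k = B' j k) \<Longrightarrow>
    mat_prod J A B i k = mat_prod J A' B' i k"
  unfolding mat_prod_def by (intro sum.cong) auto

lemma mat_prod_one_left [simp]: "finite I \<Longrightarrow> i \<in> I \<Longrightarrow> mat_prod I mat_one B i k = B i k"
  by (simp add: mat_prod_def mat_one_def if_distrib[of "\<lambda>x. x * _"] sum.delta cong: if_cong)

lemma mat_prod_one_right [simp]: "finite I \<Longrightarrow> k \<in> I \<Longrightarrow> mat_prod I B mat_one i k = B i k"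
  by (simp add: mat_prod_def mat_one_def if_distrib[of "\<lambda>x. _ * x"] sum.delta' cong: if_cong)

lemma trace_on_prod_commute: "trace_on I (mat_prod J U W) = trace_on J (mat_prod I W U)"
proof -
  have "trace_on I (mat_prod J U W) = (\<Sum>i\<in>I. \<Sum>j\<in>J. U i j * W j i)"
    by (simp add: trace_on_def mat_prod_def)
  also have "\<dots> = (\<Sum>j\<in>J. \<Sum>i\<in>I. U i j * W j i)"
    by (rule sum.swap)
  finally show ?thesis
    by (simp add: trace_on_def mat_prod_def mult.commute)
qed

lemma trace_on_cong: "(\<And>i. i \<in> I \<Longrightarrow> A i i = B i i) \<Longrightarrow> trace_on I A = trace_on I B"
  by (simp add: trace_on_def)

lemma mat_pow_commute:
  assumes "finite I" "i \<in> I" "j \<in> I"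
  shows "mat_prod I (mat_pow I M k) M i j = mat_prod I M (mat_pow I M k) i j"
  using assms(2,3)
proof (induction k arbitrary: i j)
  case 0
  then show ?case using assms(1) by simp
next
  case (Suc k)
  have "mat_prod I (mat_pow I M (Suc k)) M i j = mat_prod I M (mat_prod I (mat_pow I M k) M) i j"
    by (simp add: mat_prod_assoc)
  also have "\<dots> = mat_prod I M (mat_pow I M (Suc k)) i j"
    using Suc by (intro mat_prod_cong) auto
  finally show ?case .
qed

lemma trace_on_pow_commute:
  fixes U :: "'i \<Rightarrow> 'j \<Rightarrow> 'r::comm_ring_1"
  assumes "finite I" "finite J"
  shows "trace_on I (mat_pow I (mat_prod J U W) (Suc k)) = trace_on J (mat_pow J (mat_prod I W U) (Suc k))"
proof -
  let ?M = "mat_prod J U W" and ?N = "mat_prod I W U"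
  have shift: "mat_prod I (mat_pow I ?M k) U i j = mat_prod J U (mat_pow J ?N k) i j"
    if "i \<in> I" "j \<in> J" for i j k
    using that
  proof (induction k arbitrary: i j)
    case 0
    then show ?case using assms by simp
  next
    case (Suc k)
    have "mat_prod I (mat_pow I ?M (Suc k)) U i j
        = mat_prod I ?M (mat_prod I (mat_pow I ?M k) U) i j"
      by (simp add: mat_prod_assoc)
    also have "\<dots> = mat_prod I ?M (mat_prod J U (mat_pow J ?N k)) i j"
      using Suc by (intro mat_prod_cong) auto
    also have "\<dots> = mat_prod J U (mat_pow J ?N (Suc k)) i j"
      by (simp add: mat_prod_assoc)
    finally show ?case .
  qed
  have "trace_on I (mat_pow I ?M (Suc k)) = trace_on I (mat_prod J U (mat_prod I W (mat_pow I ?M k)))"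
    by (simp add: mat_prod_assoc)
  also have "\<dots> = trace_on J (mat_prod I W (mat_prod I (mat_pow I ?M k) U))"
    by (subst trace_on_prod_commute) (simp add: mat_prod_assoc)
  also have "\<dots> = trace_on J (mat_prod I W (mat_prod J U (mat_pow J ?N k)))"
    by (intro trace_on_cong mat_prod_cong) (auto simp: shift)
  finally show ?thesis
    by (simp add: mat_prod_assoc)
qed

lemma det_on_cong:
  assumes "\<And>i j. i \<in> I \<Longrightarrow> j \<in> I \<Longrightarrow> A i j = B i j"
  shows "det_on I A = det_on I B"
  unfolding det_on_def
proof (intro sum.cong refl arg_cong2[of _ _ _ _ "(*)"] prod.cong)
  fix \<pi> i assume "\<pi> \<in> {\<pi>. \<pi> permutes I}" "i \<in> I"
  then show "A i (\<pi> i) = B i (\<pi> i)" by (intro assms) (simp_all add: permutes_in_image)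
qed

text \<open>
  Enumerating the index set makes the Laplace expansion and the multiplicativity of the determinant
  of matrices over initial segments of the natural numbers applicable.
\<close>
lemma det_on_eq_det:
  assumes "bij_betw f {0..<n} I"
  shows "det_on I M = det (mat n n (\<lambda>(i, j). M (f i) (f j)))"
proof -
  let ?N = "{0..<n}"
  have inj: "inj_on f ?N" and img: "f ` ?N = I"
    using assms by (auto simp: bij_betw_def)
  have "(\<lambda>\<pi> x. if x \<in> I then f (\<pi> (inv_into ?N f x)) else x) = map_permutation ?N f"
    by (simp add: fun_eq_iff map_permutation_def restrict_id_def img)
  then have bij: "bij_betw (map_permutation ?N f) {\<pi>. \<pi> permutes ?N} {\<pi>. \<pi> permutes I}"
    using bij_betw_permutations[OF assms] by simp
  have "det_on I M = (\<Sum>\<pi> | \<pi> permutes ?N. of_int (sign (map_permutation ?N f \<pi>)) *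
      (\<Prod>i\<in>I. M i (map_permutation ?N f \<pi> i)))"
    unfolding det_on_def
    by (simp add: sum.reindex_bij_betw[OF bij, symmetric])
  also have "\<dots> = (\<Sum>\<pi> | \<pi> permutes ?N. of_int (sign \<pi>) * (\<Prod>i = 0..<n. M (f i) (f (\<pi> i))))"
  proof (intro sum.cong refl)
    fix \<pi> assume "\<pi> \<in> {\<pi>. \<pi> permutes ?N}"
    then have p: "\<pi> permutes ?N" by simp
    have "(\<Prod>i\<in>I. M i (map_permutation ?N f \<pi> i)) = (\<Prod>i\<in>?N. M (f i) (map_permutation ?N f \<pi> (f i)))"
      unfolding img[symmetric] using inj by (simp add: prod.reindex)
    also have "\<dots> = (\<Prod>i\<in>?N. M (f i) (f (\<pi> i)))"
      using inj by (intro prod.cong refl) (simp add: map_permutation_def restrict_id_def)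
    finally show "of_int (sign (map_permutation ?N f \<pi>)) * (\<Prod>i\<in>I. M i (map_permutation ?N f \<pi> i))
        = of_int (sign \<pi>) * (\<Prod>i = 0..<n. M (f i) (f (\<pi> i)))"
      using p inj by (simp add: sign_map_permutation)
  qed
  also have "\<dots> = det (mat n n (\<lambda>(i, j). M (f i) (f j)))"
    unfolding det_def by (auto intro!: sum.cong prod.cong simp: permutes_in_image)
  finally show ?thesis .
qed

lemma fps_deriv_prod:
  fixes f :: "'i \<Rightarrow> 'a::comm_ring_1 fps"
  assumes "finite S"
  shows "fps_deriv (\<Prod>i\<in>S. f i) = (\<Sum>i\<in>S. fps_deriv (f i) * (\<Prod>j\<in>S - {i}. f j))"
  using assms
proof (induction S)
  case empty
  then show ?case by simp
next
  case (insert a S)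
  have "(\<Prod>j\<in>insert a S - {i}. f j) = f a * (\<Prod>j\<in>S - {i}. f j)" if "i \<in> S" for i
  proof -
    have "insert a S - {i} = insert a (S - {i})" using that insert.hyps by auto
    then show ?thesis using insert.hyps by simp
  qed
  moreover have "insert a S - {a} = S" using insert.hyps by auto
  ultimately show ?case
    using insert by (simp add: sum_distrib_left algebra_simps cong: sum.cong)
qed

text \<open>
  Jacobi's formula. Differentiating the Leibniz formula gives the sum over \<open>i\<close> of the determinants in
  which row \<open>i\<close> is differentiated; expanding such a determinant along row \<open>i\<close> produces the cofactors
  of \<open>A\<close>, since deleting row \<open>i\<close> removes the changed entries.
\<close>
lemma fps_deriv_det:
  fixes A :: "'a::comm_ring_1 fps mat"
  assumes A: "A \<in> carrier_mat n n"
  shows "fps_deriv (det A) = (\<Sum>i<n. \<Sum>j<n. fps_deriv (A $$ (i, j)) * adj_mat A $$ (j, i))"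
proof -
  let ?P = "{\<pi>. \<pi> permutes {0..<n}}"
  define B where "B i = mat n n (\<lambda>(i', j). if i' = i then fps_deriv (A $$ (i, j)) else A $$ (i', j))" for i
  have B: "B i \<in> carrier_mat n n" for i by (simp add: B_def)
  have det_B: "det (B i) = (\<Sum>j<n. fps_deriv (A $$ (i, j)) * adj_mat A $$ (j, i))" if i: "i < n" for i
  proof -
    have del: "mat_delete (B i) i j = mat_delete A i j" if "j < n" for j
      using A i that by (intro eq_matI) (auto simp: mat_delete_def B_def)
    have row: "B i $$ (i, j) = fps_deriv (A $$ (i, j))" if "j < n" for j
      using i that by (simp add: B_def)
    have "det (B i) = (\<Sum>j<n. B i $$ (i, j) * cofactor (B i) i j)"
      by (rule laplace_expansion_row[OF B i])
    also have "\<dots> = (\<Sum>j<n. fps_deriv (A $$ (i, j)) * adj_mat A $$ (j, i))"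
      using i A by (intro sum.cong refl) (auto simp: cofactor_def del adj_mat_def row)
    finally show ?thesis .
  qed
  have "fps_deriv (det A) = (\<Sum>\<pi>\<in>?P. of_int (sign \<pi>) *
      (\<Sum>i\<in>{0..<n}. fps_deriv (A $$ (i, \<pi> i)) * (\<Prod>j\<in>{0..<n} - {i}. A $$ (j, \<pi> j))))"
    by (simp add: det_def'[OF A] fps_deriv_sum fps_deriv_prod)
  also have "\<dots> = (\<Sum>\<pi>\<in>?P. \<Sum>i\<in>{0..<n}. of_int (sign \<pi>) * (\<Prod>j\<in>{0..<n}. B i $$ (j, \<pi> j)))"
  proof (intro sum.cong refl)
    fix \<pi> assume "\<pi> \<in> ?P"
    then have p: "\<pi> j < n" if "j < n" for j
      using that permutes_in_image[of \<pi> "{0..<n}" j] by simp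
    have "fps_deriv (A $$ (i, \<pi> i)) * (\<Prod>j\<in>{0..<n} - {i}. A $$ (j, \<pi> j))
        = (\<Prod>j\<in>{0..<n}. B i $$ (j, \<pi> j))" if "i \<in> {0..<n}" for i
      using that p by (subst (2) prod.remove[of _ i]) (auto simp: B_def intro!: arg_cong2[of _ _ _ _ "(*)"] prod.cong)
    then show "of_int (sign \<pi>) * (\<Sum>i\<in>{0..<n}. fps_deriv (A $$ (i, \<pi> i)) * (\<Prod>j\<in>{0..<n} - {i}. A $$ (j, \<pi> j)))
        = (\<Sum>i\<in>{0..<n}. of_int (sign \<pi>) * (\<Prod>j\<in>{0..<n}. B i $$ (j, \<pi> j)))"
      by (simp add: sum_distrib_left)
  qed
  also have "\<dots> = (\<Sum>i\<in>{0..<n}. det (B i))"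
    by (subst sum.swap) (simp add: det_def'[OF B])
  also have "\<dots> = (\<Sum>i<n. \<Sum>j<n. fps_deriv (A $$ (i, j)) * adj_mat A $$ (j, i))"
    by (simp add: det_B atLeast0LessThan)
  finally show ?thesis .
qed

lemma finite_indexing:
  assumes "finite I"
  obtains f and n :: nat where "bij_betw f {0..<n} I"
  using ex_bij_betw_nat_finite[OF assms] by blast

lemma det_on_mult:
  assumes "finite I"
  shows "det_on I (mat_prod I A B) = det_on I A * det_on I B"
proof -
  obtain f and n :: nat where f: "bij_betw f {0..<n} I"
    using finite_indexing[OF assms] .
  let ?m = "\<lambda>M. mat n n (\<lambda>(i, j). M (f i) (f j))"
  have "?m (mat_prod I A B) = ?m A * ?m B"
    by (intro eq_matI)
      (auto simp: mat_prod_def scalar_prod_def sum.reindex_bij_betw[OF f, symmetric])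
  then show ?thesis
    by (simp add: det_on_eq_det[OF f] det_mult[of _ n])
qed

text \<open>
  The adjugate enters the argument only through these two identities, so it is obtained and not given
  a name of its own.
\<close>
lemma det_on_adjugate:
  fixes A :: "'i \<Rightarrow> 'i \<Rightarrow> 'a::comm_ring_1 fps"
  assumes "finite I"
  obtains Adj where
    "\<And>i j. i \<in> I \<Longrightarrow> j \<in> I \<Longrightarrow> mat_prod I Adj A i j = det_on I A * mat_one i j"
    "fps_deriv (det_on I A) = (\<Sum>i\<in>I. \<Sum>j\<in>I. fps_deriv (A i j) * Adj j i)"
proof -
  obtain f and n :: nat where f: "bij_betw f {0..<n} I"
    using finite_indexing[OF assms] .
  define g where "g = inv_into {0..<n} f"
  have gf: "g (f i) = i" if "i < n" for i
    using f that by (simp add: g_def bij_betw_def)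
  have fg: "f (g i) = i" "g i < n" if "i \<in> I" for i
  proof -
    show "f (g i) = i" unfolding g_def using f that by (simp add: bij_betw_def f_inv_into_f)
    show "g i < n" unfolding g_def using bij_betw_inv_into[OF f] that by (auto dest: bij_betwE)
  qed
  define m where "m = mat n n (\<lambda>(i, j). A (f i) (f j))"
  have m: "m \<in> carrier_mat n n" by (simp add: m_def)
  define Adj where "Adj i j = adj_mat m $$ (g i, g j)" for i j
  have det: "det_on I A = det m" unfolding m_def by (rule det_on_eq_det[OF f])
  show thesis
  proof (rule that[of Adj])
    fix i j assume ij: "i \<in> I" "j \<in> I"
    have "mat_prod I Adj A i j = (\<Sum>k\<in>{0..<n}. Adj i (f k) * A (f k) j)"
      by (simp add: mat_prod_def sum.reindex_bij_betw[OF f, symmetric])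
    also have "\<dots> = (adj_mat m * m) $$ (g i, g j)"
      using ij adj_mat(1)[OF m]
      by (auto simp: scalar_prod_def Adj_def fg m_def gf intro!: sum.cong)
    also have "\<dots> = det_on I A * mat_one i j"
      using ij m fg by (auto simp: adj_mat(3)[OF m] det mat_one_def) metis
    finally show "mat_prod I Adj A i j = det_on I A * mat_one i j" .
  next
    show "fps_deriv (det_on I A) = (\<Sum>i\<in>I. \<Sum>j\<in>I. fps_deriv (A i j) * Adj j i)"
    proof -
      have entry: "m $$ (i, j) = A (f i) (f j)" if "i < n" "j < n" for i j
        using that by (simp add: m_def)
      show ?thesis
        by (simp add: det fps_deriv_det[OF m] sum.reindex_bij_betw[OF f, symmetric] Adj_def gf entry
          atLeast0LessThan)
    qed
  qed
qed

text \<open>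
  The formal derivative of the sum over \<open>k > 0\<close> of \<open>trace (M ^ k) / k\<close>. If the entries of \<open>M\<close> have no
  constant term, then \<open>M ^ k\<close> contributes to the coefficient of \<open>z ^ Suc n\<close> only for \<open>k \<le> Suc n\<close>, which
  makes the sum in each coefficient finite.
\<close>
definition trace_log_deriv :: "'i set \<Rightarrow> ('i \<Rightarrow> 'i \<Rightarrow> 'a::field_char_0 fps) \<Rightarrow> 'a fps" where
  "trace_log_deriv I M =
     Abs_fps (\<lambda>n. \<Sum>k\<le>n. of_nat (Suc n) / of_nat (Suc k) * fps_nth (trace_on I (mat_pow I M (Suc k))) (Suc n))"

lemma mat_pow_nth_eq_0:
  assumes "\<And>i j. i \<in> I \<Longrightarrow> j \<in> I \<Longrightarrow> fps_nth (M i j) 0 = 0" "i \<in> I" "j \<in> I" "n < k"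
  shows "fps_nth (mat_pow I M k i j) n = 0"
  using assms(2-)
proof (induction k arbitrary: i j n)
  case 0
  then show ?case by simp
next
  case (Suc k)
  have "fps_nth (M i l * mat_pow I M k l j) n = 0" if l: "l \<in> I" for l
    unfolding fps_mult_nth
  proof (rule sum.neutral, rule ballI)
    fix a assume "a \<in> {0..n}"
    then show "fps_nth (M i l) a * fps_nth (mat_pow I M k l j) (n - a) = 0"
      using Suc l assms(1) by (cases "a = 0") auto
  qed
  then show ?case by (simp add: mat_prod_def fps_sum_nth)
qed

text \<open>
  By the product rule and the cyclicity of the trace each of the \<open>Suc k\<close> factors contributes the same
  trace. The extra factor \<open>M ^ l\<close> collects the copies of \<open>M\<close> that the induction moves past the
  differentiated power.
\<close>
lemma trace_deriv_mat_pow: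
  fixes M :: "'i \<Rightarrow> 'i \<Rightarrow> 'a::comm_ring_1 fps"
  assumes I: "finite I"
  shows "trace_on I (mat_prod I (\<lambda>i j. fps_deriv (mat_pow I M (Suc k) i j)) (mat_pow I M l))
    = of_nat (Suc k) * trace_on I (mat_prod I (\<lambda>i j. fps_deriv (M i j)) (mat_pow I M (k + l)))"
proof (induction k arbitrary: l)
  case 0
  show ?case
    using I by (auto intro!: trace_on_cong mat_prod_cong arg_cong[of _ _ fps_deriv])
next
  case (Suc k)
  let ?D = "\<lambda>X i j. fps_deriv (X i j)"
  have add: "mat_prod I (mat_pow I M a) (mat_pow I M b) i j = mat_pow I M (a + b) i j"
    if "i \<in> I" "j \<in> I" for a b i j
    using that
  proof (induction a arbitrary: i j)
    case 0
    then show ?case using I by simp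
  next
    case (Suc a)
    then show ?case by (auto simp: mat_prod_assoc intro: mat_prod_cong)
  qed
  have "?D (mat_pow I M (Suc (Suc k))) i j
      = mat_prod I (?D M) (mat_pow I M (Suc k)) i j + mat_prod I M (?D (mat_pow I M (Suc k))) i j" for i j
    unfolding mat_pow.simps(2)[of I M "Suc k"] mat_prod_def[of I M]
    by (simp add: mat_prod_def fps_deriv_sum sum.distrib del: mat_pow.simps)
  then have "trace_on I (mat_prod I (?D (mat_pow I M (Suc (Suc k)))) (mat_pow I M l))
     = trace_on I (mat_prod I (mat_prod I (?D M) (mat_pow I M (Suc k))) (mat_pow I M l))
     + trace_on I (mat_prod I (mat_prod I M (?D (mat_pow I M (Suc k)))) (mat_pow I M l))"
    by (simp add: trace_on_def mat_prod_def[of I _ "mat_pow I M l"] algebra_simps sum.distrib del: mat_pow.simps)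
  also have "trace_on I (mat_prod I (mat_prod I (?D M) (mat_pow I M (Suc k))) (mat_pow I M l))
     = trace_on I (mat_prod I (?D M) (mat_pow I M (Suc k + l)))"
    unfolding mat_prod_assoc by (intro trace_on_cong mat_prod_cong add refl)
  also have "trace_on I (mat_prod I (mat_prod I M (?D (mat_pow I M (Suc k)))) (mat_pow I M l))
     = trace_on I (mat_prod I (mat_prod I (?D (mat_pow I M (Suc k))) (mat_pow I M l)) M)"
    unfolding mat_prod_assoc by (rule trace_on_prod_commute[THEN trans]) (simp only: mat_prod_assoc)
  also have "\<dots> = trace_on I (mat_prod I (?D (mat_pow I M (Suc k))) (mat_pow I M (Suc l)))"
    unfolding mat_prod_assoc
    by (intro trace_on_cong mat_prod_cong refl) (simp add: mat_pow_commute I)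
  also have "\<dots> = of_nat (Suc k) * trace_on I (mat_prod I (?D M) (mat_pow I M (k + Suc l)))"
    by (rule Suc.IH)
  finally show ?case by (simp add: algebra_simps del: mat_pow.simps)
qed

text \<open>
  With \<open>A = 1 - M\<close> and \<open>d = det A\<close>, multiplying \<open>adj A * A = d\<close> from the right by
  \<open>1 + M + \<dots> + M ^ (K - 1)\<close> gives \<open>adj A = d (1 + \<dots> + M ^ (K - 1)) + adj A * M ^ K\<close>. Insert this into
  Jacobi's formula \<open>d' = - trace (M' * adj A)\<close>; the last term starts in degree \<open>K\<close>, so every
  coefficient is determined by choosing \<open>K\<close> large enough.
\<close>
lemma fps_deriv_det_one_minus:
  fixes M :: "'i \<Rightarrow> 'i \<Rightarrow> 'a::field_char_0 fps"
  assumes I: "finite I" and M0: "\<And>i j. i \<in> I \<Longrightarrow> j \<in> I \<Longrightarrow> fps_nth (M i j) 0 = 0"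
  shows "fps_deriv (det_on I (\<lambda>i j. mat_one i j - M i j))
    = - trace_log_deriv I M * det_on I (\<lambda>i j. mat_one i j - M i j)"
proof -
  let ?A = "\<lambda>i j. mat_one i j - M i j" and ?D = "\<lambda>i j. fps_deriv (M i j)"
  let ?d = "det_on I ?A"
  obtain Adj where adj: "\<And>i j. i \<in> I \<Longrightarrow> j \<in> I \<Longrightarrow> mat_prod I Adj ?A i j = ?d * mat_one i j"
    and deriv: "fps_deriv ?d = (\<Sum>i\<in>I. \<Sum>j\<in>I. fps_deriv (?A i j) * Adj j i)"
    using det_on_adjugate[OF I, of ?A] by blast
  have one: "fps_deriv (mat_one i j :: 'a fps) = 0" for i j :: 'i
    by (simp add: mat_one_def)
  have deriv: "fps_deriv ?d = - trace_on I (mat_prod I ?D Adj)"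
    by (simp add: deriv one trace_on_def mat_prod_def sum_negf)
  have step: "mat_prod I Adj (mat_pow I M k) i j
      = ?d * mat_pow I M k i j + mat_prod I Adj (mat_pow I M (Suc k)) i j"
    if "i \<in> I" "j \<in> I" for i j k
  proof -
    have "mat_prod I Adj (mat_pow I M k) i j - mat_prod I Adj (mat_pow I M (Suc k)) i j
        = mat_prod I Adj (mat_prod I ?A (mat_pow I M k)) i j"
      unfolding mat_prod_def[of I Adj] sum_subtractf[symmetric]
    proof (intro sum.cong refl)
      fix l assume "l \<in> I"
      moreover have "mat_prod I ?A (mat_pow I M k) l j
          = mat_prod I mat_one (mat_pow I M k) l j - mat_pow I M (Suc k) l j"
        by (simp add: mat_prod_def algebra_simps sum_subtractf)
      ultimately have "mat_prod I ?A (mat_pow I M k) l j = mat_pow I M k l j - mat_pow I M (Suc k) l j"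
        using I by (simp del: mat_pow.simps)
      then show "Adj i l * mat_pow I M k l j - Adj i l * mat_pow I M (Suc k) l j
          = Adj i l * mat_prod I ?A (mat_pow I M k) l j"
        by (simp only: right_diff_distrib)
    qed
    also have "\<dots> = mat_prod I (\<lambda>i j. ?d * mat_one i j) (mat_pow I M k) i j"
      unfolding mat_prod_assoc[symmetric] using that by (intro mat_prod_cong) (auto simp: adj)
    also have "\<dots> = ?d * mat_prod I mat_one (mat_pow I M k) i j"
      by (simp add: mat_prod_def sum_distrib_left mult.assoc)
    finally show ?thesis using I that by (simp add: algebra_simps)
  qed
  have expand: "Adj i j = ?d * (\<Sum>k<K. mat_pow I M k i j) + mat_prod I Adj (mat_pow I M K) i j"
    if ij: "i \<in> I" "j \<in> I" for i j K
  proof (induction K)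
    case 0
    then show ?case using I ij by simp
  next
    case (Suc K)
    then show ?case using step[OF ij, of K] by (simp add: algebra_simps del: mat_pow.simps)
  qed
  define T where "T k = trace_on I (mat_prod I ?D (mat_pow I M k))" for k
  \<comment> \<open>\<open>T k\<close> is the derivative of \<open>trace (M ^ Suc k)\<close> divided by \<open>Suc k\<close>.\<close>
  have T_nth: "fps_nth (T k) n
      = of_nat (Suc n) / of_nat (Suc k) * fps_nth (trace_on I (mat_pow I M (Suc k))) (Suc n)" for k n
  proof -
    have "trace_on I (mat_prod I (\<lambda>i j. fps_deriv (mat_pow I M (Suc k) i j)) (mat_pow I M 0))
        = fps_deriv (trace_on I (mat_pow I M (Suc k)))"
      using I by (simp add: trace_on_def fps_deriv_sum del: mat_pow.simps(2))
    then have "fps_deriv (trace_on I (mat_pow I M (Suc k))) = of_nat (Suc k) * T k"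
      using trace_deriv_mat_pow[OF I, of M k 0] by (simp add: T_def)
    then have "fps_nth (fps_deriv (trace_on I (mat_pow I M (Suc k)))) n
        = of_nat (Suc k) * fps_nth (T k) n"
      by (metis fps_mult_left_const_nth fps_of_nat)
    then show ?thesis
      by (simp add: field_simps del: mat_pow.simps of_nat_Suc)
  qed
  have small: "fps_nth (X i j) n = 0"
    if "X = mat_prod I A (mat_pow I M K)" "n < K" "j \<in> I" for A X n K and i j :: 'i
    unfolding that mat_prod_def fps_sum_nth fps_mult_nth
    using that by (intro sum.neutral ballI) (auto intro!: mat_pow_nth_eq_0 M0)
  have T_small: "fps_nth (T k) n = 0" if "n < k" for k n
    unfolding T_def trace_on_def fps_sum_nth using that by (intro sum.neutral ballI small[OF refl])
  show ?thesis
  proof (rule fps_ext)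
    fix n
    \<comment> \<open>The smallest exponent for which the remainder \<open>adj A * M ^ K\<close> does not reach the coefficient \<open>n\<close>.\<close>
    let ?K = "Suc n"
    have "fps_deriv ?d = - trace_on I (mat_prod I ?D
        (\<lambda>i j. ?d * (\<Sum>k<?K. mat_pow I M k i j) + mat_prod I Adj (mat_pow I M ?K) i j))"
      unfolding deriv by (intro arg_cong[of _ _ uminus] trace_on_cong mat_prod_cong refl expand)
    also have "trace_on I (mat_prod I ?D
        (\<lambda>i j. ?d * (\<Sum>k<?K. mat_pow I M k i j) + mat_prod I Adj (mat_pow I M ?K) i j))
      = ?d * (\<Sum>k<?K. T k) + trace_on I (mat_prod I (mat_prod I ?D Adj) (mat_pow I M ?K))"
    proof -
      have "(\<Sum>k<?K. T k) = trace_on I (mat_prod I ?D (\<lambda>i j. \<Sum>k<?K. mat_pow I M k i j))"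
        unfolding T_def trace_on_def mat_prod_def sum_distrib_left
        by (subst sum.swap, rule sum.cong, simp, subst sum.swap, simp)
      then show ?thesis
        by (simp add: mat_prod_assoc del: mat_pow.simps sum.lessThan_Suc)
          (simp add: trace_on_def mat_prod_def[of I ?D] algebra_simps sum.distrib sum_distrib_left
            del: mat_pow.simps sum.lessThan_Suc)
    qed
    also have "fps_nth (- (?d * (\<Sum>k<?K. T k) + trace_on I (mat_prod I (mat_prod I ?D Adj) (mat_pow I M ?K)))) n
       = - fps_nth (?d * (\<Sum>k<?K. T k)) n"
      by (simp add: trace_on_def fps_sum_nth small[OF refl] del: mat_pow.simps)
    also have "fps_nth (?d * (\<Sum>k<?K. T k)) n = fps_nth (?d * trace_log_deriv I M) n"
      unfolding fps_mult_nth
    proof (intro sum.cong refl)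
      fix i assume "i \<in> {0..n}"
      have "fps_nth (\<Sum>k<?K. T k) (n - i) = (\<Sum>k\<le>n - i. fps_nth (T k) (n - i))"
        unfolding fps_sum_nth by (intro sum.mono_neutral_right) (auto simp: T_small)
      then show "fps_nth ?d i * fps_nth (\<Sum>k<?K. T k) (n - i) = fps_nth ?d i * fps_nth (trace_log_deriv I M) (n - i)"
        by (simp only: T_nth trace_log_deriv_def fps_nth_Abs_fps)
    qed
    finally show "fps_nth (fps_deriv ?d) n = fps_nth (- trace_log_deriv I M * ?d) n"
      by (simp add: mult.commute)
  qed
qed

text \<open>At \<open>z = 0\<close> the matrix becomes the identity, so only the identity permutation contributes.\<close>
lemma det_on_one_minus_nth_0:
  fixes M :: "'i \<Rightarrow> 'i \<Rightarrow> 'a::field_char_0 fps"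
  assumes I: "finite I" and M0: "\<And>i j. i \<in> I \<Longrightarrow> j \<in> I \<Longrightarrow> fps_nth (M i j) 0 = 0"
  shows "fps_nth (det_on I (\<lambda>i j. mat_one i j - M i j)) 0 = 1"
proof -
  have prod0: "fps_nth (prod f S) 0 = (\<Prod>i\<in>S. fps_nth (f i) 0)" for f :: "'i \<Rightarrow> 'a fps" and S
    by (induction S rule: infinite_finite_induct) auto
  have "fps_nth (det_on I (\<lambda>i j. mat_one i j - M i j)) 0
      = (\<Sum>\<pi> | \<pi> permutes I. of_int (sign \<pi>) * (\<Prod>i\<in>I. if i = \<pi> i then 1 else 0))"
    unfolding det_on_def fps_sum_nth
  proof (intro sum.cong refl)
    fix \<pi> assume "\<pi> \<in> {\<pi>. \<pi> permutes I}"
    then have "\<pi> i \<in> I" if "i \<in> I" for i using that by (simp add: permutes_in_image)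
    then have "(\<Prod>i\<in>I. fps_nth (mat_one i (\<pi> i) - M i (\<pi> i)) 0) = (\<Prod>i\<in>I. if i = \<pi> i then 1 else 0)"
      by (intro prod.cong refl) (simp add: mat_one_def M0)
    then show "fps_nth (of_int (sign \<pi>) * (\<Prod>i\<in>I. mat_one i (\<pi> i) - M i (\<pi> i))) 0
        = of_int (sign \<pi>) * (\<Prod>i\<in>I. if i = \<pi> i then 1 else 0)"
      by (simp add: prod0 fps_of_int[symmetric])
  qed
  also have "\<dots> = (\<Sum>\<pi> | \<pi> permutes I. if \<pi> = id then 1 else 0)"
  proof (intro sum.cong refl)
    fix \<pi> assume p: "\<pi> \<in> {\<pi>. \<pi> permutes I}"
    have "\<exists>i\<in>I. i \<noteq> \<pi> i" if "\<pi> \<noteq> id"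
      using that p by (metis eq_id_iff mem_Collect_eq permutes_not_in)
    then show "of_int (sign \<pi>) * (\<Prod>i\<in>I. if i = \<pi> i then 1 else 0) = (if \<pi> = id then 1 else (0::'a))"
      using I by auto
  qed
  also have "\<dots> = 1"
    using I by (simp add: finite_permutations permutes_id)
  finally show ?thesis .
qed

lemma fps_linear_ode_unique:
  fixes y w :: "'a::field_char_0 fps"
  assumes "fps_deriv y = g * y" "fps_deriv w = g * w" "fps_nth y 0 = fps_nth w 0"
  shows "y = w"
proof -
  define d where "d = y - w"
  have d: "fps_deriv d = g * d" "fps_nth d 0 = 0"
    using assms by (simp_all add: d_def algebra_simps)
  have "fps_nth d n = 0" for n
  proof (induction n rule: less_induct)
    case (less n)
    show ?case
    proof (cases n)
      case 0
      then show ?thesis using d by simp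
    next
      case (Suc m)
      have "of_nat (Suc m) * fps_nth d (Suc m) = fps_nth (g * d) m"
        using d(1) by (metis Suc_eq_plus1 fps_deriv_nth)
      also have "\<dots> = 0"
        unfolding fps_mult_nth using less Suc by (intro sum.neutral) auto
      finally show ?thesis using Suc by (simp del: of_nat_Suc)
    qed
  qed
  then have "d = 0" by (simp add: fps_eq_iff)
  then show ?thesis by (simp add: d_def)
qed

text \<open>
  Sylvester's identity \<open>det (1 - U W) = det (1 - W U)\<close> for rectangular factors: the powers of \<open>U W\<close> and
  \<open>W U\<close> have the same traces, hence both determinants solve the same differential equation.
\<close>
lemma det_on_one_minus_prod_commute:
  fixes U :: "'i \<Rightarrow> 'j \<Rightarrow> 'a::field_char_0 fps"
  assumes "finite I" "finite J"
    and U0: "\<And>i j. i \<in> I \<Longrightarrow> j \<in> J \<Longrightarrow> fps_nth (W j i) 0 = 0"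
  shows "det_on I (\<lambda>i k. mat_one i k - mat_prod J U W i k)
    = det_on J (\<lambda>j l. mat_one j l - mat_prod I W U j l)"
proof (rule fps_linear_ode_unique)
  have M0: "fps_nth (mat_prod J U W i k) 0 = 0" if "i \<in> I" "k \<in> I" for i k
    using that by (simp add: mat_prod_def fps_sum_nth U0)
  have N0: "fps_nth (mat_prod I W U j l) 0 = 0" if "j \<in> J" "l \<in> J" for j l
    using that by (simp add: mat_prod_def fps_sum_nth U0)
  show "fps_deriv (det_on I (\<lambda>i k. mat_one i k - mat_prod J U W i k))
    = - trace_log_deriv I (mat_prod J U W) * det_on I (\<lambda>i k. mat_one i k - mat_prod J U W i k)"
    by (rule fps_deriv_det_one_minus[OF assms(1) M0])
  have "trace_log_deriv I (mat_prod J U W) = trace_log_deriv J (mat_prod I W U)"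
    unfolding trace_log_deriv_def trace_on_pow_commute[OF assms(1,2)] ..
  then show "fps_deriv (det_on J (\<lambda>i k. mat_one i k - mat_prod I W U i k))
    = - trace_log_deriv I (mat_prod J U W) * det_on J (\<lambda>i k. mat_one i k - mat_prod I W U i k)"
    using fps_deriv_det_one_minus[OF assms(2) N0] by simp
  show "fps_nth (det_on I (\<lambda>i k. mat_one i k - mat_prod J U W i k)) 0
     = fps_nth (det_on J (\<lambda>i k. mat_one i k - mat_prod I W U i k)) 0"
    by (simp add: det_on_one_minus_nth_0[OF assms(1) M0] det_on_one_minus_nth_0[OF assms(2) N0])
qed


section \<open>Counting periodic sequences by cyclic factorizations\<close>

definition window :: "(int \<Rightarrow> 's) \<Rightarrow> int \<Rightarrow> nat \<Rightarrow> 's list" where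
  "window x i n = map (\<lambda>k. x (i + int k)) [0..<n]"

definition periodic :: "nat \<Rightarrow> (int \<Rightarrow> 's) \<Rightarrow> bool" where
  "periodic n x \<longleftrightarrow> (\<forall>i. x (i + int n) = x i)"

text \<open>
  In the applications \<open>L\<close> is the set of closed paths, and the lists are the cyclic sequences of words of
  the code \<open>D\<close> with a marked first word.
\<close>
definition factorizations :: "'s list set \<Rightarrow> 's list set \<Rightarrow> nat \<Rightarrow> 's list list set" where
  "factorizations D L n = {cs \<in> lists D. concat cs \<in> L \<and> length (concat cs) = n}"

lemma length_window [simp]: "length (window x i n) = n"
  by (simp add: window_def)

lemma window_0 [simp]: "window x i 0 = []"
  by (simp add: window_def)

lemma window_1 [simp]: "window x i (Suc 0) = [x i]"
  by (simp add: window_def)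

lemma nth_window [simp]: "k < n \<Longrightarrow> window x i n ! k = x (i + int k)"
  by (simp add: window_def)

lemma window_add: "window x i (k + l) = window x i k @ window x (i + int k) l"
  by (rule nth_equalityI) (auto simp: nth_append)

lemma window_split: "k \<le> l \<Longrightarrow> window x i l = window x i k @ window x (i + int k) (l - k)"
  using window_add[of x i k "l - k"] by simp

lemma periodic_add_mult: "periodic n x \<Longrightarrow> x (i + j * int n) = x i"
proof (induction j rule: int_induct[where k = 0])
  case base
  then show ?case by simp
next
  case (step1 j)
  have "x (i + (j + 1) * int n) = x ((i + j * int n) + int n)" by (simp add: algebra_simps)
  then show ?case using step1 by (simp add: periodic_def)
next
  case (step2 j)
  have "x (i + (j - 1) * int n) = x ((i + (j - 1) * int n) + int n)"
    using step2.prems by (simp add: periodic_def)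
  also have "(i + (j - 1) * int n) + int n = i + j * int n" by (simp add: algebra_simps)
  finally show ?case using step2 by simp
qed

lemma window_periodic: "periodic n x \<Longrightarrow> window x (i + j * int n) l = window x i l"
proof -
  assume p: "periodic n x"
  have "x (i + j * int n + int k) = x (i + int k)" for k
    using periodic_add_mult[OF p, of "i + int k" j] by (simp add: add_ac)
  then show ?thesis by (simp add: window_def)
qed

lemma window_mult: "periodic n x \<Longrightarrow> window x i (k * n) = concat (replicate k (window x i n))"
proof (induction k)
  case (Suc k)
  then show ?case using window_periodic[of n x i 1] by (simp add: window_add)
qed simp

text \<open>The periodic sequence that reads the word \<open>w\<close> from position \<open>m\<close> on.\<close>
definition extend :: "nat \<Rightarrow> 's list \<Rightarrow> int \<Rightarrow> 's" where
  "extend m w i = w ! nat ((i - int m) mod int (length w))"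

lemma periodic_extend: "periodic (length w) (extend m w)"
proof -
  have "(i + int (length w) - int m) mod int (length w) = (i - int m) mod int (length w)" for i
    by (metis add_diff_eq diff_add_eq mod_add_self2)
  then show ?thesis by (simp add: periodic_def extend_def)
qed

lemma window_extend: "window (extend m w) (int m) (length w) = w"
  by (rule nth_equalityI) (auto simp: extend_def)

lemma extend_window:
  assumes "periodic n x" "n > 0"
  shows "extend m (window x (int m) n) = x"
proof
  fix i
  define r where "r = (i - int m) mod int n"
  have r: "0 \<le> r" "r < int n" using assms(2) by (simp_all add: r_def)
  have "extend m (window x (int m) n) i = x (int m + r)"
    using r by (simp add: extend_def r_def[symmetric])
  also have "\<dots> = x (int m + r + ((i - int m) div int n) * int n)"
    by (rule periodic_add_mult[OF assms(1), symmetric])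
  also have "int m + r + ((i - int m) div int n) * int n = i"
    unfolding r_def by (simp add: algebra_simps minus_mod_eq_mult_div)
  finally show "extend m (window x (int m) n) i = x i" .
qed

text \<open>
  Moving a window of length \<open>n\<close> by one position exchanges its first position with one that is congruent
  to it modulo \<open>n\<close>.
\<close>
lemma card_periodic_shift:
  fixes P :: "int \<Rightarrow> bool"
  assumes "\<And>i. P (i + int n) = P i"
  shows "card {k. k < n \<and> P (i + int k)} = card {k. k < n \<and> P (int k)}"
proof -
  have step: "card {k. k < n \<and> P (i + 1 + int k)} = card {k. k < n \<and> P (i + int k)}" for i
  proof (cases n)
    case (Suc n')
    have "{k. k < n \<and> P (i + int k)} = (if P i then {0} else {}) \<union> Suc ` {k. k < n' \<and> P (i + 1 + int k)}"
      using Suc by (auto simp: image_iff less_Suc_eq_0_disj algebra_simps)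
    moreover have "{k. k < n \<and> P (i + 1 + int k)} = (if P i then {n'} else {}) \<union> {k. k < n' \<and> P (i + 1 + int k)}"
      using assms[of i] Suc by (auto simp: less_Suc_eq algebra_simps)
    ultimately show ?thesis
      by (auto simp: card_image card_Un_disjoint)
  qed simp
  show ?thesis
  proof (induction i rule: int_induct[where k = 0])
    case (step1 i)
    then show ?case using step[of i] by simp
  next
    case (step2 i)
    then show ?case using step[of "i - 1"] by simp
  qed simp
qed

lemma finite_factorizations:
  assumes "finite A" "D \<subseteq> lists A" "[] \<notin> D"
  shows "finite (factorizations D L n)"
proof (rule finite_subset)
  let ?W = "{w. set w \<subseteq> A \<and> length w \<le> n}"
  show "finite {cs. set cs \<subseteq> ?W \<and> length cs \<le> n}"
    using finite_lists_length_le[OF finite_lists_length_le[OF assms(1)]] .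
  show "factorizations D L n \<subseteq> {cs. set cs \<subseteq> ?W \<and> length cs \<le> n}"
  proof
    fix cs assume "cs \<in> factorizations D L n"
    then have cs: "set cs \<subseteq> D" "length (concat cs) = n" by (auto simp: factorizations_def)
    have "length c \<le> length (concat cs)" if "c \<in> set cs" for c
      using that by (induction cs) auto
    moreover have "length cs \<le> length (concat cs)"
      using cs(1) assms(3)
    proof (induction cs)
      case (Cons c cs)
      then have "c \<noteq> []" by auto
      then have "length c \<ge> 1" by (cases c) auto
      then show ?case using Cons by simp
    qed simp
    ultimately show "cs \<in> {cs. set cs \<subseteq> ?W \<and> length cs \<le> n}"
      using cs assms(2) by fastforce
  qed
qed

text \<open>
  Double counting. A pair of a point \<open>x\<close> and a cut position \<open>m\<close> in \<open>{0..<n}\<close> is the same as a pair of a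
  position \<open>m\<close> and a factorization of a word of length \<open>n\<close>: cut \<open>x\<close> along one period starting at \<open>m\<close>, and
  conversely repeat the factorized word periodically from \<open>m\<close> on. Under this bijection the number of
  cuts per period is the number of factors, so giving each pair the inverse of that number as weight
  counts every point once and every factorization \<open>n / length cs\<close> times.
\<close>
lemma card_by_cuts:
  fixes Y :: "(int \<Rightarrow> 's) set" and cut :: "(int \<Rightarrow> 's) \<Rightarrow> int \<Rightarrow> bool"
  assumes n: "n > 0"
    and fin: "finite (factorizations D L n)"
    and Y_periodic: "\<And>x. x \<in> Y \<Longrightarrow> periodic n x"
    and cut_periodic: "\<And>x i. x \<in> Y \<Longrightarrow> cut x (i + int n) = cut x i"
    and cut_ex: "\<And>x. x \<in> Y \<Longrightarrow> \<exists>i. cut x i"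
    and block: "\<And>x i l. x \<in> Y \<Longrightarrow> cut x i \<Longrightarrow> cut x (i + int l) \<Longrightarrow> 0 < l \<Longrightarrow>
      (\<And>k. 0 < k \<Longrightarrow> k < l \<Longrightarrow> \<not> cut x (i + int k)) \<Longrightarrow> window x i l \<in> D"
    and window_L: "\<And>x i. x \<in> Y \<Longrightarrow> window x i n \<in> L"
    and realize: "\<And>x m cs. cs \<in> factorizations D L n \<Longrightarrow> periodic n x \<Longrightarrow>
      window x (int m) n = concat cs \<Longrightarrow> x \<in> Y \<and> cut x (int m)"
    and unique: "\<And>cs ds. cs \<in> lists D \<Longrightarrow> ds \<in> lists D \<Longrightarrow> concat cs = concat ds \<Longrightarrow> cs = ds"
  shows "of_nat (card Y) = (\<Sum>cs\<in>factorizations D L n. of_nat n / of_nat (length cs) :: 'a::field_char_0)"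
proof -
  let ?Q = "factorizations D L n"
  define N where "N x = card {k. k < n \<and> cut x (int k)}" for x
  define P where "P = (SIGMA x:Y. {m. m < n \<and> cut x (int m)})"
  have factor: "\<exists>cs\<in>lists D. concat cs = window x i l \<and> length cs = card {k. k < l \<and> cut x (i + int k)}"
    if "x \<in> Y" "cut x i" "cut x (i + int l)" for x i l
    using that(2,3)
  proof (induction l arbitrary: i rule: less_induct)
    case (less l)
    show ?case
    proof (cases "l = 0")
      case True
      then show ?thesis by (intro bexI[of _ "[]"]) auto
    next
      case False
      \<comment> \<open>The first factor ends at the next cut.\<close>
      define l' where "l' = (LEAST k. 0 < k \<and> cut x (i + int k))"
      have ex: "0 < l \<and> cut x (i + int l)" using False less.prems by simp
      then have l': "0 < l'" "cut x (i + int l')" "l' \<le> l"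
        unfolding l'_def using LeastI[of "\<lambda>k. 0 < k \<and> cut x (i + int k)", OF ex]
          Least_le[of "\<lambda>k. 0 < k \<and> cut x (i + int k)", OF ex] by auto
      have gap: "\<not> cut x (i + int k)" if "0 < k" "k < l'" for k
        using not_less_Least[of k "\<lambda>k. 0 < k \<and> cut x (i + int k)"] that by (auto simp: l'_def)
      have D: "window x i l' \<in> D"
        using block[OF that(1) less.prems(1) l'(2) l'(1)] gap by blast
      have "cut x (i + int l' + int (l - l'))" using less.prems(2) l'(3) by simp
      then obtain cs where cs: "cs \<in> lists D" "concat cs = window x (i + int l') (l - l')"
        "length cs = card {k. k < l - l' \<and> cut x (i + int l' + int k)}"
        using less.IH[of "l - l'" "i + int l'"] l' False by auto
      have split: "{k. k < l \<and> cut x (i + int k)}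
          = insert 0 ((\<lambda>k. k + l') ` {k. k < l - l' \<and> cut x (i + int l' + int k)})"
      proof (intro equalityI subsetI)
        fix k assume k: "k \<in> {k. k < l \<and> cut x (i + int k)}"
        show "k \<in> insert 0 ((\<lambda>k. k + l') ` {k. k < l - l' \<and> cut x (i + int l' + int k)})"
        proof (cases "k = 0")
          case False
          then have "l' \<le> k" using gap[of k] k by force
          then show ?thesis using k by (intro insertI2 image_eqI[of _ _ "k - l'"]) auto
        qed simp
      qed (use less.prems(1) l' False in \<open>auto simp: add_ac\<close>)
      have "card {k. k < l \<and> cut x (i + int k)} = Suc (length cs)"
        unfolding split cs(3) using l'(1) by (subst card_insert_disjoint) (auto simp: card_image)
      then show ?thesis
        using cs D l'(3) by (intro bexI[of _ "window x i l' # cs"]) (auto simp: window_split[of l' l])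
    qed
  qed
  have N_shift: "card {k. k < n \<and> cut x (i + int k)} = N x" if "x \<in> Y" for x i
    unfolding N_def by (rule card_periodic_shift) (rule cut_periodic[OF that])
  define F where "F = (\<lambda>(m :: nat, cs :: 's list list). (extend m (concat cs), m))"
  have F_Y: "extend m (concat cs) \<in> Y" "cut (extend m (concat cs)) (int m)"
    if "cs \<in> ?Q" for m cs
  proof -
    have len: "length (concat cs) = n" using that by (simp add: factorizations_def)
    show "extend m (concat cs) \<in> Y" "cut (extend m (concat cs)) (int m)"
      using realize[OF that, of "extend m (concat cs)" m] periodic_extend[of "concat cs" m]
        window_extend[of m "concat cs"] by (simp_all only: len)
  qed
  have F_length: "N (extend m (concat cs)) = length cs" if "cs \<in> ?Q" for m cs
  proof -
    let ?x = "extend m (concat cs)"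
    have Y: "?x \<in> Y" "cut ?x (int m)" using F_Y[OF that] by auto
    then have "cut ?x (int m + int n)" using cut_periodic by simp
    then obtain ds where "ds \<in> lists D" "concat ds = window ?x (int m) n" "length ds = N ?x"
      using factor[OF Y, of n] N_shift[OF Y(1)] by auto
    moreover have "window ?x (int m) n = concat cs"
      using window_extend[of m "concat cs"] that by (simp add: factorizations_def)
    ultimately show ?thesis using unique[of ds cs] that by (auto simp: factorizations_def)
  qed
  have "inj_on F ({..<n} \<times> ?Q)"
  proof (rule inj_onI)
    fix p q assume p: "p \<in> {..<n} \<times> ?Q" and q: "q \<in> {..<n} \<times> ?Q" and eq: "F p = F q"
    obtain m cs m' ds where pq: "p = (m, cs)" "q = (m', ds)" by (cases p, cases q)
    then have eq': "m' = m" "extend m (concat cs) = extend m (concat ds)"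
      using eq by (auto simp: F_def)
    have "length (concat cs) = length (concat ds)"
      using p q pq by (auto simp: factorizations_def)
    then have "concat cs = concat ds"
      using window_extend[of m "concat cs"] window_extend[of m "concat ds"] eq'(2) by metis
    then have "cs = ds" using unique p q pq by (auto simp: factorizations_def)
    then show "p = q" using pq eq' by simp
  qed
  moreover have "F ` ({..<n} \<times> ?Q) = P"
  proof (intro equalityI subsetI)
    fix p assume "p \<in> F ` ({..<n} \<times> ?Q)"
    then show "p \<in> P" by (auto simp: F_def P_def F_Y)
  next
    fix p assume "p \<in> P"
    then obtain x m where p: "p = (x, m)" "x \<in> Y" "m < n" "cut x (int m)" by (auto simp: P_def)
    then have "cut x (int m + int n)" using cut_periodic by simp
    then obtain cs where cs: "cs \<in> lists D" "concat cs = window x (int m) n"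
      using factor[OF p(2,4), of n] by blast
    have "cs \<in> ?Q" using cs window_L[OF p(2)] by (simp add: factorizations_def)
    moreover have "F (m, cs) = p"
      using p cs extend_window[OF Y_periodic[OF p(2)] n, of m] by (simp add: F_def)
    ultimately show "p \<in> F ` ({..<n} \<times> ?Q)" using p by (auto intro!: image_eqI[of _ _ "(m, cs)"])
  qed
  ultimately have F: "bij_betw F ({..<n} \<times> ?Q) P" by (simp add: bij_betw_def)
  have N_pos: "N x > 0" if x: "x \<in> Y" for x
  proof -
    obtain i where "cut x i" using cut_ex[OF x] by blast
    then have "{k. k < n \<and> cut x (i + int k)} \<noteq> {}" using n by force
    then show ?thesis using N_shift[OF x, of i] by (metis card_gt_0_iff finite_Collect_conjI finite_Collect_less_nat)
  qed
  have "finite P" using bij_betw_finite[OF F] fin by simp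
  moreover have "Y \<subseteq> fst ` P"
  proof
    fix x assume x: "x \<in> Y"
    then have "{k. k < n \<and> cut x (int k)} \<noteq> {}" using N_pos[OF x] by (auto simp: N_def card_gt_0_iff)
    then show "x \<in> fst ` P" using x by (force simp: P_def)
  qed
  ultimately have "finite Y" by (meson finite_imageI finite_subset)
  have "of_nat (card Y) = (\<Sum>x\<in>Y. \<Sum>m | m < n \<and> cut x (int m). 1 / of_nat (N x) :: 'a)"
  proof -
    have one: "(\<Sum>m | m < n \<and> cut x (int m). 1 / of_nat (N x) :: 'a) = 1" if "x \<in> Y" for x
      using N_pos[OF that] by (simp only: sum_constant N_def[symmetric]) simp
    have "(\<Sum>x\<in>Y. \<Sum>m | m < n \<and> cut x (int m). 1 / of_nat (N x) :: 'a) = (\<Sum>x\<in>Y. 1)"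
      by (rule sum.cong[OF refl one])
    then show ?thesis by (simp only: sum_constant mult_1_right)
  qed
  also have "\<dots> = (\<Sum>p\<in>P. 1 / of_nat (N (fst p)))"
    unfolding P_def using \<open>finite Y\<close> by (subst sum.Sigma) (auto simp: case_prod_beta)
  also have "\<dots> = (\<Sum>q\<in>{..<n} \<times> ?Q. 1 / of_nat (N (fst (F q))))"
    by (rule sum.reindex_bij_betw[OF F, symmetric])
  also have "\<dots> = (\<Sum>q\<in>{..<n} \<times> ?Q. 1 / of_nat (length (snd q)))"
    by (intro sum.cong refl) (auto simp: F_def F_length)
  also have "\<dots> = (\<Sum>m\<in>{..<n}. \<Sum>cs\<in>?Q. 1 / of_nat (length cs))"
    unfolding sum.cartesian_product case_prod_beta ..
  also have "\<dots> = (\<Sum>cs\<in>?Q. of_nat n / of_nat (length cs))"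
    by (simp add: sum_distrib_left)
  finally show ?thesis .
qed


section \<open>Periodic points and their drift\<close>

definition subshift_of :: "'s list set \<Rightarrow> (int \<Rightarrow> 's) set" where
  "subshift_of A = {x. \<forall>i. \<forall>n>0. window x i n \<in> A}"

abbreviation height :: "('s \<Rightarrow> int) \<Rightarrow> 's list \<Rightarrow> int" where
  "height h w \<equiv> sum_list (map h w)"

text \<open>
  Think of the height as an altitude. Read from right to left, a descent is a first passage of the
  accumulated height to a value \<open>\<le> 0\<close>; read from left to right, an ascent is a first passage to a value
  \<open>\<ge> 0\<close>. A single letter of the right sign belongs to the set as well.
\<close>
definition descents :: "('s \<Rightarrow> int) \<Rightarrow> 's list set \<Rightarrow> 's list set" where
  "descents h A = {c \<in> A. c \<noteq> [] \<and> height h c \<le> 0 \<and>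
     (\<forall>u v. c = u @ v \<longrightarrow> u \<noteq> [] \<longrightarrow> v \<noteq> [] \<longrightarrow> height h v > 0)}"

definition ascents :: "('s \<Rightarrow> int) \<Rightarrow> 's list set \<Rightarrow> 's list set" where
  "ascents h A = {c \<in> A. c \<noteq> [] \<and> height h c \<ge> 0 \<and>
     (\<forall>u v. c = u @ v \<longrightarrow> u \<noteq> [] \<longrightarrow> v \<noteq> [] \<longrightarrow> height h u < 0)}"

text \<open>
  For a periodic point of non-positive drift this says that no descent straddles the position: a window
  of positive height starting at \<open>i\<close> would have to be extended to the left, across \<open>i\<close>, until its height
  has come down to a value \<open>\<le> 0\<close>.
\<close>
definition cut :: "('s \<Rightarrow> int) \<Rightarrow> (int \<Rightarrow> 's) \<Rightarrow> int \<Rightarrow> bool" where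
  "cut h x i \<longleftrightarrow> (\<forall>l. height h (window x i l) \<le> 0)"

text \<open>
  Descents form a suffix code: a proper suffix of a descent has positive height and is therefore not a
  descent. The last words of two factorizations of the same word are suffixes of each other, so they
  agree.
\<close>
lemma descents_factorization_unique:
  assumes "cs \<in> lists (descents h A)" "ds \<in> lists (descents h A)" "concat cs = concat ds"
  shows "cs = ds"
  using assms
proof (induction cs arbitrary: ds rule: rev_induct)
  case Nil
  then show ?case by (cases ds) (auto simp: descents_def)
next
  case (snoc c cs)
  then have c: "c \<in> descents h A" by simp
  then have "ds \<noteq> []" using snoc.prems(3) by (auto simp: descents_def)
  then obtain ds' d where ds: "ds = ds' @ [d]" by (metis append_butlast_last_id)
  then have d: "d \<in> descents h A" and eq: "concat cs @ c = concat ds' @ d" using snoc.prems by auto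
  have no: "u = []" if "u @ a = b" "a \<in> descents h A" "b \<in> descents h A" for u a b
    using that unfolding descents_def by fastforce
  from eq consider u where "u @ c = d" | u where "u @ d = c"
    by (auto simp: append_eq_append_conv2)
  then have "c = d"
    using no[OF _ c d] no[OF _ d c] by cases auto
  with snoc eq ds show ?case by auto
qed

text \<open>
  A prefix consists of complete descents and a prefix of one more descent, whose height is that of the
  descent minus the positive height of the remaining suffix.
\<close>
lemma height_prefix_descents:
  assumes "cs \<in> lists (descents h A)" "concat cs = u @ v"
  shows "height h u \<le> 0"
  using assms
proof (induction cs arbitrary: u)
  case Nil
  then show ?case by simp
next
  case (Cons c cs)
  then have c: "c \<in> descents h A" and eq: "c @ concat cs = u @ v" by auto
  show ?case
  proof (cases "length u < length c")
    case True
    then obtain w where w: "c = u @ w" "w \<noteq> []"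
      using eq by (auto simp: append_eq_append_conv2)
    then show ?thesis
      using c by (cases "u = []") (force simp: descents_def)+
  next
    case False
    then obtain w where w: "u = c @ w" "concat cs = w @ v"
      using eq by (auto simp: append_eq_append_conv2)
    then have "height h w \<le> 0" using Cons by auto
    then show ?thesis using w c by (simp add: descents_def)
  qed
qed

lemma height_window_shift:
  assumes "periodic n x"
  shows "height h (window x i n) = height h (window x j n)"
proof -
  have step: "height h (window x (i + 1) n) = height h (window x i n)" for i
  proof -
    have "height h (window x i (n + 1)) = height h (window x i n) + h (x i)"
      using assms by (simp add: window_add periodic_def del: Suc_eq_plus1 Suc_eq_plus1_left One_nat_def) (simp add: window_def)
    moreover have "height h (window x i (1 + n)) = h (x i) + height h (window x (i + 1) n)"
      by (simp only: window_add) simp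
    ultimately show ?thesis by (simp add: add.commute)
  qed
  have "height h (window x i n) = height h (window x 0 n)" for i
  proof (induction i rule: int_induct[where k = 0])
    case (step1 i)
    then show ?case using step[of i] by simp
  next
    case (step2 i)
    then show ?case using step[of "i - 1"] by simp
  qed simp
  then show ?thesis by metis
qed

text \<open>
  A position in \<open>{0..<n}\<close> at which the accumulated height is maximal is a cut: as the drift is
  non-positive, later periods do not exceed that maximum either.
\<close>
lemma cut_exists:
  assumes x: "periodic n x" and n: "n > 0" and drift: "height h (window x 0 n) \<le> 0"
  shows "\<exists>i. cut h x i"
proof -
  define f where "f l = height h (window x 0 l)" for l
  obtain m where m: "m < n" "\<And>l. l < n \<Longrightarrow> f l \<le> f m"
  proof -
    have fin: "finite (f ` {..<n})" and ne: "f ` {..<n} \<noteq> {}" using n by auto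
    from Max_in[OF fin ne] obtain m where "m < n" "f m = Max (f ` {..<n})" by auto
    then show ?thesis using that[of m] Max_ge[OF fin] by simp
  qed
  have f_max: "f l \<le> f m" for l
  proof (induction l rule: less_induct)
    case (less l)
    show ?case
    proof (cases "l < n")
      case False
      then have "f l = f n + f (l - n)"
        using window_split[of n l x 0] window_periodic[OF x, of 0 1 "l - n"] by (simp add: f_def)
      also have "\<dots> \<le> f m" using less[of "l - n"] drift n False by (simp add: f_def)
      finally show ?thesis .
    qed (use m in auto)
  qed
  have "cut h x (int m)"
    unfolding cut_def
  proof
    fix l
    have "f (m + l) = f m + height h (window x (int m) l)" by (simp add: f_def window_add)
    then show "height h (window x (int m) l) \<le> 0" using f_max[of "m + l"] by simp
  qed
  then show ?thesis ..
qed

text \<open>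
  Otherwise consider the last position \<open>m\<close> strictly between the two cuts from which the height up to
  the second cut is non-positive. From there no window ending before the second cut has positive
  height, by the choice of \<open>m\<close>, and no longer window has, because the second position is a cut. So \<open>m\<close>
  would be a cut itself.
\<close>
lemma height_between_cuts:
  assumes cut: "cut h x (i + int l)" and gap: "\<And>k. 0 < k \<Longrightarrow> k < l \<Longrightarrow> \<not> cut h x (i + int k)"
    and k: "0 < k" "k < l"
  shows "height h (window x (i + int k) (l - k)) > 0"
proof (rule ccontr)
  define bad where "bad k \<longleftrightarrow> 0 < k \<and> k < l \<and> height h (window x (i + int k) (l - k)) \<le> 0" for k
  assume "\<not> ?thesis"
  then have "{k. bad k} \<noteq> {}" using k by (auto simp: bad_def)
  moreover have fin: "finite {k. bad k}" by (simp add: bad_def)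
  ultimately have bad: "bad (Max {k. bad k})" using Max_in by blast
  define m where "m = Max {k. bad k}"
  have last: "\<not> bad k" if "m < k" for k
    using that Max_ge[OF fin, of k] by (auto simp: m_def)
  have m: "0 < m" "m < l" "height h (window x (i + int m) (l - m)) \<le> 0"
    using bad by (auto simp: bad_def m_def)
  have "cut h x (i + int m)"
    unfolding cut_def
  proof
    fix t
    show "height h (window x (i + int m) t) \<le> 0"
    proof (cases "m + t < l")
      case True
      show ?thesis
      proof (cases "t = 0")
        case False
        have "height h (window x (i + int m) (l - m))
            = height h (window x (i + int m) t) + height h (window x (i + int (m + t)) (l - (m + t)))"
          using True window_split[of t "l - m" x "i + int m"] by (simp add: add.assoc)
        moreover have "height h (window x (i + int (m + t)) (l - (m + t))) > 0"
          using last[of "m + t"] False True m by (auto simp: bad_def)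
        ultimately show ?thesis using m(3) by simp
      qed simp
    next
      case False
      have "height h (window x (i + int m) t)
          = height h (window x (i + int m) (l - m)) + height h (window x (i + int l) (t - (l - m)))"
        using False m window_split[of "l - m" t x "i + int m"] by (simp add: add.assoc of_nat_diff)
      then show ?thesis
        using m(3) cut[unfolded cut_def, rule_format, of "t - (l - m)"] by simp
    qed
  qed
  then show False using gap m by blast
qed

text \<open>
  \<open>A\<close> stands for the admissible words over the alphabet \<open>S\<close>, and \<open>L\<close> for the words that close up to a
  cycle. The two are kept apart because closing up is a condition on the underlying paths, whereas
  admissibility also depends on the labels.
\<close>
locale factorial_language =
  fixes A :: "'s list set" and L :: "'s list set" and S :: "'s set"
  assumes finite_S: "finite S"
    and A_S: "A \<subseteq> lists S"
    and factor: "u @ v @ w \<in> A \<Longrightarrow> v \<noteq> [] \<Longrightarrow> v \<in> A"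
    and window_L: "x \<in> subshift_of A \<Longrightarrow> periodic n x \<Longrightarrow> n > 0 \<Longrightarrow> window x i n \<in> L"
begin

text \<open>Every window of a periodic sequence is a factor of a power of one period.\<close>
lemma periodic_in_subshift:
  assumes x: "periodic n x" and n: "n > 0" and pow: "\<And>k. k > 0 \<Longrightarrow> concat (replicate k (window x m n)) \<in> A"
  shows "x \<in> subshift_of A"
  unfolding subshift_of_def
proof (intro CollectI allI impI)
  fix i and l :: nat
  assume l: "l > 0"
  define j where "j = nat \<bar>m - i\<bar>"
  define a where "a = m + - int j * int n"
  have "int j * 1 \<le> int j * int n" using n by (intro mult_left_mono) auto
  then have a: "a \<le> i" by (simp add: a_def j_def)
  \<comment> \<open>\<open>a\<close> is a start of a period to the left of \<open>i\<close>, and \<open>k\<close> periods from \<open>a\<close> reach at least to \<open>i + l\<close>.\<close>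
  define k where "k = nat (i - a) + l"
  have "k * 1 \<le> k * n" using n by (intro mult_le_mono) auto
  then have "nat (i - a) + l \<le> k * n" by (simp add: k_def)
  then have split: "window x a (k * n) = window x a (nat (i - a)) @ window x i l
      @ window x (i + int l) (k * n - (nat (i - a) + l))"
    using a window_split[of "nat (i - a)" "k * n" x a] window_split[of l "k * n - nat (i - a)" x i] by simp
  have "window x a (k * n) \<in> A"
    using pow[of k] l window_mult[OF x, of a k] window_periodic[OF x, of m "- int j" n]
    by (simp add: k_def a_def)
  moreover have "window x i l \<noteq> []" using l by (auto simp: window_def)
  ultimately show "window x i l \<in> A" unfolding split by (rule factor)
qed

text \<open>
  The cuts of a point with non-positive drift split it into descents. If the drift is zero, two cuts
  have equal altitude and all the descents have height zero. Both statements are proved together, the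
  set \<open>H\<close> being the range allowed for the drift as well as for the heights of the descents.
\<close>
lemma card_nonpositive_drift:
  assumes n: "n > 0"
    and pow: "\<And>cs k. cs \<in> lists (descents h A) \<Longrightarrow> concat cs \<in> L \<Longrightarrow> cs \<noteq> [] \<Longrightarrow> k > 0 \<Longrightarrow>
      concat (replicate k (concat cs)) \<in> A"
    and H: "H = {..0} \<or> H = {0}"
  shows "of_nat (card {x \<in> subshift_of A. periodic n x \<and> height h (window x 0 n) \<in> H})
    = (\<Sum>cs\<in>factorizations {c \<in> descents h A. height h c \<in> H} L n. of_nat n / of_nat (length cs) :: 'a::field_char_0)"
proof (rule card_by_cuts[OF n, where cut = "cut h"])
  let ?D = "{c \<in> descents h A. height h c \<in> H}"
  have H0: "H \<subseteq> {..0}" using H by auto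
  show "finite (factorizations ?D L n)"
    using A_S by (intro finite_factorizations[OF finite_S]) (auto simp: descents_def)
  fix x :: "int \<Rightarrow> 's"
  assume "x \<in> {x \<in> subshift_of A. periodic n x \<and> height h (window x 0 n) \<in> H}"
  then have x: "x \<in> subshift_of A" "periodic n x" "height h (window x 0 n) \<in> H" by auto
  show "periodic n x" by fact
  show "cut h x (i + int n) = cut h x i" for i
    using window_periodic[OF x(2), of i 1] by (simp add: cut_def)
  show "\<exists>i. cut h x i" using x H0 by (intro cut_exists[OF x(2) n]) auto
  show "window x i n \<in> L" for i by (rule window_L[OF x(1,2) n])
  show "window x i l \<in> ?D"
    if i: "cut h x i" "cut h x (i + int l)" and l: "0 < l"
      and gap: "\<And>k. 0 < k \<Longrightarrow> k < l \<Longrightarrow> \<not> cut h x (i + int k)" for i l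
  proof (intro CollectI conjI)
    show "window x i l \<in> descents h A"
      unfolding descents_def
    proof (intro CollectI conjI allI impI)
      show "window x i l \<in> A" using x(1) l by (simp add: subshift_of_def)
      show "window x i l \<noteq> []" using l by (auto simp: window_def)
      show "height h (window x i l) \<le> 0" using i by (simp add: cut_def)
      fix u v assume uv: "window x i l = u @ v" "u \<noteq> []" "v \<noteq> []"
      have len: "length u + length v = l" using arg_cong[OF uv(1), of length] by simp
      have "u @ v = window x i (length u) @ window x (i + int (length u)) (l - length u)"
        unfolding uv(1)[symmetric] by (rule window_split) (use len in simp)
      then have v: "v = window x (i + int (length u)) (l - length u)"
        by (rule append_eq_append_conv[THEN iffD1, THEN conjunct2, rotated]) simp
      have "0 < length u" "length u < l" using uv(2,3) len by auto
      then show "height h v > 0"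
        unfolding v by (intro height_between_cuts[OF i(2) gap])
    qed
    show "height h (window x i l) \<in> H"
    proof (cases "H = {0}")
      case True
      \<comment> \<open>A whole number of periods from \<open>i\<close>, at least \<open>l\<close> long, has height zero; both parts have height \<open>\<le> 0\<close>.\<close>
      define k where "k = Suc l * n"
      have "l \<le> k" using n by (cases n) (auto simp: k_def)
      have zero: "height h (window x i k) = 0"
      proof -
        have "height h (window x i n) = 0"
          using x(3) True height_window_shift[OF x(2), of h i 0] by simp
        then have "height h (concat (replicate a (window x i n))) = 0" for a
          by (induction a) auto
        then show ?thesis unfolding k_def window_mult[OF x(2)] by blast
      qed
      then have "height h (window x i l) = - height h (window x (i + int l) (k - l))"
        using window_split[OF \<open>l \<le> k\<close>, of x i] by simp
      moreover have "height h (window x i l) \<le> 0" "height h (window x (i + int l) (k - l)) \<le> 0"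
        using i by (auto simp: cut_def)
      ultimately show ?thesis using True by simp
    next
      case False
      then show ?thesis using H i by (simp add: cut_def)
    qed
  qed
next
  let ?D = "{c \<in> descents h A. height h c \<in> H}"
  show "cs = ds" if "cs \<in> lists ?D" "ds \<in> lists ?D" "concat cs = concat ds" for cs ds
    using that by (intro descents_factorization_unique[of cs h A ds]) auto
  fix x :: "int \<Rightarrow> 's" and m cs
  assume cs: "cs \<in> factorizations ?D L n" and x: "periodic n x" "window x (int m) n = concat cs"
  then have cs': "cs \<in> lists (descents h A)" "concat cs \<in> L" by (auto simp: factorizations_def)
  have "cs \<noteq> []" using cs n by (auto simp: factorizations_def)
  then have pow: "concat (replicate k (window x (int m) n)) \<in> A" if "k > 0" for k
    using pow[OF cs'] that x by simp
  have sum: "height h (concat cs) \<in> H"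
  proof -
    have "height h (concat ds) \<in> H" if "set ds \<subseteq> {c. height h c \<in> H}" for ds
      using that H by (induction ds) auto
    then show ?thesis using cs by (auto simp: factorizations_def)
  qed
  have "cut h x (int m)"
    unfolding cut_def
  proof
    fix l
    have "l \<le> l * n" using n by (cases n) auto
    have "concat (concat (replicate l cs)) = concat (replicate l (concat cs))"
      by (induction l) auto
    also have "\<dots> = window x (int m) l @ window x (int m + int l) (l * n - l)"
      using window_mult[OF x(1), of "int m" l] x(2) window_split[OF \<open>l \<le> l * n\<close>, of x "int m"] by simp
    finally show "height h (window x (int m) l) \<le> 0"
      using cs' by (intro height_prefix_descents[of "concat (replicate l cs)" h A]) auto
  qed
  moreover have "height h (window x 0 n) \<in> H"
    using sum height_window_shift[OF x(1), of h 0 "int m"] x(2) by simp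
  ultimately show "x \<in> {x \<in> subshift_of A. periodic n x \<and> height h (window x 0 n) \<in> H} \<and> cut h x (int m)"
    using periodic_in_subshift[OF x(1) n pow] x(1) by simp
qed

end

lemma window_reflect: "window (\<lambda>j. x (- j)) i n = rev (window x (1 - i - int n) n)"
  by (rule nth_equalityI) (auto simp: rev_nth of_nat_diff algebra_simps)

lemma in_rev_image: "w \<in> rev ` A \<longleftrightarrow> rev w \<in> A"
  by (metis image_iff rev_rev_ident)

text \<open>
  Non-negative drift is reduced to non-positive drift by reading sequences and words from right to left
  and changing the sign of the heights, which exchanges ascents and descents.
\<close>
lemma subshift_of_rev: "x \<in> subshift_of (rev ` A) \<longleftrightarrow> (\<lambda>j. x (- j)) \<in> subshift_of A"
proof -
  have "(\<forall>i n. n > 0 \<longrightarrow> P i n) \<longleftrightarrow> (\<forall>i n. n > 0 \<longrightarrow> P (1 - i - int n) n)" for P :: "int \<Rightarrow> nat \<Rightarrow> bool"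
  proof
    assume *: "\<forall>i n. n > 0 \<longrightarrow> P (1 - i - int n) n"
    show "\<forall>i n. n > 0 \<longrightarrow> P i n"
    proof (intro allI impI)
      fix i and n :: nat assume "n > 0"
      then show "P i n" using *[rule_format, of n "1 - i - int n"] by simp
    qed
  qed simp
  from this[of "\<lambda>i n. rev (window x i n) \<in> A"] show ?thesis
    unfolding subshift_of_def window_reflect in_rev_image mem_Collect_eq .
qed

lemma periodic_reflect: "periodic n x \<Longrightarrow> periodic n (\<lambda>j. x (- j))"
  using periodic_add_mult[of n x _ "-1"] by (simp add: periodic_def)

lemma height_rev [simp]: "height h (rev w) = height h w"
  by (induction w) auto

lemma height_uminus [simp]: "height (\<lambda>s. - h s) w = - height h w"
  by (induction w) auto

lemma descents_rev: "descents (\<lambda>s. - h s) (rev ` A) = rev ` ascents h A"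
proof (intro equalityI subsetI)
  fix c assume c: "c \<in> descents (\<lambda>s. - h s) (rev ` A)"
  have "rev c \<in> ascents h A"
    unfolding ascents_def
  proof (intro CollectI conjI allI impI)
    show "rev c \<in> A" "rev c \<noteq> []" "height h (rev c) \<ge> 0" using c by (auto simp: descents_def)
    fix u v assume "rev c = u @ v" "u \<noteq> []" "v \<noteq> []"
    then have "c = rev v @ rev u" "rev v \<noteq> []" "rev u \<noteq> []" by (simp_all add: rev_swap)
    then have "height (\<lambda>s. - h s) (rev u) > 0" using c unfolding descents_def by blast
    then show "height h u < 0" by simp
  qed
  then show "c \<in> rev ` ascents h A" by (metis image_iff rev_rev_ident)
next
  fix c assume "c \<in> rev ` ascents h A"
  then obtain a where a: "c = rev a" "a \<in> ascents h A" by auto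
  show "c \<in> descents (\<lambda>s. - h s) (rev ` A)"
    unfolding descents_def
  proof (intro CollectI conjI allI impI)
    show "c \<in> rev ` A" "c \<noteq> []" "height (\<lambda>s. - h s) c \<le> 0" using a by (auto simp: ascents_def)
    fix u v assume uv: "c = u @ v" "u \<noteq> []" "v \<noteq> []"
    then have "a = rev v @ rev u" using a(1) by (metis rev_append rev_rev_ident)
    moreover have "rev v \<noteq> []" "rev u \<noteq> []" using uv by simp_all
    ultimately have "height h (rev v) < 0" using a(2) unfolding ascents_def by blast
    then show "height (\<lambda>s. - h s) v > 0" by simp
  qed
qed

lemma factorizations_rev:
  "bij_betw (\<lambda>cs. rev (map rev cs)) (factorizations D L n) (factorizations (rev ` D) (rev ` L) n)"
proof (rule bij_betw_byWitness[where f' = "\<lambda>cs. rev (map rev cs)"])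
  have concat: "concat (rev (map rev cs)) = rev (concat cs)" for cs :: "'a list list"
    by (simp add: rev_concat rev_map)
  show "\<forall>cs\<in>factorizations D L n. rev (map rev (rev (map rev cs))) = cs"
    "\<forall>cs\<in>factorizations (rev ` D) (rev ` L) n. rev (map rev (rev (map rev cs))) = cs"
    by (simp_all add: rev_map o_def)
  show "(\<lambda>cs. rev (map rev cs)) ` factorizations D L n \<subseteq> factorizations (rev ` D) (rev ` L) n"
    unfolding factorizations_def mem_Collect_eq image_subset_iff ball_simps concat
    by (auto simp: in_rev_image in_lists_conv_set)
  show "(\<lambda>cs. rev (map rev cs)) ` factorizations (rev ` D) (rev ` L) n \<subseteq> factorizations D L n"
    unfolding factorizations_def mem_Collect_eq image_subset_iff ball_simps concat
    by (auto simp: in_rev_image in_lists_conv_set)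
qed

context factorial_language
begin

lemma factorial_language_rev: "factorial_language (rev ` A) (rev ` L) S"
proof
  show "finite S" by (rule finite_S)
  show "rev ` A \<subseteq> lists S" using A_S by auto
  fix u v w assume "u @ v @ w \<in> rev ` A" "v \<noteq> []"
  then have "rev w @ rev v @ rev u \<in> A" "rev v \<noteq> []" by (simp_all add: in_rev_image)
  then show "v \<in> rev ` A" unfolding in_rev_image by (rule factor)
next
  fix x and n :: nat and i
  assume "x \<in> subshift_of (rev ` A)" "periodic n x" "n > 0"
  then have "window (\<lambda>j. x (- j)) (1 - i - int n) n \<in> L"
    using window_L[of "\<lambda>j. x (- j)" n] subshift_of_rev[of x A] periodic_reflect[of n x] by simp
  then show "window x i n \<in> rev ` L"
    by (simp add: window_reflect in_rev_image)
qed

lemma card_nonnegative_drift: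
  assumes n: "n > 0"
    and pow: "\<And>cs k. cs \<in> lists (ascents h A) \<Longrightarrow> concat cs \<in> L \<Longrightarrow> cs \<noteq> [] \<Longrightarrow> k > 0 \<Longrightarrow>
      concat (replicate k (concat cs)) \<in> A"
  shows "of_nat (card {x \<in> subshift_of A. periodic n x \<and> height h (window x 0 n) \<in> {0..}})
    = (\<Sum>cs\<in>factorizations (ascents h A) L n. of_nat n / of_nat (length cs) :: 'a::field_char_0)"
proof -
  interpret rev: factorial_language "rev ` A" "rev ` L" S by (rule factorial_language_rev)
  let ?X = "{x \<in> subshift_of A. periodic n x \<and> height h (window x 0 n) \<in> {0..}}"
  let ?Y = "{x \<in> subshift_of (rev ` A). periodic n x \<and> height (\<lambda>s. - h s) (window x 0 n) \<in> {..0}}"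
  have drift: "height h (window (\<lambda>j. x (- j)) 0 n) = height h (window x 0 n)" if "periodic n x" for x
    unfolding window_reflect using height_window_shift[OF that] by simp
  have X: "(\<lambda>j. x (- j)) \<in> ?Y" if x: "x \<in> ?X" for x
    using x subshift_of_rev[of "\<lambda>j. x (- j)" A] periodic_reflect[of n x] drift[of x] by simp
  have Y: "(\<lambda>j. x (- j)) \<in> ?X" if x: "x \<in> ?Y" for x
    using x subshift_of_rev[of x A] periodic_reflect[of n x] drift[of x] by simp
  have "bij_betw (\<lambda>x j. x (- j)) ?X ?Y"
    by (rule bij_betw_byWitness[where f' = "\<lambda>x j. x (- j)"])
      (use X Y in \<open>simp_all only: image_subset_iff minus_minus, blast+\<close>)
  then have "card ?X = card ?Y" by (rule bij_betw_same_card)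
  moreover have "of_nat (card ?Y) = (\<Sum>cs\<in>factorizations
      {c \<in> descents (\<lambda>s. - h s) (rev ` A). height (\<lambda>s. - h s) c \<in> {..0}} (rev ` L) n.
        of_nat n / of_nat (length cs) :: 'a)"
  proof (rule rev.card_nonpositive_drift[OF n])
    fix cs :: "'s list list" and k :: nat
    assume cs: "cs \<in> lists (descents (\<lambda>s. - h s) (rev ` A))" "concat cs \<in> rev ` L" "cs \<noteq> []" "k > 0"
    let ?ds = "rev (map rev cs)"
    have ds: "concat ?ds = rev (concat cs)" by (simp add: rev_concat rev_map)
    have "?ds \<in> lists (ascents h A)"
      using cs(1) unfolding descents_rev by (auto simp: in_lists_conv_set in_rev_image)
    moreover have "concat ?ds \<in> L" using cs(2) unfolding ds by auto
    ultimately have "concat (replicate k (rev (concat cs))) \<in> A"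
      using pow[of ?ds k] cs(3,4) unfolding ds by simp
    moreover have "concat (replicate k (rev w)) = rev (concat (replicate k w))" for w :: "'s list"
      by (simp add: rev_concat)
    ultimately show "concat (replicate k (concat cs)) \<in> rev ` A"
      by (simp add: in_rev_image)
  qed simp
  moreover have "{c \<in> descents (\<lambda>s. - h s) (rev ` A). height (\<lambda>s. - h s) c \<in> {..0}} = rev ` ascents h A"
    unfolding descents_rev[symmetric] by (auto simp: descents_def)
  ultimately show ?thesis
    using sum.reindex_bij_betw[OF factorizations_rev[of "ascents h A" L n],
        of "\<lambda>cs. of_nat n / of_nat (length cs) :: 'a"]
    by simp
qed

text \<open>
  Inclusion and exclusion: a point whose drift is both non-negative and non-positive has drift zero.
\<close>
lemma card_periodic_points:
  assumes n: "n > 0"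
    and pow_descents: "\<And>cs k. cs \<in> lists (descents h A) \<Longrightarrow> concat cs \<in> L \<Longrightarrow> cs \<noteq> [] \<Longrightarrow> k > 0 \<Longrightarrow>
      concat (replicate k (concat cs)) \<in> A"
    and pow_ascents: "\<And>cs k. cs \<in> lists (ascents h A) \<Longrightarrow> concat cs \<in> L \<Longrightarrow> cs \<noteq> [] \<Longrightarrow> k > 0 \<Longrightarrow>
      concat (replicate k (concat cs)) \<in> A"
  shows "of_nat (card {x \<in> subshift_of A. periodic n x})
    = (\<Sum>cs\<in>factorizations (descents h A) L n. of_nat n / of_nat (length cs))
    + (\<Sum>cs\<in>factorizations (ascents h A) L n. of_nat n / of_nat (length cs))
    - (\<Sum>cs\<in>factorizations {c \<in> descents h A. height h c = 0} L n. of_nat n / of_nat (length cs) :: 'a::field_char_0)"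
proof -
  let ?X = "\<lambda>H. {x \<in> subshift_of A. periodic n x \<and> height h (window x 0 n) \<in> H}"
  have fin: "finite {x \<in> subshift_of A. periodic n x}"
  proof (rule inj_on_finite)
    show "inj_on (\<lambda>x. window x 0 n) {x \<in> subshift_of A. periodic n x}"
    proof (rule inj_onI)
      fix x y assume "x \<in> {x \<in> subshift_of A. periodic n x}" "y \<in> {x \<in> subshift_of A. periodic n x}"
        and "window x 0 n = window y 0 n"
      then show "x = y"
        using extend_window[of n x 0, OF _ n] extend_window[of n y 0, OF _ n] by (metis mem_Collect_eq of_nat_0)
    qed
    show "(\<lambda>x. window x 0 n) ` {x \<in> subshift_of A. periodic n x} \<subseteq> {w. set w \<subseteq> S \<and> length w = n}"
    proof (intro image_subsetI)
      fix x assume "x \<in> {x \<in> subshift_of A. periodic n x}"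
      then have "window x 0 n \<in> A" using n by (simp add: subshift_of_def)
      then show "window x 0 n \<in> {w. set w \<subseteq> S \<and> length w = n}" using A_S by auto
    qed
    show "finite {w. set w \<subseteq> S \<and> length w = n}" by (rule finite_lists_length_eq[OF finite_S])
  qed
  have un: "{x \<in> subshift_of A. periodic n x} = ?X {..0} \<union> ?X {0..}"
    and int: "?X {0} = ?X {..0} \<inter> ?X {0..}"
    by auto
  have X_fin: "finite (?X H)" for H by (rule finite_subset[OF _ fin]) auto
  have card: "card {x \<in> subshift_of A. periodic n x} + card (?X {0}) = card (?X {..0}) + card (?X {0..})"
    by (subst un, subst int, rule card_Un_Int[OF X_fin X_fin, symmetric])
  have incl_excl: "of_nat (card {x \<in> subshift_of A. periodic n x}) =
      of_nat (card (?X {..0})) + of_nat (card (?X {0..})) - (of_nat (card (?X {0})) :: 'a)"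
    using arg_cong[OF card, of "of_nat :: nat \<Rightarrow> 'a"] by (simp only: of_nat_add eq_diff_eq)
  have nonpos: "{c \<in> descents h A. height h c \<in> {..0}} = descents h A"
    and neutral: "{c \<in> descents h A. height h c \<in> {0}} = {c \<in> descents h A. height h c = 0}"
    by (auto simp: descents_def)
  have "of_nat (card (?X {..0}))
      = (\<Sum>cs\<in>factorizations (descents h A) L n. of_nat n / of_nat (length cs) :: 'a)"
    by (rule card_nonpositive_drift[where h = h and H = "{..0}", unfolded nonpos, OF n pow_descents]) simp_all
  moreover have "of_nat (card (?X {0})) = (\<Sum>cs\<in>factorizations {c \<in> descents h A. height h c = 0} L n.
      of_nat n / of_nat (length cs) :: 'a)"
    by (rule card_nonpositive_drift[where h = h and H = "{0}", unfolded neutral, OF n pow_descents]) simp_all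
  moreover have "of_nat (card (?X {0..}))
      = (\<Sum>cs\<in>factorizations (ascents h A) L n. of_nat n / of_nat (length cs) :: 'a)"
    by (rule card_nonnegative_drift[OF n pow_ascents])
  ultimately show ?thesis
    unfolding incl_excl by (simp only:)
qed

end


section \<open>Generating matrices of codes of paths\<close>

definition closed_walks :: "('v, 's) pre_digraph \<Rightarrow> 's list set" where
  "closed_walks G = {w. \<exists>u. pre_digraph.awalk G u w u}"

definition letters :: "'s set \<Rightarrow> 's list set" where
  "letters T = (\<lambda>s. [s]) ` T"

context fin_digraph
begin

lemma finite_paths_of_length: "finite {c \<in> C. is_path G u c v \<and> length c = n}"
  by (rule finite_subset[OF _ finite_lists_length_eq[OF finite_arcs, of n]])
    (auto simp: is_path_def awalk_def)

lemma gen_matrix_cong: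
  assumes "\<And>c. is_path G u c v \<Longrightarrow> c \<in> C \<longleftrightarrow> c \<in> D"
  shows "gen_matrix G C u v = gen_matrix G D u v"
proof -
  have "{c \<in> C. is_path G u c v \<and> length c = n} = {c \<in> D. is_path G u c v \<and> length c = n}" for n
    using assms by auto
  then show ?thesis by (simp add: gen_matrix_def)
qed

lemma gen_matrix_nth_0 [simp]: "fps_nth (gen_matrix G C u v) 0 = 0"
  by (simp add: gen_matrix_def is_path_def)

lemma gen_matrix_Un:
  assumes "C \<inter> D = {}"
  shows "gen_matrix G (C \<union> D) u v = gen_matrix G C u v + gen_matrix G D u v"
proof (rule fps_ext)
  fix n
  have "{c \<in> C \<union> D. is_path G u c v \<and> length c = n}
      = {c \<in> C. is_path G u c v \<and> length c = n} \<union> {c \<in> D. is_path G u c v \<and> length c = n}"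
    by auto
  then have "card {c \<in> C \<union> D. is_path G u c v \<and> length c = n}
      = card {c \<in> C. is_path G u c v \<and> length c = n} + card {c \<in> D. is_path G u c v \<and> length c = n}"
    using assms by (simp add: card_Un_disjoint finite_paths_of_length disjoint_iff)
  then show "fps_nth (gen_matrix G (C \<union> D) u v) n = fps_nth (gen_matrix G C u v + gen_matrix G D u v) n"
    by (simp add: gen_matrix_def)
qed

text \<open>
  Counts objects that are built by \<open>f\<close> from a word \<open>c\<close> of the code and a continuation, according to the
  end vertex \<open>w\<close> and the length \<open>i\<close> of \<open>c\<close>. It yields the coefficients of products of generating matrices
  for concatenations of two words as well as for lists of words.
\<close>
lemma card_split_walks:
  fixes f :: "'b list \<times> 'c \<Rightarrow> 'd"
  assumes fin: "\<And>w k. finite (B w k)" and B: "\<And>w k. B w k \<subseteq> D"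
    and inj: "inj_on f (C \<times> D)"
    and E: "E = f ` (\<Union>w\<in>verts G. \<Union>i\<in>{0..n}. {c \<in> C. is_path G u c w \<and> length c = i} \<times> B w (n - i))"
  shows "of_nat (card E) = (\<Sum>w\<in>verts G. \<Sum>i = 0..n.
     of_nat (card {c \<in> C. is_path G u c w \<and> length c = i}) * (of_nat (card (B w (n - i))) :: complex))"
proof -
  let ?A = "\<lambda>w i. {c \<in> C. is_path G u c w \<and> length c = i}"
  let ?U = "\<Union>w\<in>verts G. \<Union>i\<in>{0..n}. ?A w i \<times> B w (n - i)"
  have "card E = card ?U"
    unfolding E using B by (intro card_image inj_on_subset[OF inj]) fastforce
  also have "\<dots> = (\<Sum>w\<in>verts G. card (\<Union>i\<in>{0..n}. ?A w i \<times> B w (n - i)))"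
  proof (rule card_UN_disjoint)
    show "\<forall>w\<in>verts G. \<forall>w'\<in>verts G. w \<noteq> w' \<longrightarrow>
        (\<Union>i\<in>{0..n}. ?A w i \<times> B w (n - i)) \<inter> (\<Union>i\<in>{0..n}. ?A w' i \<times> B w' (n - i)) = {}"
      by (auto simp: is_path_def)
  qed (auto simp: finite_paths_of_length fin)
  also have "\<dots> = (\<Sum>w\<in>verts G. \<Sum>i = 0..n. card (?A w i) * card (B w (n - i)))"
    by (intro sum.cong refl, subst card_UN_disjoint)
      (auto simp: finite_paths_of_length fin card_cartesian_product)
  finally show ?thesis by simp
qed

lemma gen_matrix_prod:
  assumes inj: "inj_on (\<lambda>(c, d). c @ d) (C \<times> D)" and C: "[] \<notin> C" and D: "[] \<notin> D"
  shows "mat_prod (verts G) (gen_matrix G C) (gen_matrix G D) u v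
    = gen_matrix G ((\<lambda>(c, d). c @ d) ` (C \<times> D)) u v"
proof (rule fps_ext)
  fix n
  let ?f = "\<lambda>(c :: 'b list, d). c @ d"
  let ?B = "\<lambda>w k. {d \<in> D. is_path G w d v \<and> length d = k}"
  have "{e \<in> ?f ` (C \<times> D). is_path G u e v \<and> length e = n}
      = ?f ` (\<Union>w\<in>verts G. \<Union>i\<in>{0..n}. {c \<in> C. is_path G u c w \<and> length c = i} \<times> ?B w (n - i))"
  proof (intro equalityI subsetI)
    fix e assume "e \<in> {e \<in> ?f ` (C \<times> D). is_path G u e v \<and> length e = n}"
    then obtain c d where e: "e = c @ d" "c \<in> C" "d \<in> D" "is_path G u e v" "length e = n"
      by auto
    let ?w = "awlast u c"
    have walks: "awalk u c ?w" "awalk ?w d v" using e(1,4) by (auto simp: is_path_def awalk_append_iff)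
    moreover have "?w \<in> verts G" using walks(1) by (rule awalk_last_in_verts)
    moreover have "c \<noteq> []" "d \<noteq> []" using e C D by auto
    ultimately show "e \<in> ?f ` (\<Union>w\<in>verts G. \<Union>i\<in>{0..n}. {c \<in> C. is_path G u c w \<and> length c = i} \<times> ?B w (n - i))"
      using e by (intro image_eqI[of _ _ "(c, d)"] UN_I[of ?w] UN_I[of "length c"]) (auto simp: is_path_def)
  qed (auto simp: is_path_def)
  from card_split_walks[OF finite_paths_of_length Collect_restrict inj this]
  show "fps_nth (mat_prod (verts G) (gen_matrix G C) (gen_matrix G D) u v) n
      = fps_nth (gen_matrix G (?f ` (C \<times> D)) u v) n"
    by (simp add: mat_prod_def fps_sum_nth fps_mult_nth gen_matrix_def)
qed

text \<open>
  What is counted are lists of words and not their concatenations, which for a general code may have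
  several factorizations.
\<close>
lemma mat_pow_gen_matrix_nth:
  assumes C: "[] \<notin> C" and u: "u \<in> verts G" and v: "v \<in> verts G"
  shows "fps_nth (mat_pow (verts G) (gen_matrix G C) k u v) n
    = of_nat (card {cs \<in> lists C. length cs = k \<and> length (concat cs) = n \<and> awalk u (concat cs) v})"
  using u
proof (induction k arbitrary: u n)
  case 0
  have "{cs \<in> lists C. length cs = 0 \<and> length (concat cs) = n \<and> awalk u (concat cs) v}
      = (if n = 0 \<and> u = v then {[]} else {})"
    using 0 by (auto simp: awalk_Nil_iff)
  then show ?case by (simp add: mat_one_def)
next
  case (Suc k)
  let ?E = "\<lambda>k u n. {cs \<in> lists C. length cs = k \<and> length (concat cs) = n \<and> awalk u (concat cs) v}"
  have fin: "finite (?E k u n)" for k u n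
  proof (rule finite_subset)
    let ?C = "{c. set c \<subseteq> arcs G \<and> length c \<le> n}"
    show "?E k u n \<subseteq> {cs. set cs \<subseteq> ?C \<and> length cs = k}"
    proof
      fix cs assume cs: "cs \<in> ?E k u n"
      then have "set (concat cs) \<subseteq> arcs G" by (auto simp: awalk_def)
      moreover have "length c \<le> length (concat cs)" if "c \<in> set cs" for c
        using that by (induction cs) auto
      ultimately show "cs \<in> {cs. set cs \<subseteq> ?C \<and> length cs = k}" using cs by fastforce
    qed
    show "finite {cs. set cs \<subseteq> ?C \<and> length cs = k}"
      by (intro finite_lists_length_eq finite_lists_length_le finite_arcs)
  qed
  have "?E (Suc k) u n = (\<lambda>(c, cs). c # cs) `
      (\<Union>w\<in>verts G. \<Union>i\<in>{0..n}. {c \<in> C. is_path G u c w \<and> length c = i} \<times> ?E k w (n - i))"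
  proof (intro equalityI subsetI)
    fix ds assume ds: "ds \<in> ?E (Suc k) u n"
    then obtain c cs where [simp]: "ds = c # cs" by (cases ds) auto
    let ?w = "awlast u c"
    have "awalk u c ?w" "awalk ?w (concat cs) v" using ds by (auto simp: awalk_append_iff)
    moreover have "?w \<in> verts G" using calculation by (auto intro: awalk_last_in_verts)
    moreover have "c \<noteq> []" using ds C by auto
    ultimately show "ds \<in> (\<lambda>(c, cs). c # cs) `
      (\<Union>w\<in>verts G. \<Union>i\<in>{0..n}. {c \<in> C. is_path G u c w \<and> length c = i} \<times> ?E k w (n - i))"
      using ds by (intro image_eqI[of _ _ "(c, cs)"] UN_I[of ?w] UN_I[of "length c"]) (auto simp: is_path_def)
  qed (auto simp: is_path_def)
  from card_split_walks[OF fin subset_UNIV _ this]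
  have "of_nat (card (?E (Suc k) u n)) = (\<Sum>w\<in>verts G. \<Sum>i = 0..n.
     of_nat (card {c \<in> C. is_path G u c w \<and> length c = i}) * (of_nat (card (?E k w (n - i))) :: complex))"
    by (auto simp: inj_on_def)
  also have "\<dots> = fps_nth (mat_pow (verts G) (gen_matrix G C) (Suc k) u v) n"
    by (simp add: mat_prod_def fps_sum_nth fps_mult_nth gen_matrix_def Suc.IH cong: sum.cong)
  finally show ?case ..
qed

lemma finite_factorizations_closed_walks:
  assumes "[] \<notin> C"
  shows "finite (factorizations C (closed_walks G) n)"
proof -
  have "factorizations C (closed_walks G) n = factorizations (C \<inter> lists (arcs G)) (closed_walks G) n"
    by (auto simp: factorizations_def closed_walks_def awalk_def)
  then show ?thesis
    using finite_factorizations[OF finite_arcs, of "C \<inter> lists (arcs G)"] assms by simp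
qed

lemma trace_pow_gen_matrix_nth:
  assumes C: "[] \<notin> C"
  shows "fps_nth (trace_on (verts G) (mat_pow (verts G) (gen_matrix G C) (Suc k))) n
    = of_nat (card {cs \<in> factorizations C (closed_walks G) n. length cs = Suc k})"
proof -
  let ?E = "\<lambda>u. {cs \<in> lists C. length cs = Suc k \<and> length (concat cs) = n \<and> awalk u (concat cs) u}"
  let ?F = "{cs \<in> factorizations C (closed_walks G) n. length cs = Suc k}"
  have F: "?F = (\<Union>u\<in>verts G. ?E u)"
    by (auto simp: factorizations_def closed_walks_def)
  have nonempty: "concat cs \<noteq> []" if "cs \<in> ?E u" for cs u
    using that C by (cases cs) auto
  have "card ?F = (\<Sum>u\<in>verts G. card (?E u))"
    unfolding F
  proof (rule card_UN_disjoint)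
    show "\<forall>u\<in>verts G. finite (?E u)"
      using finite_factorizations_closed_walks[OF C, of n]
      by (auto simp: factorizations_def closed_walks_def intro: finite_subset[rotated])
    show "\<forall>u\<in>verts G. \<forall>v\<in>verts G. u \<noteq> v \<longrightarrow> ?E u \<inter> ?E v = {}"
    proof (intro ballI impI equals0I)
      fix u v cs assume "u \<noteq> v" "cs \<in> ?E u \<inter> ?E v"
      then show False using nonempty[of cs u] by (cases "concat cs") (auto simp: awalk_Cons_iff)
    qed
  qed simp
  then show ?thesis
    by (simp add: trace_on_def fps_sum_nth mat_pow_gen_matrix_nth[OF C] del: mat_pow.simps)
qed

text \<open>
  This is where the weights \<open>n / length cs\<close> of \<open>card_by_cuts\<close> meet the weights \<open>1 / k\<close> of the logarithm.
\<close>
lemma trace_log_deriv_gen_matrix_nth: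
  assumes C: "[] \<notin> C"
  shows "fps_nth (trace_log_deriv (verts G) (gen_matrix G C)) n
    = (\<Sum>cs\<in>factorizations C (closed_walks G) (Suc n). of_nat (Suc n) / of_nat (length cs))"
proof -
  let ?F = "factorizations C (closed_walks G) (Suc n)"
  have len: "1 \<le> length cs \<and> length cs \<le> Suc n" if "cs \<in> ?F" for cs
  proof -
    have le: "length cs \<le> length (concat cs)" if "set cs \<subseteq> C" for cs
      using that
    proof (induction cs)
      case (Cons c cs)
      then have "c \<noteq> []" using C by auto
      then have "length c \<ge> 1" by (cases c) auto
      then show ?case using Cons by simp
    qed simp
    show ?thesis using that le[of cs] by (cases cs) (auto simp: factorizations_def)
  qed
  have "(\<Sum>cs\<in>?F. of_nat (Suc n) / of_nat (length cs) :: complex)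
      = (\<Sum>k\<in>{..n}. \<Sum>cs\<in>{cs \<in> ?F. length cs - 1 = k}. of_nat (Suc n) / of_nat (length cs))"
    using len by (intro sum.group[symmetric] finite_factorizations_closed_walks[OF C]) fastforce+
  also have "\<dots> = (\<Sum>k\<le>n. of_nat (Suc n) / of_nat (Suc k) * of_nat (card {cs \<in> ?F. length cs = Suc k}))"
  proof (intro sum.cong refl)
    fix k
    have "{cs \<in> ?F. length cs - 1 = k} = {cs \<in> ?F. length cs = Suc k}" using len by fastforce
    then show "(\<Sum>cs\<in>{cs \<in> ?F. length cs - 1 = k}. of_nat (Suc n) / of_nat (length cs))
      = of_nat (Suc n) / of_nat (Suc k) * (of_nat (card {cs \<in> ?F. length cs = Suc k}) :: complex)"
      by simp
  qed
  finally show ?thesis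
    by (simp add: trace_log_deriv_def trace_pow_gen_matrix_nth[OF C] del: mat_pow.simps)
qed

lemma det_one_minus_gen_nth_0: "fps_nth (det_one_minus_gen G C) 0 = 1"
  unfolding det_one_minus_gen_def by (rule det_on_one_minus_nth_0) auto

lemma fps_deriv_det_one_minus_gen:
  "fps_deriv (det_one_minus_gen G C) = - trace_log_deriv (verts G) (gen_matrix G C) * det_one_minus_gen G C"
  unfolding det_one_minus_gen_def by (rule fps_deriv_det_one_minus) auto

text \<open>
  Factor the generating matrix of the single arcs as \<open>U W\<close>, where \<open>U\<close> and \<open>W\<close> are the incidence matrices
  of tails and of heads, the latter multiplied by \<open>z\<close>. In the opposite order the product is the
  transition matrix times \<open>z\<close>.
\<close>
lemma det_one_minus_gen_letters:
  assumes T: "T \<subseteq> arcs G"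
  shows "det_one_minus_gen G (letters T) = det_one_minus_transition G T"
proof -
  define U where "U v s = (if tail G s = v then 1 else 0 :: complex fps)" for v s
  define W where "W s v = (if head G s = v then fps_X else 0 :: complex fps)" for s v
  have fin: "finite T" using T finite_arcs by (rule finite_subset)
  have "gen_matrix G (letters T) u v = mat_prod T U W u v" for u v
  proof (rule fps_ext)
    fix n
    have "{c \<in> letters T. is_path G u c v \<and> length c = n}
        = (if n = 1 then (\<lambda>s. [s]) ` {s \<in> T. tail G s = u \<and> head G s = v} else {})"
      using T by (auto simp: letters_def is_path_def awalk_Cons_iff awalk_Nil_iff)
    moreover have "fps_nth (U u s * W s v) n = (if n = 1 \<and> tail G s = u \<and> head G s = v then 1 else 0)" for s
      by (simp add: U_def W_def)
    ultimately show "fps_nth (gen_matrix G (letters T) u v) n = fps_nth (mat_prod T U W u v) n"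
      using fin by (simp add: gen_matrix_def mat_prod_def fps_sum_nth card_image inj_on_def sum.If_cases Int_def)
  qed
  then have "det_one_minus_gen G (letters T) = det_on (verts G) (\<lambda>u v. mat_one u v - mat_prod T U W u v)"
    by (simp add: det_one_minus_gen_def)
  also have "\<dots> = det_on T (\<lambda>s t. mat_one s t - mat_prod (verts G) W U s t)"
    by (rule det_on_one_minus_prod_commute) (auto simp: fin W_def)
  also have "\<dots> = det_one_minus_transition G T"
    unfolding det_one_minus_transition_def
  proof (rule det_on_cong)
    fix s t assume st: "s \<in> T" "t \<in> T"
    have "mat_prod (verts G) W U s t = (\<Sum>v\<in>verts G. if v = head G s then W s v * U v t else 0)"
      unfolding mat_prod_def by (intro sum.cong) (auto simp: W_def)
    also have "\<dots> = fps_const (transition G s t) * fps_X"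
      using st T by (auto simp: U_def W_def transition_def)
    finally show "mat_one s t - mat_prod (verts G) W U s t = mat_one s t - fps_const (transition G s t) * fps_X"
      by simp
  qed
  finally show ?thesis .
qed

lemma awalk_imp_successively:
  "awalk u w v \<Longrightarrow> successively (\<lambda>s t. transition G s t = 1) w"
proof (induction w arbitrary: u)
  case (Cons s w)
  then show ?case by (cases w) (auto simp: awalk_Cons_iff transition_def)
qed simp

text \<open>
  Removing the last letter shows that a word of the closure \<open>C\<close> of \<open>K\<close> is either in \<open>K\<close> or a word of \<open>C\<close>
  followed by an arc of \<open>T\<close>, and by \<open>disjoint\<close> not both. On generating matrices, with \<open>N\<close> for the single
  arcs, this reads \<open>C = K + C N\<close>, hence \<open>(1 - C) (1 - N) = 1 - (K + N)\<close>; now take determinants.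
\<close>
lemma det_one_minus_gen_code_closure:
  assumes T: "T \<subseteq> arcs G"
    and K: "\<And>c. c \<in> K \<Longrightarrow> length c > 1"
    and disjoint: "\<And>c s. c \<in> code_closure G K T \<Longrightarrow> s \<in> T \<Longrightarrow> c @ [s] \<notin> K"
  shows "det_one_minus_transition G T * det_one_minus_gen G (code_closure G K T)
    = det_one_minus_gen G (K \<union> letters T)"
proof -
  let ?C = "code_closure G K T" and ?f = "\<lambda>(c :: 'b list, d). c @ d"
  have inj: "inj_on ?f (?C \<times> letters T)" by (auto simp: inj_on_def letters_def)
  have nil: "[] \<notin> ?C" "[] \<notin> letters T" using K[of "[]"] by (auto simp: code_closure_def letters_def)
  have C: "gen_matrix G ?C u v = gen_matrix G K u v + mat_prod (verts G) (gen_matrix G ?C) (gen_matrix G (letters T)) u v" for u v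
  proof -
    have "gen_matrix G ?C u v = gen_matrix G (K \<union> ?f ` (?C \<times> letters T)) u v"
    proof (rule gen_matrix_cong)
      fix e assume path: "is_path G u e v"
      have "e \<in> ?f ` (?C \<times> letters T)" if "e \<in> ?C" "e \<notin> K"
      proof -
        from that obtain c w where w: "e = c @ w" "c \<in> K" "w \<noteq> []" "set w \<subseteq> T"
          by (auto simp: code_closure_def)
        obtain w' s where ws: "w = w' @ [s]" using w(3) by (metis append_butlast_last_id)
        have walk: "awalk u ((c @ w') @ [s]) v" using path w ws by (simp add: is_path_def)
        have "c @ w' \<in> ?C"
        proof (cases "w' = []")
          case False
          have "awalk u (c @ w') (awlast u (c @ w'))" using walk by (subst (asm) awalk_append_iff) blast
          moreover from this have "successively (\<lambda>s t. transition G s t = 1) w'"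
            by (auto simp: awalk_append_iff intro: awalk_imp_successively)
          moreover from calculation False have "is_path G u (c @ w') (awlast u (c @ w'))"
            by (simp add: is_path_def)
          moreover have "set w' \<subseteq> T" using w(4) ws by simp
          ultimately show ?thesis
            using False w(2) unfolding code_closure_def by blast
        qed (use w in \<open>simp add: code_closure_def\<close>)
        then show ?thesis using w ws by (auto simp: letters_def intro!: image_eqI[of _ _ "(c @ w', [s])"])
      qed
      moreover have "e \<in> ?C" if e: "e \<in> ?f ` (?C \<times> letters T)"
      proof -
        from e obtain c s where s: "e = c @ [s]" "c \<in> ?C" "s \<in> T" by (auto simp: letters_def)
        have "\<exists>k w. c = k @ w \<and> k \<in> K \<and> set w \<subseteq> T"
        proof (cases "c \<in> K")
          case True
          then show ?thesis by (intro exI[of _ c] exI[of _ "[]"]) simp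
        next
          case False
          then show ?thesis using s(2) unfolding code_closure_def by blast
        qed
        then obtain k w where k: "c = k @ w" "k \<in> K" "set w \<subseteq> T" by blast
        have "awalk u (k @ w @ [s]) v" using path s k by (simp add: is_path_def)
        then have "successively (\<lambda>s t. transition G s t = 1) (w @ [s])"
          by (auto simp: awalk_append_iff[of _ k] intro: awalk_imp_successively)
        moreover have "e = k @ (w @ [s])" "set (w @ [s]) \<subseteq> T" using s k by auto
        ultimately show ?thesis
          using path k(2) unfolding code_closure_def by blast
      qed
      moreover have "e \<in> ?C" if "e \<in> K" using that by (simp add: code_closure_def)
      ultimately show "e \<in> ?C \<longleftrightarrow> e \<in> K \<union> ?f ` (?C \<times> letters T)" by blast
    qed
    also have "\<dots> = gen_matrix G K u v + gen_matrix G (?f ` (?C \<times> letters T)) u v"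
      using disjoint by (intro gen_matrix_Un) (auto simp: letters_def)
    finally show ?thesis by (simp add: gen_matrix_prod[OF inj nil])
  qed
  have "det_one_minus_gen G ?C * det_one_minus_gen G (letters T)
      = det_on (verts G) (mat_prod (verts G) (\<lambda>u v. mat_one u v - gen_matrix G ?C u v)
          (\<lambda>u v. mat_one u v - gen_matrix G (letters T) u v))"
    by (simp add: det_one_minus_gen_def det_on_mult)
  also have "\<dots> = det_one_minus_gen G (K \<union> letters T)"
    unfolding det_one_minus_gen_def
  proof (rule det_on_cong)
    fix u v assume uv: "u \<in> verts G" "v \<in> verts G"
    let ?I = "verts G" and ?H = "gen_matrix G ?C" and ?N = "gen_matrix G (letters T)"
    have "mat_prod ?I (\<lambda>u v. mat_one u v - ?H u v) (\<lambda>u v. mat_one u v - ?N u v) u v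
        = mat_prod ?I mat_one (\<lambda>u v. mat_one u v - ?N u v) u v - mat_prod ?I ?H mat_one u v + mat_prod ?I ?H ?N u v"
      by (simp add: mat_prod_def sum_subtractf[symmetric] sum.distrib[symmetric] algebra_simps)
    also have "\<dots> = mat_one u v - ?N u v - ?H u v + mat_prod ?I ?H ?N u v" using uv by simp
    also have "\<dots> = mat_one u v - (gen_matrix G K u v + ?N u v)" by (subst C) simp
    also have "gen_matrix G K u v + ?N u v = gen_matrix G (K \<union> letters T) u v"
      using K by (intro gen_matrix_Un[symmetric]) (fastforce simp: letters_def)
    finally show "mat_prod ?I (\<lambda>u v. mat_one u v - ?H u v) (\<lambda>u v. mat_one u v - ?N u v) u v
        = mat_one u v - gen_matrix G (K \<union> letters T) u v" .
  qed
  finally show ?thesis by (simp add: det_one_minus_gen_letters[OF T] mult.commute)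
qed

end


section \<open>Normal forms in the semigroup of an R-graph\<close>

text \<open>
  A state \<open>Some (t, a, b)\<close> represents the element given by the path \<open>a\<close> of positive edges followed by the
  path \<open>b\<close> of negative edges, which together end in the vertex \<open>t\<close>; \<open>None\<close> represents zero. Letters act by
  multiplication from the right. The list \<open>b\<close> is a stack with its top at the end: negative edges are
  pushed, and a positive edge cancels the top or makes the product zero.
\<close>
type_synonym ('p, 'e) sstate = "('p \<times> 'e list \<times> 'e list) option"

definition push :: "('p, 'e) r_graph \<Rightarrow> 'e \<Rightarrow> 'p \<times> 'e list \<times> 'e list \<Rightarrow> ('p, 'e) sstate" where
  "push Q e = (\<lambda>(t, a, b).
     if tail (base Q) e \<noteq> t then None
     else if e \<in> neg_arcs Q then Some (head (base Q) e, a, b @ [e])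
     else if b = [] then Some (head (base Q) e, a @ [e], [])
     else if (last b, e) \<in> relns Q (tail (base Q) (last b)) (head (base Q) (last b))
       then Some (head (base Q) e, a, butlast b)
     else None)"

fun act :: "('p, 'e) r_graph \<Rightarrow> ('p, 'e) sgen \<Rightarrow> ('p, 'e) sstate \<Rightarrow> ('p, 'e) sstate" where
  "act Q g None = None"
| "act Q GZero (Some st) = None"
| "act Q (GOne p) (Some st) = (if fst st = p then Some st else None)"
| "act Q (GEdge e) (Some st) = push Q e st"

definition run :: "('p, 'e) r_graph \<Rightarrow> ('p, 'e) sgen list \<Rightarrow> ('p, 'e) sstate \<Rightarrow> ('p, 'e) sstate" where
  "run Q u st = fold (act Q) u st"

lemma run_simps [simp]:
  "run Q [] st = st" "run Q (g # u) st = run Q u (act Q g st)" "run Q u None = None"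
  "run Q (u @ v) st = run Q v (run Q u st)"
proof -
  show "run Q u None = None" by (induction u) (simp_all add: run_def)
qed (simp_all add: run_def)

definition weight :: "('p, 'e) r_graph \<Rightarrow> ('p, 'e) sgen \<Rightarrow> int" where
  "weight Q g = (case g of GEdge e \<Rightarrow> if e \<in> neg_arcs Q then - 1 else 1 | _ \<Rightarrow> 0)"

lemma act_SomeE:
  assumes "act Q g (Some (t, a, b)) = Some (t', a', b')"
  obtains (one) "g = GOne t" "t' = t" "a' = a" "b' = b"
  | (neg) e where "g = GEdge e" "e \<in> neg_arcs Q" "tail (base Q) e = t" "t' = head (base Q) e" "a' = a" "b' = b @ [e]"
  | (pos) e where "g = GEdge e" "e \<notin> neg_arcs Q" "tail (base Q) e = t" "t' = head (base Q) e"
      "a' = a @ [e]" "b = []" "b' = []"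
  | (pop) e where "g = GEdge e" "e \<notin> neg_arcs Q" "tail (base Q) e = t" "t' = head (base Q) e" "a' = a" "b \<noteq> []"
      "(last b, e) \<in> relns Q (tail (base Q) (last b)) (head (base Q) (last b))" "b' = butlast b"
  using assms by (cases g) (auto simp: push_def split: if_splits)

lemma act_cases:
  assumes "run Q (g # u) (Some (t, a, b)) = Some (t', a', b')"
  obtains t1 a1 b1 where "act Q g (Some (t, a, b)) = Some (t1, a1, b1)" "run Q u (Some (t1, a1, b1)) = Some (t', a', b')"
  using assms by (cases "act Q g (Some (t, a, b))") auto

text \<open>Cancelling a pair of edges takes away one negative and one positive edge.\<close>
lemma run_weight:
  "run Q u (Some (t, a, b)) = Some (t', a', b') \<Longrightarrow>
    int (length a') - int (length b') = int (length a) - int (length b) + sum_list (map (weight Q) u)"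
proof (induction u arbitrary: t a b)
  case (Cons g u)
  from Cons.prems obtain t1 a1 b1 where
    1: "act Q g (Some (t, a, b)) = Some (t1, a1, b1)" and 2: "run Q u (Some (t1, a1, b1)) = Some (t', a', b')"
    by (rule act_cases)
  from 1 have "int (length a1) - int (length b1) = int (length a) - int (length b) + weight Q g"
  proof (cases rule: act_SomeE)
    case pop
    then show ?thesis by (cases b rule: rev_cases) (auto simp: weight_def)
  qed (auto simp: weight_def)
  with Cons.IH[OF 2] show ?case by simp
qed simp

text \<open>The positive part of a state never shrinks.\<close>
lemma run_prefix:
  "run Q u (Some (t, a, b)) = Some (t', a', b') \<Longrightarrow> \<exists>c. a' = a @ c"
proof (induction u arbitrary: t a b)
  case (Cons g u)
  from Cons.prems obtain t1 a1 b1 where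
    1: "act Q g (Some (t, a, b)) = Some (t1, a1, b1)" and 2: "run Q u (Some (t1, a1, b1)) = Some (t', a', b')"
    by (rule act_cases)
  from 1 have "\<exists>c. a1 = a @ c" by (cases rule: act_SomeE) auto
  with Cons.IH[OF 2] show ?case by auto
qed simp

lemma run_vertex:
  "run Q u (Some (t, a, b)) = Some (t', a', b') \<Longrightarrow> run Q u (Some (t, c, d)) = Some (t'', c', d') \<Longrightarrow> t'' = t'"
proof (induction u arbitrary: t a b c d)
  case (Cons g u)
  from Cons.prems(1) obtain t1 a1 b1 where
    1: "act Q g (Some (t, a, b)) = Some (t1, a1, b1)" "run Q u (Some (t1, a1, b1)) = Some (t', a', b')"
    by (rule act_cases)
  from Cons.prems(2) obtain t2 c1 d1 where
    2: "act Q g (Some (t, c, d)) = Some (t2, c1, d1)" "run Q u (Some (t2, c1, d1)) = Some (t'', c', d')"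
    by (rule act_cases)
  have "t2 = t1" using 1(1) 2(1) by (cases g) (auto simp: push_def split: if_splits)
  with Cons.IH[OF 1(2)] 2(2) show ?case by simp
qed simp

text \<open>
  If a word can be run on the stack \<open>b\<close> without producing positive edges, it never looks below \<open>b\<close>, and
  any further stack content \<open>c\<close> can be put underneath.
\<close>
lemma run_below:
  "run Q u (Some (t, [], b)) = Some (t', [], b') \<Longrightarrow> run Q u (Some (t, a, c @ b)) = Some (t', a, c @ b')"
proof (induction u arbitrary: t b)
  case (Cons g u)
  from Cons.prems obtain t1 a1 b1 where
    1: "act Q g (Some (t, [], b)) = Some (t1, a1, b1)" and 2: "run Q u (Some (t1, a1, b1)) = Some (t', [], b')"
    by (rule act_cases)
  have a1: "a1 = []" using run_prefix[OF 2] by simp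
  have "act Q g (Some (t, a, c @ b)) = Some (t1, a, c @ b1)"
    using 1 by (cases rule: act_SomeE) (use a1 in \<open>auto simp: push_def butlast_append\<close>)
  with Cons.IH[of t1 b1] 2 a1 show ?case by simp
qed simp

lemma run_above:
  "run Q u (Some (t, a, b)) = Some (t', a', b') \<Longrightarrow> run Q u (Some (t, c @ a, b)) = Some (t', c @ a', b')"
proof (induction u arbitrary: t a b)
  case (Cons g u)
  from Cons.prems obtain t1 a1 b1 where
    1: "act Q g (Some (t, a, b)) = Some (t1, a1, b1)" and 2: "run Q u (Some (t1, a1, b1)) = Some (t', a', b')"
    by (rule act_cases)
  have "act Q g (Some (t, c @ a, b)) = Some (t1, c @ a1, b1)"
    using 1 by (cases rule: act_SomeE) (auto simp: push_def)
  with Cons.IH[OF 2] show ?case by simp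
qed simp

lemma run_neg_word:
  assumes "set es \<subseteq> neg_arcs Q" "run Q (map GEdge es) (Some (t, a, b)) = Some (t', a', b')"
  shows "a' = a \<and> b' = b @ es"
  using assms
proof (induction es arbitrary: t a b)
  case (Cons e es)
  from Cons.prems(2) obtain t1 a1 b1 where
    1: "act Q (GEdge e) (Some (t, a, b)) = Some (t1, a1, b1)" and 2: "run Q (map GEdge es) (Some (t1, a1, b1)) = Some (t', a', b')"
    by (simp only: list.map) (rule act_cases)
  from 1 have "a1 = a \<and> b1 = b @ [e]" by (cases rule: act_SomeE) (use Cons.prems(1) in auto)
  with Cons.IH[OF _ 2] Cons.prems(1) show ?case by simp
qed simp

text \<open>
  A positive word first uses up the stack and is then appended to the positive part. So it leaves at most
  one of the two parts behind when it started without a positive part.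
\<close>
lemma run_pos_word:
  assumes "set es \<inter> neg_arcs Q = {}" "run Q (map GEdge es) (Some (t, a, b)) = Some (t', a', b')"
  shows "(a' = a \<or> b' = []) \<and> (b = [] \<longrightarrow> a' = a @ es \<and> b' = [])"
  using assms
proof (induction es arbitrary: t a b)
  case (Cons e es)
  from Cons.prems(2) obtain t1 a1 b1 where
    1: "act Q (GEdge e) (Some (t, a, b)) = Some (t1, a1, b1)" and 2: "run Q (map GEdge es) (Some (t1, a1, b1)) = Some (t', a', b')"
    by (simp only: list.map) (rule act_cases)
  have IH: "(a' = a1 \<or> b' = []) \<and> (b1 = [] \<longrightarrow> a' = a1 @ es \<and> b' = [])"
    using Cons.IH[OF _ 2] Cons.prems(1) by simp
  from 1 show ?case by (cases rule: act_SomeE) (use Cons.prems(1) IH in auto)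
qed simp

locale R_graph_semigroup =
  fixes Q :: "('p, 'e) r_graph"
  assumes R_graph: "R_graph Q"
begin

lemma base_wf: "wf_digraph (base Q)"
  using R_graph by (simp add: R_graph_def partitioned_graph_def fin_digraph.axioms(1))

lemma neg_pos_disjoint: "neg_arcs Q \<inter> pos_arcs Q = {}"
  and arcs_base: "arcs (base Q) = neg_arcs Q \<union> pos_arcs Q"
  using R_graph by (simp_all add: R_graph_def partitioned_graph_def)

lemma ends_in_verts: "e \<in> arcs (base Q) \<Longrightarrow> tail (base Q) e \<in> verts (base Q) \<and> head (base Q) e \<in> verts (base Q)"
  using base_wf by (simp add: wf_digraph_def)

lemma Eneg_iff: "e \<in> Eneg Q q r \<longleftrightarrow> e \<in> neg_arcs Q \<and> tail (base Q) e = q \<and> head (base Q) e = r"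
  by (simp add: Eneg_def)

lemma Epos_iff: "e \<in> Epos Q q r \<longleftrightarrow> e \<in> pos_arcs Q \<and> tail (base Q) e = r \<and> head (base Q) e = q"
  by (simp add: Epos_def)

lemma relns_sub:
  assumes "f \<in> neg_arcs Q" "(f, g) \<in> relns Q (tail (base Q) f) (head (base Q) f)"
  shows "g \<in> pos_arcs Q" "tail (base Q) g = head (base Q) f" "head (base Q) g = tail (base Q) f"
proof -
  have "tail (base Q) f \<in> verts (base Q)" "head (base Q) f \<in> verts (base Q)"
    using ends_in_verts[of f] assms(1) by (auto simp: arcs_base)
  then have "relns Q (tail (base Q) f) (head (base Q) f)
      \<subseteq> Eneg Q (tail (base Q) f) (head (base Q) f) \<times> Epos Q (tail (base Q) f) (head (base Q) f)"
    using R_graph by (simp add: R_graph_def)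
  then show "g \<in> pos_arcs Q" "tail (base Q) g = head (base Q) f" "head (base Q) g = tail (base Q) f"
    using assms(2) by (auto simp: Epos_iff)
qed

lemma sgens_iff [simp]:
  "GZero \<in> sgens Q" "GOne p \<in> sgens Q \<longleftrightarrow> p \<in> verts (base Q)" "GEdge e \<in> sgens Q \<longleftrightarrow> e \<in> arcs (base Q)"
  by (auto simp: sgens_def)

text \<open>
  The defining relations hold for the action on states. This separates the classes of different normal
  forms, and all of them from zero.
\<close>
lemma srel_run:
  assumes "srel Q u v"
  shows "run Q u st = run Q v st"
proof (cases st)
  case (Some st')
  obtain t a b where st: "st = Some (t, a, b)" using Some by (cases st') auto
  from assms show ?thesis
  proof cases
    case (mismatch f q r g q')
    then have "(f, g) \<notin> relns Q q r"
      using relns_sub(3)[of f g] by (auto simp: Eneg_iff Epos_iff)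
    then show ?thesis
      using mismatch neg_pos_disjoint by (auto simp: st push_def Eneg_iff Epos_iff)
  next
    case (zero_r x)
    then show ?thesis by (cases x; cases "act Q x st") (auto simp: st)
  qed (use neg_pos_disjoint in \<open>auto simp: st push_def Eneg_iff Epos_iff\<close>)
qed simp

lemma srel_sgens:
  assumes "srel Q u v"
  shows "u \<in> swords Q \<and> v \<in> swords Q"
  using assms
  by cases (auto simp: swords_def Eneg_iff Epos_iff arcs_base ends_in_verts)

lemma scls_eq_run:
  assumes "scls Q u = scls Q v" "u \<in> swords Q" "v \<in> swords Q"
  shows "run Q u st = run Q v st"
proof -
  have "(u, v) \<in> scong Q"
    using assms eq_equiv_class[OF _ equiv_scong] unfolding scls_def by blast
  then have "equivclp (sstep Q) u v" by (simp add: scong_def)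
  then show ?thesis
  proof (induction rule: equivclp_induct)
    case (step y z)
    have "run Q y st = run Q z st" if "sstep Q y z" for y z
      using that by cases (simp add: srel_run)
    then show ?case using step by metis
  qed simp
qed

lemma swords_append: "u \<in> lists (sgens Q) \<Longrightarrow> v \<in> swords Q \<Longrightarrow> w \<in> lists (sgens Q) \<Longrightarrow> u @ v @ w \<in> swords Q"
  by (auto simp: swords_def)

lemma scls_step:
  assumes "srel Q u v" "x \<in> lists (sgens Q)" "y \<in> lists (sgens Q)"
  shows "scls Q (x @ u @ y) = scls Q (x @ v @ y)"
proof -
  have "(x @ u @ y, x @ v @ y) \<in> scong Q"
    unfolding scong_def using assms srel_sgens[OF assms(1)]
    by (auto intro!: swords_append r_into_equivclp sstep.intros)
  then show ?thesis unfolding scls_def by (rule equiv_class_eq[OF equiv_scong])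
qed

lemma scls_GZero:
  assumes "x \<in> lists (sgens Q)" "y \<in> lists (sgens Q)"
  shows "scls Q (x @ GZero # y) = szero Q"
proof -
  have Z: "GZero \<in> sgens Q" by (simp add: sgens_def)
  have "scls Q (x @ GZero # y) = scls Q (x @ [GZero])"
    using assms(2)
  proof (induction y)
    case (Cons g y)
    then have "scls Q (x @ [GZero, g] @ y) = scls Q (x @ [GZero] @ y)"
      using assms(1) by (intro scls_step zero_l) auto
    then show ?case using Cons by simp
  qed simp
  also have "\<dots> = scls Q [GZero]"
    using assms(1)
  proof (induction x rule: rev_induct)
    case (snoc g x)
    then have "scls Q (x @ [g, GZero] @ []) = scls Q (x @ [GZero] @ [])"
      by (intro scls_step zero_r) auto
    then show ?case using snoc by simp
  qed simp
  finally show ?thesis by (simp add: szero_def)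
qed

text \<open>An invariant of the states that are reached from \<open>(p, [], [])\<close>.\<close>
definition reduced :: "'p \<Rightarrow> 'p \<times> 'e list \<times> 'e list \<Rightarrow> bool" where
  "reduced p = (\<lambda>(t, a, b). p \<in> verts (base Q) \<and> set a \<subseteq> pos_arcs Q \<and> set b \<subseteq> neg_arcs Q \<and>
     pre_digraph.cas (base Q) p (a @ b) t)"

text \<open>
  The word of a state. The leading \<open>GOne p\<close> keeps it non-empty and fixes its source also when there are no
  edges.
\<close>
definition nword :: "'p \<Rightarrow> 'p \<times> 'e list \<times> 'e list \<Rightarrow> ('p, 'e) sgen list" where
  "nword p = (\<lambda>(t, a, b). GOne p # map GEdge (a @ b))"

lemma cas_snoc:
  "pre_digraph.cas (base Q) p (es @ [e]) t \<longleftrightarrow>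
    pre_digraph.cas (base Q) p es (tail (base Q) e) \<and> head (base Q) e = t"
  by (induction es arbitrary: p) (auto simp: pre_digraph.cas.simps)

lemma reduced_target:
  assumes r: "reduced p (t, a, b)"
  shows "t \<in> verts (base Q)"
proof (cases "a @ b" rule: rev_cases)
  case Nil
  then show ?thesis using r by (auto simp: reduced_def pre_digraph.cas.simps)
next
  case (snoc es e)
  then have "e \<in> set (a @ b)" by simp
  then have "e \<in> arcs (base Q)" using r by (auto simp: reduced_def arcs_base)
  then show ?thesis using r snoc ends_in_verts by (auto simp: reduced_def cas_snoc)
qed

lemma nword_lists:
  assumes "reduced p st"
  shows "nword p st \<in> lists (sgens Q)"
proof -
  obtain t a b where st: "st = (t, a, b)" by (cases st)
  have "p \<in> verts (base Q)" "set (a @ b) \<subseteq> arcs (base Q)"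
    using assms by (auto simp: st reduced_def arcs_base)
  then have "g \<in> sgens Q" if "g \<in> set (nword p st)" for g
    using that unfolding st nword_def prod.case by auto
  then show ?thesis by (simp add: in_lists_conv_set)
qed

lemma scls_nword_one:
  assumes r: "reduced p (t, a, b)" and y: "y \<in> lists (sgens Q)"
  shows "scls Q (nword p (t, a, b) @ GOne t # y) = scls Q (nword p (t, a, b) @ y)"
proof (cases "a @ b" rule: rev_cases)
  case Nil
  then have "t = p" "p \<in> verts (base Q)" using r by (auto simp: reduced_def pre_digraph.cas.simps)
  then show ?thesis using scls_step[OF one_idem, of p "[]" y] y Nil by (simp add: nword_def)
next
  case (snoc es e)
  then have "e \<in> set (a @ b)" by simp
  then have e: "e \<in> neg_arcs Q \<or> e \<in> pos_arcs Q" using r by (auto simp: reduced_def)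
  have t: "t = head (base Q) e" using r snoc by (simp add: reduced_def cas_snoc)
  have srel: "srel Q [GEdge e, GOne t] [GEdge e]"
    using e
  proof
    assume "e \<in> neg_arcs Q"
    then show ?thesis by (intro neg_one[of _ _ "tail (base Q) e"]) (simp add: Eneg_iff t)
  next
    assume "e \<in> pos_arcs Q"
    then show ?thesis by (intro pos_one[of _ _ _ "tail (base Q) e"]) (simp add: Epos_iff t)
  qed
  have eq: "nword p (t, a, b) = (GOne p # map GEdge es) @ [GEdge e]"
    by (simp only: nword_def prod.case snoc) simp
  then have "GOne p # map GEdge es \<in> lists (sgens Q)" using nword_lists[OF r] by simp
  from scls_step[OF srel this y] show ?thesis unfolding eq by simp
qed

lemma srel_tail_one:
  assumes "e \<in> arcs (base Q)"
  shows "srel Q [GOne (tail (base Q) e), GEdge e] [GEdge e]"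
  using assms unfolding arcs_base
proof
  assume "e \<in> neg_arcs Q"
  then show ?thesis by (intro one_neg[of _ _ _ "head (base Q) e"]) (simp add: Eneg_iff)
next
  assume "e \<in> pos_arcs Q"
  then show ?thesis by (intro one_pos[of _ _ "head (base Q) e"]) (simp add: Epos_iff)
qed

text \<open>
  The converse of \<open>srel_run\<close>: each transition of the machine follows from the defining relations. Where
  the machine stops because vertices do not match, the product vanishes since the orthogonal idempotents
  of the two vertices can be inserted.
\<close>
lemma scls_reduce_step:
  assumes r: "reduced p (t, a, b)" and g: "g \<in> sgens Q" and y: "y \<in> lists (sgens Q)"
  shows "case act Q g (Some (t, a, b)) of
      None \<Rightarrow> scls Q (nword p (t, a, b) @ g # y) = szero Q
    | Some st \<Rightarrow> reduced p st \<and> scls Q (nword p (t, a, b) @ g # y) = scls Q (nword p st @ y)"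
proof -
  let ?w = "nword p (t, a, b)"
  have w: "?w \<in> lists (sgens Q)" using r by (rule nword_lists)
  have tv: "t \<in> verts (base Q)" using r by (rule reduced_target)
  have orth: "scls Q (?w @ GOne q # z) = szero Q"
    if "q \<in> verts (base Q)" "q \<noteq> t" "z \<in> lists (sgens Q)" for q z
  proof -
    have "GOne q # z \<in> lists (sgens Q)" using that by (simp add: sgens_def)
    from scls_nword_one[OF r this] have "scls Q (?w @ GOne q # z) = scls Q (?w @ [GOne t, GOne q] @ z)" by simp
    also have "\<dots> = scls Q (?w @ [GZero] @ z)" using that w tv by (intro scls_step one_orth) auto
    also have "\<dots> = szero Q" using scls_GZero[OF w that(3)] by simp
    finally show ?thesis .
  qed
  show ?thesis
  proof (cases g)
    case GZero
    then show ?thesis using scls_GZero[OF w y] by simp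
  next
    case (GOne q)
    then have "q \<in> verts (base Q)" using g by (auto simp: sgens_def)
    then show ?thesis
      using GOne orth[of q y] y r scls_nword_one[OF r y] by (cases "t = q") simp_all
  next
    case (GEdge e)
    then have e: "e \<in> arcs (base Q)" using g by (auto simp: sgens_def)
    note ev = ends_in_verts[OF e]
    show ?thesis
    proof (cases "tail (base Q) e = t")
      case False
      have "scls Q (?w @ [GEdge e] @ y) = scls Q (?w @ [GOne (tail (base Q) e), GEdge e] @ y)"
        by (rule scls_step[OF srel_tail_one[OF e] w y, symmetric])
      also have "\<dots> = szero Q"
        using orth[of "tail (base Q) e" "GEdge e # y"] False ev y e by (simp add: sgens_def)
      finally show ?thesis using GEdge False by (simp add: push_def)
    next
      case tail: True
      show ?thesis
      proof (cases "e \<in> neg_arcs Q \<or> b = []")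
        case True
        obtain a' b' where push: "push Q e (t, a, b) = Some (head (base Q) e, a', b')"
          and ab: "a' @ b' = (a @ b) @ [e]" and sub: "set a' \<subseteq> pos_arcs Q" "set b' \<subseteq> neg_arcs Q"
        proof (cases "e \<in> neg_arcs Q")
          case True
          then show ?thesis using that[of a "b @ [e]"] tail r by (simp add: push_def reduced_def)
        next
          case False
          then have "b = []" "e \<in> pos_arcs Q" using \<open>e \<in> neg_arcs Q \<or> b = []\<close> e by (auto simp: arcs_base)
          then show ?thesis using that[of "a @ [e]" "[]"] tail r False by (simp add: push_def reduced_def)
        qed
        have "reduced p (head (base Q) e, a', b')"
          using r sub tail unfolding reduced_def prod.case ab cas_snoc by simp
        moreover have "nword p (head (base Q) e, a', b') @ y = ?w @ g # y"
          by (simp only: nword_def prod.case ab) (simp add: GEdge)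
        ultimately show ?thesis by (simp add: GEdge push)
      next
        case False
        then have pos: "e \<in> pos_arcs Q" "e \<notin> neg_arcs Q" and "b \<noteq> []" using e by (auto simp: arcs_base)
        then obtain c f where b: "b = c @ [f]" by (metis append_butlast_last_id)
        have f: "f \<in> neg_arcs Q" "head (base Q) f = t" and rc: "reduced p (tail (base Q) f, a, c)"
          using r unfolding reduced_def b by (auto simp: cas_snoc simp flip: append_assoc)
        let ?q = "tail (base Q) f"
        have fE: "f \<in> Eneg Q ?q t" using f by (simp add: Eneg_iff)
        have eE: "e \<in> Epos Q (head (base Q) e) t" using pos tail by (simp add: Epos_iff)
        have w': "nword p (?q, a, c) \<in> lists (sgens Q)" using rc by (rule nword_lists)
        have split: "?w @ g # y = nword p (?q, a, c) @ [GEdge f, GEdge e] @ y"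
          by (simp add: nword_def b GEdge)
        show ?thesis
        proof (cases "(f, e) \<in> relns Q ?q t")
          case True
          have head: "head (base Q) e = ?q" using relns_sub(3)[of f e] True f by simp
          have "srel Q [GEdge f, GEdge e] [GOne ?q]"
            using cancel[OF fE, of e] eE True head by simp
          from scls_step[OF this w' y] scls_nword_one[OF rc y]
          have "scls Q (?w @ g # y) = scls Q (nword p (?q, a, c) @ y)" unfolding split by simp
          then show ?thesis
            using rc True head f tail pos by (simp add: GEdge push_def b)
        next
          case False
          have "srel Q [GEdge f, GEdge e] [GZero]"
          proof (cases "head (base Q) e = ?q")
            case True
            then show ?thesis using annihilate[OF fE, of e] eE False by simp
          next
            case neq: False
            then show ?thesis using mismatch[OF fE eE] by simp
          qed
          from scls_step[OF this w' y] scls_GZero[OF w' y]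
          have "scls Q (?w @ g # y) = szero Q" unfolding split by simp
          then show ?thesis using False f tail pos by (simp add: GEdge push_def b)
        qed
      qed
    qed
  qed
qed

lemma scls_reduce:
  assumes "reduced p (t, a, b)" "u \<in> lists (sgens Q)"
  shows "case run Q u (Some (t, a, b)) of
      None \<Rightarrow> scls Q (nword p (t, a, b) @ u) = szero Q
    | Some st \<Rightarrow> reduced p st \<and> scls Q (nword p (t, a, b) @ u) = scls Q (nword p st)"
  using assms
proof (induction u arbitrary: t a b)
  case (Cons g u)
  then have gu: "g \<in> sgens Q" "u \<in> lists (sgens Q)" by auto
  note step = scls_reduce_step[OF Cons.prems(1) gu]
  show ?case
  proof (cases "act Q g (Some (t, a, b))")
    case None
    then show ?thesis using step by simp
  next
    case (Some st)
    then obtain t1 a1 b1 where st: "act Q g (Some (t, a, b)) = Some (t1, a1, b1)" by (cases st) auto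
    then have "reduced p (t1, a1, b1)"
      and eq: "scls Q (nword p (t, a, b) @ g # u) = scls Q (nword p (t1, a1, b1) @ u)"
      using step by auto
    from Cons.IH[OF this(1) gu(2)] show ?thesis unfolding run_simps eq st .
  qed
qed simp

lemma scls_absorb_one:
  assumes "act Q g (Some (p, [], [])) \<noteq> None" "g \<in> sgens Q" "u \<in> lists (sgens Q)"
  shows "scls Q (GOne p # g # u) = scls Q (g # u)"
proof -
  have "srel Q [GOne p, g] [g]"
  proof (cases g)
    case (GOne q)
    then show ?thesis using assms by (auto split: if_splits intro: one_idem)
  next
    case (GEdge e)
    then have "tail (base Q) e = p" "e \<in> arcs (base Q)"
      using assms(1,2) by (auto simp: push_def split: if_splits)
    then show ?thesis using srel_tail_one[of e] GEdge by simp
  qed (use assms in simp)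
  from scls_step[OF this, of "[]" u] show ?thesis using assms(3) by simp
qed
end

context R_graph_semigroup
begin

lemma subsemigroup_edges_iff:
  assumes E: "E \<subseteq> arcs (base Q)"
  shows "X \<in> subsemigroup Q (sedge Q ` E) \<longleftrightarrow> (\<exists>es. es \<noteq> [] \<and> set es \<subseteq> E \<and> X = scls Q (map GEdge es))"
proof
  have sw: "map GEdge es \<in> swords Q" if "es \<noteq> []" "set es \<subseteq> E" for es
    using that E by (auto simp: swords_def in_lists_conv_set subset_iff)
  show "\<exists>es. es \<noteq> [] \<and> set es \<subseteq> E \<and> X = scls Q (map GEdge es)" if "X \<in> subsemigroup Q (sedge Q ` E)"
    using that
  proof induction
    case (incl X)
    then obtain e where "e \<in> E" "X = sedge Q e" by auto
    then show ?case by (intro exI[of _ "[e]"]) (simp add: sedge_def)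
  next
    case (mult X Y)
    then obtain es fs where es: "es \<noteq> []" "set es \<subseteq> E" "X = scls Q (map GEdge es)"
      and fs: "fs \<noteq> []" "set fs \<subseteq> E" "Y = scls Q (map GEdge fs)" by auto
    then show ?case
      using smult_scls[OF sw[OF es(1,2)] sw[OF fs(1,2)]] by (intro exI[of _ "es @ fs"]) simp
  qed
  show "X \<in> subsemigroup Q (sedge Q ` E)" if "\<exists>es. es \<noteq> [] \<and> set es \<subseteq> E \<and> X = scls Q (map GEdge es)"
  proof -
    from that obtain es where "es \<noteq> []" "set es \<subseteq> E" "X = scls Q (map GEdge es)" by auto
    moreover have "es \<noteq> [] \<Longrightarrow> set es \<subseteq> E \<Longrightarrow> scls Q (map GEdge es) \<in> subsemigroup Q (sedge Q ` E)" for es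
    proof (induction es rule: list_nonempty_induct)
      case (single e)
      then have "sedge Q e \<in> subsemigroup Q (sedge Q ` E)" by (intro subsemigroup.incl) simp
      then show ?case by (simp add: sedge_def)
    next
      case (cons e es)
      then have "Defs.smult Q (sedge Q e) (scls Q (map GEdge es)) \<in> subsemigroup Q (sedge Q ` E)"
        by (intro subsemigroup.mult[OF subsemigroup.incl]) auto
      moreover have "Defs.smult Q (sedge Q e) (scls Q (map GEdge es)) = scls Q (map GEdge (e # es))"
        using smult_scls[OF sw[of "[e]"] sw[of es]] cons by (simp add: sedge_def)
      ultimately show ?case by simp
    qed
    ultimately show ?thesis by simp
  qed
qed

lemma Sneg_iff: "X \<in> Sneg Q \<longleftrightarrow> (\<exists>es. es \<noteq> [] \<and> set es \<subseteq> neg_arcs Q \<and> X = scls Q (map GEdge es)) \<and> X \<noteq> szero Q"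
  unfolding Sneg_def using subsemigroup_edges_iff[of "neg_arcs Q" X] by (simp add: arcs_base)

lemma Spos_iff: "X \<in> Spos Q \<longleftrightarrow> (\<exists>es. es \<noteq> [] \<and> set es \<subseteq> pos_arcs Q \<and> X = scls Q (map GEdge es)) \<and> X \<noteq> szero Q"
  unfolding Spos_def using subsemigroup_edges_iff[of "pos_arcs Q" X] by (simp add: arcs_base)

lemma Sone_iff: "X \<in> Sone Q \<longleftrightarrow> (\<exists>p\<in>verts (base Q). X = scls Q [GOne p])"
  by (auto simp: Sone_def sone_def)

lemma edges_swords: "es \<noteq> [] \<Longrightarrow> set es \<subseteq> arcs (base Q) \<Longrightarrow> map GEdge es \<in> swords Q"
  by (auto simp: swords_def in_lists_conv_set subset_iff)

lemma run_szero: "scls Q u = szero Q \<Longrightarrow> u \<in> swords Q \<Longrightarrow> run Q u st = None"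
  using scls_eq_run[of u "[GZero]" st] by (cases st) (simp_all add: szero_def swords_def)

lemma Sone_nonzero: "X \<in> Sone Q \<Longrightarrow> X \<noteq> szero Q"
proof
  assume "X \<in> Sone Q" "X = szero Q"
  then obtain p where "p \<in> verts (base Q)" "scls Q [GOne p] = szero Q" by (auto simp: Sone_iff)
  then show False using run_szero[of "[GOne p]" "Some (p, [], [])"] by (simp add: swords_def)
qed

lemma scls_nword_drop:
  assumes r: "reduced p (t, a, b)" and ne: "a @ b \<noteq> []"
  shows "scls Q (nword p (t, a, b)) = scls Q (map GEdge (a @ b))"
proof -
  obtain e es where ab: "a @ b = e # es" using ne by (cases "a @ b") auto
  have sub: "set (e # es) \<subseteq> arcs (base Q)" using r unfolding ab[symmetric] by (auto simp: reduced_def arcs_base)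
  have "tail (base Q) e = p" using r ab by (simp add: reduced_def pre_digraph.cas.simps)
  then have "srel Q [GOne p, GEdge e] [GEdge e]" using srel_tail_one[of e] sub by simp
  moreover have "map GEdge es \<in> lists (sgens Q)" using sub by (auto simp: in_lists_conv_set)
  ultimately show ?thesis
    using scls_step[of "[GOne p, GEdge e]" "[GEdge e]" "[]" "map GEdge es"]
    unfolding nword_def prod.case ab by simp
qed

end


section \<open>Labels of paths in a presentation\<close>

locale presentation =
  fixes Q :: "('p, 'e) r_graph" and G :: "('v, 's) pre_digraph" and lam :: "'s \<Rightarrow> ('p, 'e) selem"
  assumes pres: "S_presentation Q G lam"

sublocale presentation \<subseteq> R_graph_semigroup Q
  using pres by unfold_locales (simp add: S_presentation_def)

sublocale presentation \<subseteq> fin_digraph G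
  using pres by (simp add: S_presentation_def)

context presentation
begin

abbreviation label :: "'s list \<Rightarrow> ('p, 'e) selem" where
  "label \<equiv> plabel Q lam"

text \<open>
  Labels are classes of words. Fixing a representative for every arc makes the label of a path the class of
  one concrete word, on which the machine can be run.
\<close>
definition arc_word :: "'s \<Rightarrow> ('p, 'e) sgen list" where
  "arc_word s = (SOME x. x \<in> swords Q \<and> lam s = scls Q x)"

definition word :: "'s list \<Rightarrow> ('p, 'e) sgen list" where
  "word w = concat (map arc_word w)"

text \<open>The index of the part that contains the vertex, in the partition of the vertices by \<open>Vset\<close>.\<close>
definition cell :: "'v \<Rightarrow> 'p" where
  "cell v = (SOME p. p \<in> verts (base Q) \<and> v \<in> Vset Q G lam p)"

text \<open>
  The representative may contain pairs that cancel, but such pairs have weight zero, so this is the number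
  of positive minus the number of negative edges in the normal form of the label.
\<close>
definition hgt :: "'s \<Rightarrow> int" where
  "hgt s = sum_list (map (weight Q) (arc_word s))"

lemma lam_types: "s \<in> arcs G \<Longrightarrow> lam s \<in> Sneg Q \<union> Sone Q \<union> Spos Q"
  using pres by (simp add: S_presentation_def)

lemma arc_word:
  assumes "s \<in> arcs G"
  shows "arc_word s \<in> swords Q" "lam s = scls Q (arc_word s)"
proof -
  have "\<exists>x. x \<in> swords Q \<and> lam s = scls Q x"
  proof -
    from lam_types[OF assms] consider "lam s \<in> Sneg Q" | "lam s \<in> Sone Q" | "lam s \<in> Spos Q" by blast
    then show ?thesis
    proof cases
      case 1
      then obtain es where "es \<noteq> []" "set es \<subseteq> neg_arcs Q" "lam s = scls Q (map GEdge es)"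
        by (auto simp: Sneg_iff)
      then show ?thesis using edges_swords[of es] by (auto simp: arcs_base)
    next
      case 2
      then obtain p where "p \<in> verts (base Q)" "lam s = scls Q [GOne p]" by (auto simp: Sone_iff)
      then show ?thesis by (intro exI[of _ "[GOne p]"]) (simp add: swords_def)
    next
      case 3
      then obtain es where "es \<noteq> []" "set es \<subseteq> pos_arcs Q" "lam s = scls Q (map GEdge es)"
        by (auto simp: Spos_iff)
      then show ?thesis using edges_swords[of es] by (auto simp: arcs_base)
    qed
  qed
  from someI_ex[OF this] show "arc_word s \<in> swords Q" "lam s = scls Q (arc_word s)"
    by (auto simp: arc_word_def)
qed

lemma word_simps [simp]: "word [] = []" "word (s # w) = arc_word s @ word w" "word (w @ w') = word w @ word w'"
  by (simp_all add: word_def)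

lemma word_lists: "set w \<subseteq> arcs G \<Longrightarrow> word w \<in> lists (sgens Q)"
  using arc_word by (induction w) (auto simp: swords_def)

lemma label_word:
  assumes "w \<noteq> []" "set w \<subseteq> arcs G"
  shows "word w \<in> swords Q \<and> label w = scls Q (word w)"
  using assms
proof (induction w rule: list_nonempty_induct)
  case (single s)
  then show ?case using arc_word[of s] by simp
next
  case (cons s w)
  then obtain s' w' where w: "w = s' # w'" by (cases w) auto
  have IH: "word w \<in> swords Q" "label w = scls Q (word w)" using cons by auto
  have s: "arc_word s \<in> swords Q" "lam s = scls Q (arc_word s)" using arc_word[of s] cons by auto
  have "label (s # w) = Defs.smult Q (lam s) (label w)" by (simp add: w)
  then show ?case using smult_scls[OF s(1) IH(1)] s IH by (auto simp: swords_def)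
qed

lemma label_append:
  assumes "u \<noteq> []" "v \<noteq> []" "set (u @ v) \<subseteq> arcs G"
  shows "label (u @ v) = Defs.smult Q (label u) (label v)"
  using label_word[of u] label_word[of v] label_word[of "u @ v"] assms by (simp add: smult_scls)

lemma cell:
  assumes "v \<in> verts G"
  shows "cell v \<in> verts (base Q)" "v \<in> Vset Q G lam (cell v)"
proof -
  have "partition_on (verts G) (Vset Q G lam ` verts (base Q))"
    using pres by (simp add: S_presentation_def)
  then have "v \<in> \<Union> (Vset Q G lam ` verts (base Q))" using assms by (simp add: partition_on_def)
  then have "\<exists>p. p \<in> verts (base Q) \<and> v \<in> Vset Q G lam p" by auto
  from someI_ex[OF this] show "cell v \<in> verts (base Q)" "v \<in> Vset Q G lam (cell v)"
    by (auto simp: cell_def)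
qed

lemma cell_nonzero:
  assumes s: "s \<in> arcs G"
  shows "Defs.smult Q (sone Q (cell (tail G s))) (lam s) \<noteq> szero Q"
    "Defs.smult Q (lam s) (sone Q (cell (head G s))) \<noteq> szero Q"
  using pres s cell[of "tail G s"] cell[of "head G s"] by (auto simp: S_presentation_def)

abbreviation start :: "'v \<Rightarrow> ('p, 'e) sstate" where
  "start v \<equiv> Some (cell v, [], [])"

lemma reduced_start: "v \<in> verts G \<Longrightarrow> reduced (cell v) (cell v, [], [])"
  using cell by (simp add: reduced_def pre_digraph.cas.simps)

lemma run_nonzero:
  assumes "v \<in> verts G" "u \<in> lists (sgens Q)" "scls Q (GOne (cell v) # u) \<noteq> szero Q"
  shows "run Q u (start v) \<noteq> None"
proof
  assume "run Q u (start v) = None"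
  then show False using scls_reduce[OF reduced_start[OF assms(1)] assms(2)] assms(3) by (simp add: nword_def)
qed

lemma scls_absorb_cell:
  assumes "run Q u (start v) \<noteq> None" "u \<in> swords Q" "y \<in> lists (sgens Q)"
  shows "scls Q (GOne (cell v) # u @ y) = scls Q (u @ y)"
proof -
  obtain g x where u: "u = g # x" "g \<in> sgens Q" "x \<in> lists (sgens Q)"
    using assms(2) by (cases u) (auto simp: swords_def)
  have "act Q g (start v) \<noteq> None"
  proof
    assume "act Q g (start v) = None"
    then show False using assms(1) u(1) by simp
  qed
  then show ?thesis using scls_absorb_one[of g "cell v" "x @ y"] u assms(3) by simp
qed

text \<open>
  The conditions on the idempotents at the two end points of an arc say exactly that its label leads from
  the cell of its tail to the cell of its head.
\<close>
lemma arc_run: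
  assumes s: "s \<in> arcs G"
  obtains a b where "run Q (arc_word s) (start (tail G s)) = Some (cell (head G s), a, b)"
proof -
  let ?p = "cell (tail G s)" and ?q = "cell (head G s)" and ?x = "arc_word s"
  have pq: "?p \<in> verts (base Q)" "?q \<in> verts (base Q)" using cell s by auto
  have x: "?x \<in> swords Q" "?x \<in> lists (sgens Q)" using arc_word(1)[OF s] by (auto simp: swords_def)
  have one: "[GOne ?p] \<in> swords Q" "[GOne ?q] \<in> swords Q" using pq by (auto simp: swords_def)
  have "scls Q (GOne ?p # ?x) \<noteq> szero Q"
    using cell_nonzero(1)[OF s] smult_scls[OF one(1) x(1)] arc_word(2)[OF s] by (simp add: sone_def)
  then have "run Q ?x (start (tail G s)) \<noteq> None" using s x(2) by (intro run_nonzero) auto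
  then obtain t a b where run: "run Q ?x (start (tail G s)) = Some (t, a, b)" by auto
  have "scls Q (?x @ [GOne ?q]) \<noteq> szero Q"
    using cell_nonzero(2)[OF s] smult_scls[OF x(1) one(2)] arc_word(2)[OF s] by (simp add: sone_def)
  moreover have "scls Q (GOne ?p # ?x @ [GOne ?q]) = scls Q (?x @ [GOne ?q])"
    using run x(1) pq by (intro scls_absorb_cell) auto
  ultimately have "run Q (?x @ [GOne ?q]) (start (tail G s)) \<noteq> None"
    using s x(2) pq by (intro run_nonzero) auto
  then have "t = ?q" using run by (auto split: if_splits)
  then show ?thesis using run that by simp
qed

lemma walk_run_target:
  "awalk u w v \<Longrightarrow> run Q (word w) (Some (cell u, a, b)) = Some (t, a', b') \<Longrightarrow> t = cell v"
proof (induction w arbitrary: u a b)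
  case Nil
  then show ?case by (simp add: awalk_Nil_iff)
next
  case (Cons s w)
  then have s: "s \<in> arcs G" "u = tail G s" "awalk (head G s) w v" by (auto simp: awalk_Cons_iff)
  obtain a0 b0 where 0: "run Q (arc_word s) (start (tail G s)) = Some (cell (head G s), a0, b0)"
    using arc_run[OF s(1)] .
  obtain t1 a1 b1 where 1: "run Q (arc_word s) (Some (cell u, a, b)) = Some (t1, a1, b1)"
    using Cons.prems(2) by (cases "run Q (arc_word s) (Some (cell u, a, b))") auto
  have "t1 = cell (head G s)" using run_vertex[OF 0] 1 s(2) by simp
  then show ?case using Cons.IH[OF s(3)] Cons.prems(2) 1 by simp
qed

text \<open>
  The label of a path and the run of its word determine each other. In particular the label is zero
  exactly if the run fails.
\<close>
lemma label_run:
  assumes w: "awalk u w v" "w \<noteq> []"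
  shows "case run Q (word w) (start u) of
      None \<Rightarrow> label w = szero Q
    | Some (t, a, b) \<Rightarrow> t = cell v \<and> label w \<noteq> szero Q \<and> reduced (cell u) (t, a, b) \<and>
        label w = scls Q (nword (cell u) (t, a, b))"
proof -
  have sub: "set w \<subseteq> arcs G" and u: "u \<in> verts G" using w(1) by (auto simp: awalk_def)
  have lw: "word w \<in> swords Q" "label w = scls Q (word w)" using label_word[OF w(2) sub] by auto
  obtain s w' where s: "w = s # w'" "s \<in> arcs G" "u = tail G s"
    using w by (cases w) (auto simp: awalk_Cons_iff)
  obtain a0 b0 where "run Q (arc_word s) (start (tail G s)) = Some (cell (head G s), a0, b0)"
    using arc_run[OF s(2)] .
  then have "run Q (arc_word s) (start u) \<noteq> None" unfolding s(3) by simp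
  then have "scls Q (GOne (cell u) # word w) = scls Q (word w)"
    using scls_absorb_cell[of "arc_word s" u "word w'"] arc_word(1)[OF s(2)] word_lists[of w'] s(1) sub by simp
  then have nw: "scls Q (nword (cell u) (cell u, [], []) @ word w) = label w" using lw by (simp add: nword_def)
  have red: "case run Q (word w) (start u) of None \<Rightarrow> label w = szero Q
    | Some st \<Rightarrow> reduced (cell u) st \<and> label w = scls Q (nword (cell u) st)"
    using scls_reduce[OF reduced_start[OF u] word_lists[OF sub]] unfolding nw .
  have "run Q (word w) (start u) = None" if "label w = szero Q"
    by (rule run_szero[OF trans[OF lw(2)[symmetric] that] lw(1)])
  note zero = this
  show ?thesis
  proof (cases "run Q (word w) (start u)")
    case None
    then show ?thesis using red unfolding None option.case by simp
  next
    case (Some st)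
    obtain t a b where st: "st = (t, a, b)" by (cases st)
    have "t = cell v" using walk_run_target[OF w(1) Some[unfolded st]] .
    moreover have "label w \<noteq> szero Q" using zero Some by auto
    ultimately show ?thesis using red unfolding Some st option.case prod.case by blast
  qed
qed

lemma height_word: "sum_list (map (weight Q) (word w)) = height hgt w"
  by (induction w) (simp_all add: hgt_def)

text \<open>
  A label in \<open>Sneg\<close> is the class of some word of negative edges, and such a word acts on the initial state in
  the same way as the word of the path; this identifies the normal form. The other cases are alike.
\<close>
lemma label_types:
  assumes w: "awalk u w v" "w \<noteq> []" and run: "run Q (word w) (start u) = Some (t, a, b)"
  shows "label w \<in> Sneg Q \<longleftrightarrow> a = [] \<and> b \<noteq> []"
    and "label w \<in> Spos Q \<longleftrightarrow> a \<noteq> [] \<and> b = []"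
    and "label w \<in> Sone Q \<longleftrightarrow> a = [] \<and> b = []"
    and "height hgt w = int (length a) - int (length b)"
proof -
  have nz: "label w \<noteq> szero Q" and red: "reduced (cell u) (t, a, b)"
    and eq: "label w = scls Q (nword (cell u) (t, a, b))"
    using label_run[OF w] run by auto
  have sub: "set w \<subseteq> arcs G" using w(1) by (auto simp: awalk_def)
  have lw: "word w \<in> swords Q" "label w = scls Q (word w)" using label_word[OF w(2) sub] by auto
  have run_eq: "run Q x (start u) = Some (t, a, b)" if "label w = scls Q x" "x \<in> swords Q" for x
    using scls_eq_run[of "word w" x] that lw run by simp
  have ab: "set a \<subseteq> pos_arcs Q" "set b \<subseteq> neg_arcs Q" using red by (auto simp: reduced_def)
  show "label w \<in> Sneg Q \<longleftrightarrow> a = [] \<and> b \<noteq> []"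
  proof
    assume "label w \<in> Sneg Q"
    then obtain es where es: "es \<noteq> []" "set es \<subseteq> neg_arcs Q" "label w = scls Q (map GEdge es)"
      by (auto simp: Sneg_iff)
    then have "map GEdge es \<in> swords Q" by (intro edges_swords) (auto simp: arcs_base)
    from run_neg_word[OF es(2) run_eq[OF es(3) this]] show "a = [] \<and> b \<noteq> []" using es(1) by simp
  next
    assume "a = [] \<and> b \<noteq> []"
    then show "label w \<in> Sneg Q" using scls_nword_drop[OF red] eq nz ab by (auto simp: Sneg_iff)
  qed
  show "label w \<in> Spos Q \<longleftrightarrow> a \<noteq> [] \<and> b = []"
  proof
    assume "label w \<in> Spos Q"
    then obtain es where es: "es \<noteq> []" "set es \<subseteq> pos_arcs Q" "label w = scls Q (map GEdge es)"
      by (auto simp: Spos_iff)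
    then have "map GEdge es \<in> swords Q" by (intro edges_swords) (auto simp: arcs_base)
    from run_pos_word[OF _ run_eq[OF es(3) this]] show "a \<noteq> [] \<and> b = []"
      using es(1,2) neg_pos_disjoint by blast
  next
    assume "a \<noteq> [] \<and> b = []"
    then show "label w \<in> Spos Q" using scls_nword_drop[OF red] eq nz ab by (auto simp: Spos_iff)
  qed
  show "label w \<in> Sone Q \<longleftrightarrow> a = [] \<and> b = []"
  proof
    assume "label w \<in> Sone Q"
    then obtain p where p: "p \<in> verts (base Q)" "label w = scls Q [GOne p]" by (auto simp: Sone_iff)
    then have "run Q [GOne p] (start u) = Some (t, a, b)" by (intro run_eq) (auto simp: swords_def)
    then show "a = [] \<and> b = []" by (auto split: if_splits)
  next
    assume "a = [] \<and> b = []"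
    moreover have "cell u \<in> verts (base Q)" using w(1) by (intro cell) auto
    ultimately show "label w \<in> Sone Q" using eq by (auto simp: Sone_iff nword_def)
  qed
  show "height hgt w = int (length a) - int (length b)"
    using run_weight[OF run] by (simp add: height_word)
qed

text \<open>
  A label is low if its normal form has no positive edges, and high if it has no negative edges.
\<close>
definition low :: "'s list \<Rightarrow> bool" where
  "low w \<longleftrightarrow> label w \<in> Sneg Q \<union> Sone Q"

definition high :: "'s list \<Rightarrow> bool" where
  "high w \<longleftrightarrow> label w \<in> Sone Q \<union> Spos Q"

lemma low_high_nonzero: "low w \<or> high w \<Longrightarrow> label w \<noteq> szero Q"
  using Sone_nonzero by (auto simp: low_def high_def Sneg_iff Spos_iff)

lemma nonzero_runE:
  assumes "awalk u w v" "w \<noteq> []" "label w \<noteq> szero Q"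
  obtains a b where "run Q (word w) (start u) = Some (cell v, a, b)"
  using label_run[OF assms(1,2)] assms(3) by (cases "run Q (word w) (start u)") auto

lemma low_run:
  assumes "awalk u w v" "w \<noteq> []"
  shows "low w \<longleftrightarrow> (\<exists>b. run Q (word w) (start u) = Some (cell v, [], b))"
proof
  assume low: "low w"
  then obtain a b where r: "run Q (word w) (start u) = Some (cell v, a, b)"
    using nonzero_runE[OF assms] low_high_nonzero by blast
  then show "\<exists>b. run Q (word w) (start u) = Some (cell v, [], b)"
    using low label_types[OF assms r] by (auto simp: low_def)
next
  assume "\<exists>b. run Q (word w) (start u) = Some (cell v, [], b)"
  then show "low w" using label_types[OF assms] by (auto simp: low_def)
qed

lemma high_run:
  assumes "awalk u w v" "w \<noteq> []"
  shows "high w \<longleftrightarrow> (\<exists>a. run Q (word w) (start u) = Some (cell v, a, []))"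
proof
  assume high: "high w"
  then obtain a b where r: "run Q (word w) (start u) = Some (cell v, a, b)"
    using nonzero_runE[OF assms] low_high_nonzero by blast
  then show "\<exists>a. run Q (word w) (start u) = Some (cell v, a, [])"
    using high label_types[OF assms r] by (auto simp: high_def)
next
  assume "\<exists>a. run Q (word w) (start u) = Some (cell v, a, [])"
  then show "high w" using label_types[OF assms] by (auto simp: high_def)
qed

lemma label_height:
  assumes w: "awalk u w v" "w \<noteq> []" and lh: "low w \<or> high w"
  shows "label w \<in> Sneg Q \<longleftrightarrow> height hgt w < 0" "label w \<in> Sone Q \<longleftrightarrow> height hgt w = 0"
    "label w \<in> Spos Q \<longleftrightarrow> height hgt w > 0"
    "low w \<longleftrightarrow> height hgt w \<le> 0" "high w \<longleftrightarrow> height hgt w \<ge> 0"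
proof -
  obtain a b where r: "run Q (word w) (start u) = Some (cell v, a, b)"
    using nonzero_runE[OF w] low_high_nonzero lh by blast
  note types = label_types[OF w r]
  have ab: "a = [] \<or> b = []" using lh types by (auto simp: low_def high_def)
  then show "label w \<in> Sneg Q \<longleftrightarrow> height hgt w < 0" "label w \<in> Sone Q \<longleftrightarrow> height hgt w = 0"
    "label w \<in> Spos Q \<longleftrightarrow> height hgt w > 0"
    unfolding types by auto
  show "low w \<longleftrightarrow> height hgt w \<le> 0" "high w \<longleftrightarrow> height hgt w \<ge> 0"
    using ab unfolding low_def high_def Un_iff types by auto
qed

text \<open>
  Low labels compose to low labels, and the product is not zero: the target cell of the first path is the
  source cell of the second one, and negative paths can be concatenated freely.
\<close>
lemma low_append:
  assumes w: "awalk u (w @ w') v" "w \<noteq> []" "w' \<noteq> []" and low: "low w" "low w'"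
  shows "low (w @ w')"
proof -
  obtain v1 where v1: "awalk u w v1" "awalk v1 w' v" using w(1) by (auto simp: awalk_append_iff)
  obtain b where b: "run Q (word w) (start u) = Some (cell v1, [], b)"
    using low_run[OF v1(1) w(2)] low(1) by blast
  obtain b' where b': "run Q (word w') (start v1) = Some (cell v, [], b')"
    using low_run[OF v1(2) w(3)] low(2) by blast
  have "run Q (word (w @ w')) (start u) = Some (cell v, [], b @ b')"
    using b run_below[OF b', of "[]" b] by simp
  then show ?thesis using low_run[OF w(1)] w(2) by auto
qed

lemma high_append:
  assumes w: "awalk u (w @ w') v" "w \<noteq> []" "w' \<noteq> []" and high: "high w" "high w'"
  shows "high (w @ w')"
proof -
  obtain v1 where v1: "awalk u w v1" "awalk v1 w' v" using w(1) by (auto simp: awalk_append_iff)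
  obtain a where a: "run Q (word w) (start u) = Some (cell v1, a, [])"
    using high_run[OF v1(1) w(2)] high(1) by blast
  obtain a' where a': "run Q (word w') (start v1) = Some (cell v, a', [])"
    using high_run[OF v1(2) w(3)] high(2) by blast
  have "run Q (word (w @ w')) (start u) = Some (cell v, a @ a', [])"
    using a run_above[OF a', of a] by simp
  then show ?thesis using high_run[OF w(1)] w(2) by auto
qed

text \<open>
  In the product of a negative path with a positive path the shorter one is used up by cancellation, unless
  the product is zero.
\<close>
lemma low_high_append:
  assumes w: "awalk u (w @ w') v" "w \<noteq> []" "w' \<noteq> []" and lh: "low w" "high w'"
    and nz: "label (w @ w') \<noteq> szero Q"
  shows "low (w @ w') \<or> high (w @ w')"
proof -
  obtain v1 where v1: "awalk u w v1" "awalk v1 w' v" using w(1) by (auto simp: awalk_append_iff)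
  obtain b where b: "run Q (word w) (start u) = Some (cell v1, [], b)"
    using low_run[OF v1(1) w(2)] lh(1) by blast
  obtain a' b' where ab': "run Q (word (w @ w')) (start u) = Some (cell v, a', b')"
    using nonzero_runE[OF w(1) _ nz] w(2) by auto
  then have r: "run Q (word w') (Some (cell v1, [], b)) = Some (cell v, a', b')" using b by simp
  have lw': "word w' \<in> swords Q" "label w' = scls Q (word w')"
    using label_word[OF w(3)] v1(2) by (auto simp: awalk_def)
  have "a' = [] \<or> b' = []"
    using lh(2) unfolding high_def
  proof
    assume "label w' \<in> Sone Q"
    then obtain p where p: "p \<in> verts (base Q)" "label w' = scls Q [GOne p]" by (auto simp: Sone_iff)
    then have "run Q [GOne p] (Some (cell v1, [], b)) = Some (cell v, a', b')"
      using scls_eq_run[of "word w'" "[GOne p]"] lw' r by (simp add: swords_def)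
    then show ?thesis by (auto split: if_splits)
  next
    assume "label w' \<in> Spos Q"
    then obtain es where es: "es \<noteq> []" "set es \<subseteq> pos_arcs Q" "label w' = scls Q (map GEdge es)"
      by (auto simp: Spos_iff)
    then have "map GEdge es \<in> swords Q" by (intro edges_swords) (auto simp: arcs_base)
    then have "run Q (map GEdge es) (Some (cell v1, [], b)) = Some (cell v, a', b')"
      using scls_eq_run[of "word w'" "map GEdge es"] lw' es r by simp
    moreover have "set es \<inter> neg_arcs Q = {}" using es(2) neg_pos_disjoint by blast
    ultimately show ?thesis using run_pos_word[of es Q "cell v1" "[]" b] by blast
  qed
  then show ?thesis using ab' low_run[OF w(1)] high_run[OF w(1)] w(2) by auto
qed

text \<open>Positive edges produced by a prefix stay in the normal form of the whole word.\<close>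
lemma low_prefix:
  assumes w: "awalk u (w @ w') v" "w \<noteq> []" and low: "low (w @ w')"
  shows "low w"
proof -
  obtain v1 where v1: "awalk u w v1" using w(1) by (auto simp: awalk_append_iff)
  obtain b where b: "run Q (word w') (run Q (word w) (start u)) = Some (cell v, [], b)"
    using low_run[OF w(1)] low w(2) by auto
  then obtain t a1 b1 where r: "run Q (word w) (start u) = Some (t, a1, b1)"
    by (cases "run Q (word w) (start u)") auto
  have "a1 = []" using b run_prefix[of Q "word w'" t a1 b1] unfolding r by blast
  then show ?thesis using low_run[OF v1 w(2)] r walk_run_target[OF v1 r] by simp
qed

lemma low_high_arc: "s \<in> arcs G \<Longrightarrow> low [s] \<or> high [s]"
  using lam_types by (auto simp: low_def high_def)

end


section \<open>The codes of a presentation and the zeta function\<close>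

context presentation
begin

abbreviation adm :: "'s list set" where
  "adm \<equiv> admissible Q G lam"

lemma adm_iff: "w \<in> adm \<longleftrightarrow> w \<noteq> [] \<and> (\<exists>u v. awalk u w v) \<and> label w \<noteq> szero Q"
  by (auto simp: admissible_def is_path_def)

lemma smult_szero:
  assumes "u \<in> swords Q"
  shows "Defs.smult Q (scls Q u) (szero Q) = szero Q" "Defs.smult Q (szero Q) (scls Q u) = szero Q"
proof -
  have z: "[GZero] \<in> swords Q" and u: "u \<in> lists (sgens Q)" using assms by (auto simp: swords_def)
  show "Defs.smult Q (scls Q u) (szero Q) = szero Q"
    using smult_scls[OF assms z] scls_GZero[OF u, of "[]"] by (simp add: szero_def)
  show "Defs.smult Q (szero Q) (scls Q u) = szero Q"
    using smult_scls[OF z assms] scls_GZero[of "[]" u] u by (simp add: szero_def)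
qed

lemma label_append_nonzero:
  assumes "u \<noteq> []" "v \<noteq> []" "set (u @ v) \<subseteq> arcs G" "label (u @ v) \<noteq> szero Q"
  shows "label u \<noteq> szero Q" "label v \<noteq> szero Q"
proof -
  have u: "word u \<in> swords Q" "label u = scls Q (word u)" and v: "word v \<in> swords Q" "label v = scls Q (word v)"
    using label_word[of u] label_word[of v] assms by auto
  show "label u \<noteq> szero Q" using label_append[OF assms(1-3)] assms(4) smult_szero(2)[OF v(1)] v(2) by auto
  show "label v \<noteq> szero Q" using label_append[OF assms(1-3)] assms(4) smult_szero(1)[OF u(1)] u(2) by auto
qed

lemma adm_factor:
  assumes "u @ v @ w \<in> adm" "v \<noteq> []"
  shows "v \<in> adm"
proof -
  obtain x y where walk: "awalk x (u @ v @ w) y" and nz: "label (u @ v @ w) \<noteq> szero Q"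
    using assms(1) by (auto simp: adm_iff)
  have sub: "set (u @ v @ w) \<subseteq> arcs G" using walk by (auto simp: awalk_def)
  have "label (v @ w) \<noteq> szero Q"
    using label_append_nonzero(2)[of u "v @ w"] assms(2) nz sub by (cases "u = []") auto
  then have "label v \<noteq> szero Q"
    using label_append_nonzero(1)[of v w] assms(2) sub by (cases "w = []") auto
  moreover have "\<exists>x y. awalk x v y" using walk by (auto simp: awalk_append_iff)
  ultimately show ?thesis using assms(2) by (auto simp: adm_iff)
qed

lemma window_closed_walk:
  assumes x: "x \<in> subshift_of adm" "periodic n x" and n: "n > 0"
  shows "window x i n \<in> closed_walks G"
proof -
  have "window x i (n + 1) \<in> adm" using x(1) by (simp add: subshift_of_def)
  moreover have "window x i (n + 1) = window x i n @ [x (i + int n)]"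
    by (simp only: window_add window_1 One_nat_def)
  ultimately obtain u v where walk: "awalk u (window x i n @ [x (i + int n)]) v"
    unfolding adm_iff by metis
  have xn: "x (i + int n) = x i" using x(2) by (simp add: periodic_def)
  have "u = tail G (x i)"
    using walk n by (cases n) (auto simp: window_def upt_conv_Cons awalk_Cons_iff simp del: upt_Suc)
  moreover have "awalk u (window x i n) (tail G (x i))"
    using walk xn by (auto simp: awalk_append_iff awalk_Cons_iff)
  ultimately show ?thesis by (auto simp: closed_walks_def)
qed

sublocale language: factorial_language adm "closed_walks G" "arcs G"
proof
  show "finite (arcs G)" by simp
  show "adm \<subseteq> lists (arcs G)" by (auto simp: adm_iff awalk_def in_lists_conv_set subset_iff)
qed (rule adm_factor window_closed_walk; assumption)+

text \<open>
  Extending a suffix by one arc to the left either multiplies two high labels or a low label with a high one,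
  and the result remains pure. The hypothesis on the heights guarantees that the suffixes met on the way
  are high.
\<close>
lemma low_high_suffix:
  assumes w: "awalk u w v" "w \<in> adm"
    and suffixes: "\<And>x y. w = x @ y \<Longrightarrow> x \<noteq> [] \<Longrightarrow> y \<noteq> [] \<Longrightarrow> height hgt y > 0"
  shows "low w \<or> high w"
  using w suffixes
proof (induction w arbitrary: u)
  case Nil
  then show ?case by (simp add: adm_iff)
next
  case (Cons s w)
  have s: "s \<in> arcs G" using Cons.prems(1) by (simp add: awalk_Cons_iff)
  show ?case
  proof (cases "w = []")
    case True
    then show ?thesis using low_high_arc[OF s] by simp
  next
    case False
    have walk: "awalk (head G s) w v" using Cons.prems(1) by (simp add: awalk_Cons_iff)
    have "w \<in> adm" using adm_factor[of "[s]" w "[]"] Cons.prems(2) False by simp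
    moreover have "height hgt y > 0" if "w = x @ y" "x \<noteq> []" "y \<noteq> []" for x y
      using Cons.prems(3)[of "s # x" y] that by simp
    ultimately have "low w \<or> high w" using Cons.IH[OF walk] by blast
    moreover have "height hgt w > 0" using Cons.prems(3)[of "[s]" w] False by simp
    ultimately have high: "high w" using label_height[OF walk False] by auto
    have walk': "awalk u ([s] @ w) v" and nz: "label ([s] @ w) \<noteq> szero Q"
      using Cons.prems by (auto simp: adm_iff)
    show ?thesis
      using low_high_arc[OF s] low_high_append[OF walk' _ False _ high nz] high_append[OF walk' _ False _ high]
      by auto
  qed
qed

lemma low_high_prefix:
  assumes w: "awalk u w v" "w \<in> adm"
    and prefixes: "\<And>x y. w = x @ y \<Longrightarrow> x \<noteq> [] \<Longrightarrow> y \<noteq> [] \<Longrightarrow> height hgt x < 0"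
  shows "low w \<or> high w"
  using w prefixes
proof (induction w arbitrary: v rule: rev_induct)
  case Nil
  then show ?case by (simp add: adm_iff)
next
  case (snoc s w)
  have s: "s \<in> arcs G" using snoc.prems(1) by (auto simp: awalk_append_iff awalk_Cons_iff)
  show ?case
  proof (cases "w = []")
    case True
    then show ?thesis using low_high_arc[OF s] by simp
  next
    case False
    obtain t where walk: "awalk u w t" using snoc.prems(1) by (auto simp: awalk_append_iff)
    have "w \<in> adm" using adm_factor[of "[]" w "[s]"] snoc.prems(2) False by simp
    moreover have "height hgt x < 0" if "w = x @ y" "x \<noteq> []" "y \<noteq> []" for x y
      using snoc.prems(3)[of x "y @ [s]"] that by simp
    ultimately have "low w \<or> high w" using snoc.IH[OF walk] by blast
    moreover have "height hgt w < 0" using snoc.prems(3)[of w "[s]"] False by simp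
    ultimately have low: "low w" using label_height[OF walk False] by auto
    have nz: "label (w @ [s]) \<noteq> szero Q" using snoc.prems by (auto simp: adm_iff)
    show ?thesis
      using low_high_arc[OF s] low_append[OF snoc.prems(1) False _ low] low_high_append[OF snoc.prems(1) False _ low _ nz]
      by auto
  qed
qed

lemma descents_low: "c \<in> descents hgt adm \<Longrightarrow> low c"
proof -
  assume c: "c \<in> descents hgt adm"
  then obtain u v where walk: "awalk u c v" and ne: "c \<noteq> []" by (auto simp: descents_def adm_iff)
  have "low c \<or> high c"
    using c walk by (intro low_high_suffix[OF walk]) (auto simp: descents_def awalk_def subset_iff)
  then show "low c" using label_height(4)[OF walk ne] c by (auto simp: descents_def)
qed

lemma ascents_high: "c \<in> ascents hgt adm \<Longrightarrow> high c"
proof -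
  assume c: "c \<in> ascents hgt adm"
  then obtain u v where walk: "awalk u c v" and ne: "c \<noteq> []" by (auto simp: ascents_def adm_iff)
  have "low c \<or> high c"
    using c by (intro low_high_prefix[OF walk]) (auto simp: ascents_def)
  then show "high c" using label_height(5)[OF walk ne] c by (auto simp: ascents_def)
qed

text \<open>Stated for low and high labels at once, as both are closed under composition along paths.\<close>
lemma concat_adm:
  assumes P: "P = low \<or> P = high"
    and walk: "awalk u (concat ds) v" and ds: "ds \<noteq> []" "\<And>d. d \<in> set ds \<Longrightarrow> d \<noteq> [] \<and> P d"
  shows "concat ds \<in> adm"
proof -
  have "P (concat ds) \<and> concat ds \<noteq> []"
    using ds walk
  proof (induction ds arbitrary: u rule: list_nonempty_induct)
    case (cons d ds)
    then obtain t where t: "awalk u d t" "awalk t (concat ds) v" by (auto simp: awalk_append_iff)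
    have d: "d \<noteq> []" "P d" using cons.prems(1)[of d] by auto
    have IH: "P (concat ds)" "concat ds \<noteq> []" using cons.IH[OF _ t(2)] cons.prems(1) by auto
    have "awalk u (d @ concat ds) v" using cons.prems(2) by simp
    then have "P (d @ concat ds)"
      using P d IH low_append[of u d "concat ds" v] high_append[of u d "concat ds" v] by blast
    then show ?case using d by simp
  qed simp
  then show ?thesis using walk P low_high_nonzero[of "concat ds"] by (auto simp: adm_iff)
qed

lemma awalk_replicate: "awalk u w u \<Longrightarrow> awalk u (concat (replicate k w)) u"
  by (induction k) (auto simp: awalk_Nil_iff intro: awalk_hd_in_verts awalk_appendI)

lemma concat_power_adm:
  assumes P: "P = low \<or> P = high" and cs: "\<And>c. c \<in> set cs \<Longrightarrow> c \<noteq> [] \<and> P c"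
    and closed: "concat cs \<in> closed_walks G" and ne: "cs \<noteq> []" "k > 0"
  shows "concat (replicate k (concat cs)) \<in> adm"
proof -
  have concat: "concat (replicate k (concat cs)) = concat (concat (replicate k cs))"
    by (induction k) auto
  obtain u where "awalk u (concat cs) u" using closed by (auto simp: closed_walks_def)
  then have "awalk u (concat (concat (replicate k cs))) u"
    using awalk_replicate[of u "concat cs" k] unfolding concat by simp
  moreover have "concat (replicate k cs) \<noteq> []" using ne by (cases k) auto
  moreover have "d \<noteq> [] \<and> P d" if "d \<in> set (concat (replicate k cs))" for d
    using that cs by auto
  ultimately show ?thesis unfolding concat by (rule concat_adm[OF P])
qed

lemma card_periodic_subshift:
  assumes n: "n > 0"
  shows "of_nat (card {x \<in> subshift_of adm. periodic n x})
    = (\<Sum>cs\<in>factorizations (descents hgt adm) (closed_walks G) n. of_nat n / of_nat (length cs))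
    + (\<Sum>cs\<in>factorizations (ascents hgt adm) (closed_walks G) n. of_nat n / of_nat (length cs))
    - (\<Sum>cs\<in>factorizations {c \<in> descents hgt adm. height hgt c = 0} (closed_walks G) n.
        of_nat n / of_nat (length cs) :: complex)"
proof (rule language.card_periodic_points[OF n])
  fix cs :: "'s list list" and k :: nat
  assume closed: "concat cs \<in> closed_walks G" "cs \<noteq> []" "k > 0"
  show "concat (replicate k (concat cs)) \<in> adm" if "cs \<in> lists (descents hgt adm)"
    using that by (intro concat_power_adm[of low] closed) (auto simp: descents_low descents_def)
  show "concat (replicate k (concat cs)) \<in> adm" if "cs \<in> lists (ascents hgt adm)"
    using that by (intro concat_power_adm[of high] closed) (auto simp: ascents_high ascents_def)
qed

lemma adm_letter: "[s] \<in> adm \<longleftrightarrow> s \<in> arcs G"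
proof
  assume s: "s \<in> arcs G"
  then have "label [s] \<noteq> szero Q" using low_high_nonzero[of "[s]"] low_high_arc by blast
  then show "[s] \<in> adm" using arc_implies_awalk[OF s] unfolding adm_iff by blast
qed (auto simp: adm_iff awalk_Cons_iff)

lemma Sigma_neg_iff: "s \<in> Sigma_neg Q G lam \<longleftrightarrow> s \<in> arcs G \<and> hgt s \<le> 0"
  using label_height(4)[OF arc_implies_awalk, of s] low_high_arc[of s] by (auto simp: Sigma_neg_def low_def)

lemma Sigma_pos_iff: "s \<in> Sigma_pos Q G lam \<longleftrightarrow> s \<in> arcs G \<and> hgt s \<ge> 0"
  using label_height(5)[OF arc_implies_awalk, of s] low_high_arc[of s] by (auto simp: Sigma_pos_def high_def)

text \<open>
  Purity of all suffixes translates the conditions on labels in \<open>code_neg_init\<close> into conditions on heights.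
  Words of length one are the only descents that are not in \<open>code_neg_init\<close>.
\<close>
lemma descents_eq: "descents hgt adm = code_neg_init Q G lam \<union> letters (Sigma_neg Q G lam)"
proof (intro equalityI subsetI)
  fix c assume c: "c \<in> descents hgt adm"
  then obtain u v where walk: "awalk u c v" and adm: "c \<in> adm" and ne: "c \<noteq> []"
    by (auto simp: descents_def adm_iff)
  show "c \<in> code_neg_init Q G lam \<union> letters (Sigma_neg Q G lam)"
  proof (cases "length c > 1")
    case True
    have "plabel Q lam (drop (J - 1) c) \<in> Spos Q" if J: "1 < J" "J \<le> length c" for J
    proof -
      define x y where "x = take (J - 1) c" and "y = drop (J - 1) c"
      have xy: "c = x @ y" "x \<noteq> []" "y \<noteq> []" using J ne by (auto simp: x_def y_def)
      obtain t where t: "awalk t y v" using walk xy by (auto simp: awalk_append_iff)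
      have pos: "height hgt y' > 0" if "y = x' @ y'" "y' \<noteq> []" for x' y'
        using c xy that unfolding descents_def by (force simp: append_assoc[symmetric] simp del: append_assoc)
      have "y \<in> adm" using adm_factor[of x y "[]"] adm xy by simp
      then have "low y \<or> high y"
        using pos t by (intro low_high_suffix[OF t]) (auto simp: awalk_def subset_iff)
      then show ?thesis using label_height(3)[OF t xy(3)] pos[of "[]" y] xy(3) by (simp add: y_def)
    qed
    then show ?thesis using descents_low[OF c] adm True by (auto simp: code_neg_init_def low_def)
  next
    case False
    then obtain s where "c = [s]" using ne by (cases c) auto
    then show ?thesis using c by (auto simp: descents_def letters_def Sigma_neg_iff adm_letter)
  qed
next
  fix c assume "c \<in> code_neg_init Q G lam \<union> letters (Sigma_neg Q G lam)"
  then show "c \<in> descents hgt adm"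
  proof
    assume c: "c \<in> code_neg_init Q G lam"
    then have adm: "c \<in> adm" and low: "low c" by (auto simp: code_neg_init_def low_def)
    obtain u v where walk: "awalk u c v" and ne: "c \<noteq> []" using adm by (auto simp: adm_iff)
    have "height hgt y > 0" if xy: "c = x @ y" "x \<noteq> []" "y \<noteq> []" for x y
    proof -
      have "1 < length x + 1" "length x + 1 \<le> length c" using xy by (auto simp: Suc_le_eq)
      then have pos: "label y \<in> Spos Q" using c xy(1) unfolding code_neg_init_def by fastforce
      obtain t where t: "awalk t y v" using walk xy by (auto simp: awalk_append_iff)
      show ?thesis using label_height(3)[OF t xy(3)] pos by (auto simp: high_def)
    qed
    then show ?thesis
      using adm ne label_height(4)[OF walk ne] low by (auto simp: descents_def)
  next
    assume "c \<in> letters (Sigma_neg Q G lam)"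
    then show ?thesis by (auto simp: letters_def descents_def Sigma_neg_iff adm_letter Cons_eq_append_conv)
  qed
qed

lemma ascents_eq: "ascents hgt adm = code_pos_init Q G lam \<union> letters (Sigma_pos Q G lam)"
proof (intro equalityI subsetI)
  fix c assume c: "c \<in> ascents hgt adm"
  then obtain u v where walk: "awalk u c v" and adm: "c \<in> adm" and ne: "c \<noteq> []"
    by (auto simp: ascents_def adm_iff)
  show "c \<in> code_pos_init Q G lam \<union> letters (Sigma_pos Q G lam)"
  proof (cases "length c > 1")
    case True
    have "plabel Q lam (take J c) \<in> Sneg Q" if J: "1 \<le> J" "J < length c" for J
    proof -
      define x y where "x = take J c" and "y = drop J c"
      have xy: "c = x @ y" "x \<noteq> []" "y \<noteq> []" using J ne by (auto simp: x_def y_def)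
      obtain t where t: "awalk u x t" using walk xy by (auto simp: awalk_append_iff)
      have neg: "height hgt x' < 0" if "x = x' @ y'" "x' \<noteq> []" for x' y'
        using c xy that unfolding ascents_def by force
      have "x \<in> adm" using adm_factor[of "[]" x y] adm xy by simp
      then have "low x \<or> high x" using neg by (intro low_high_prefix[OF t]) auto
      then show ?thesis using label_height(1)[OF t xy(2)] neg[of x "[]"] xy(2) by (simp add: x_def)
    qed
    then show ?thesis using ascents_high[OF c] adm True by (auto simp: code_pos_init_def high_def)
  next
    case False
    then obtain s where "c = [s]" using ne by (cases c) auto
    then show ?thesis using c by (auto simp: ascents_def letters_def Sigma_pos_iff adm_letter)
  qed
next
  fix c assume "c \<in> code_pos_init Q G lam \<union> letters (Sigma_pos Q G lam)"
  then show "c \<in> ascents hgt adm"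
  proof
    assume c: "c \<in> code_pos_init Q G lam"
    then have adm: "c \<in> adm" and high: "high c" by (auto simp: code_pos_init_def high_def)
    obtain u v where walk: "awalk u c v" and ne: "c \<noteq> []" using adm by (auto simp: adm_iff)
    have "height hgt x < 0" if xy: "c = x @ y" "x \<noteq> []" "y \<noteq> []" for x y
    proof -
      have "1 \<le> length x" "length x < length c" using xy by (auto simp: Suc_le_eq)
      then have neg: "label x \<in> Sneg Q" using c xy(1) unfolding code_pos_init_def by fastforce
      obtain t where t: "awalk u x t" using walk xy by (auto simp: awalk_append_iff)
      show ?thesis using label_height(1)[OF t xy(2)] neg by (auto simp: low_def)
    qed
    then show ?thesis
      using adm ne label_height(5)[OF walk ne] high by (auto simp: ascents_def)
  next
    assume "c \<in> letters (Sigma_pos Q G lam)"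
    then show ?thesis by (auto simp: letters_def ascents_def Sigma_pos_iff adm_letter Cons_eq_append_conv)
  qed
qed

text \<open>
  A prefix of a word with label in \<open>Sone\<close> is low. If it is not in \<open>Sone\<close>, its height is negative, and then
  the complementary suffix has positive height.
\<close>
lemma code_zero_eq: "code_zero Q G lam = {c \<in> descents hgt adm. height hgt c = 0}"
proof (intro equalityI subsetI)
  fix c assume c: "c \<in> code_zero Q G lam"
  then have adm: "c \<in> adm" and one: "label c \<in> Sone Q" by (auto simp: code_zero_def)
  then have low: "low c" by (simp add: low_def)
  obtain u v where walk: "awalk u c v" and ne: "c \<noteq> []" using adm by (auto simp: adm_iff)
  have zero: "height hgt c = 0" using label_height(2)[OF walk ne] low one by simp
  have "height hgt y > 0" if xy: "c = x @ y" "x \<noteq> []" "y \<noteq> []" for x y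
  proof -
    have "1 \<le> length x" "length x < length c" using xy by (auto simp: Suc_le_eq)
    then have not_one: "label x \<notin> Sone Q" using c xy(1) unfolding code_zero_def by fastforce
    obtain t where t: "awalk u x t" using walk xy by (auto simp: awalk_append_iff)
    have "low x" using low_prefix[of u x y v] walk low xy by simp
    then have "height hgt x < 0"
      using label_height(2,4)[OF t xy(2)] not_one by (auto simp: order_le_less)
    then show ?thesis using zero xy(1) by simp
  qed
  then show "c \<in> {c \<in> descents hgt adm. height hgt c = 0}"
    using adm ne zero by (auto simp: descents_def)
next
  fix c assume "c \<in> {c \<in> descents hgt adm. height hgt c = 0}"
  then have c: "c \<in> descents hgt adm" and zero: "height hgt c = 0" by auto
  then obtain u v where walk: "awalk u c v" and adm: "c \<in> adm" and ne: "c \<noteq> []"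
    by (auto simp: descents_def adm_iff)
  have one: "label c \<in> Sone Q" using label_height(2)[OF walk ne] descents_low[OF c] zero by simp
  have "label (take J c) \<notin> Sone Q" if J: "1 \<le> J" "J < length c" for J
  proof
    assume one: "label (take J c) \<in> Sone Q"
    define x y where "x = take J c" and "y = drop J c"
    have xy: "c = x @ y" "x \<noteq> []" "y \<noteq> []" using J ne by (auto simp: x_def y_def)
    obtain t where t: "awalk u x t" using walk xy by (auto simp: awalk_append_iff)
    have "height hgt x = 0" using label_height(2)[OF t xy(2)] one by (simp add: low_def x_def)
    moreover have "height hgt y > 0" using c xy by (auto simp: descents_def)
    ultimately show False using zero xy(1) by simp
  qed
  moreover have "1 \<le> length c" using ne by (cases c) auto
  ultimately show "c \<in> code_zero Q G lam" using adm one by (auto simp: code_zero_def)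
qed

text \<open>
  The last letter of a word of \<open>code_neg_init\<close> has positive height, so that it is not an arc of \<open>Sigma_neg\<close>.
\<close>
lemma det_code_neg:
  "det_one_minus_transition G (Sigma_neg Q G lam) * det_one_minus_gen G (code_neg Q G lam)
    = det_one_minus_gen G (descents hgt adm)"
  unfolding code_neg_def descents_eq
proof (rule det_one_minus_gen_code_closure)
  show "Sigma_neg Q G lam \<subseteq> arcs G" by (auto simp: Sigma_neg_def)
  show "length c > 1" if "c \<in> code_neg_init Q G lam" for c using that by (simp add: code_neg_init_def)
  show "c @ [s] \<notin> code_neg_init Q G lam"
    if c: "c \<in> code_closure G (code_neg_init Q G lam) (Sigma_neg Q G lam)" and s: "s \<in> Sigma_neg Q G lam" for c s
  proof
    assume "c @ [s] \<in> code_neg_init Q G lam"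
    then have "c @ [s] \<in> descents hgt adm" by (simp add: descents_eq)
    moreover have "c \<noteq> []" using c by (auto simp: code_closure_def code_neg_init_def)
    ultimately have "height hgt [s] > 0" unfolding descents_def by blast
    then show False using s by (simp add: Sigma_neg_iff)
  qed
qed

text \<open>
  The words of \<open>code_pos_init\<close> may well end with an arc of \<open>Sigma_pos\<close>. Here the factorization is unambiguous
  because no ascent is a proper prefix of an ascent.
\<close>
lemma det_code_pos:
  "det_one_minus_transition G (Sigma_pos Q G lam) * det_one_minus_gen G (code_pos Q G lam)
    = det_one_minus_gen G (ascents hgt adm)"
  unfolding code_pos_def ascents_eq
proof (rule det_one_minus_gen_code_closure)
  show "Sigma_pos Q G lam \<subseteq> arcs G" by (auto simp: Sigma_pos_def)
  show "length c > 1" if "c \<in> code_pos_init Q G lam" for c using that by (simp add: code_pos_init_def)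
  show "c @ [s] \<notin> code_pos_init Q G lam"
    if c: "c \<in> code_closure G (code_pos_init Q G lam) (Sigma_pos Q G lam)" and s: "s \<in> Sigma_pos Q G lam" for c s
  proof
    assume "c @ [s] \<in> code_pos_init Q G lam"
    then have cs: "c @ [s] \<in> ascents hgt adm" by (simp add: ascents_eq)
    have "\<exists>k w. c = k @ w \<and> k \<in> code_pos_init Q G lam"
    proof (cases "c \<in> code_pos_init Q G lam")
      case True
      then show ?thesis by (intro exI[of _ c] exI[of _ "[]"]) simp
    next
      case False
      then show ?thesis using c unfolding code_closure_def by blast
    qed
    then obtain k w where k: "c = k @ w" "k \<in> ascents hgt adm" by (auto simp: ascents_eq)
    then have "k \<noteq> []" "height hgt k \<ge> 0" by (auto simp: ascents_def)
    moreover have "c @ [s] = k @ (w @ [s])" using k by simp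
    ultimately show False using cs unfolding ascents_def by force
  qed
qed

lemma num_periodic_eq: "num_periodic (presented_subshift Q G lam) n = card {x \<in> subshift_of adm. periodic n x}"
proof -
  have shift: "(shift ^^ n) x = (\<lambda>i. x (i + int n))" for x :: "int \<Rightarrow> 's"
    by (induction n) (auto simp: shift_def algebra_simps)
  show ?thesis
    by (simp add: num_periodic_def presented_subshift_def subshift_of_def window_def periodic_def shift fun_eq_iff)
qed

text \<open>
  The logarithmic derivative of the zeta function has the numbers of periodic points as coefficients, and
  these are the alternating sum of the coefficients that belong to the three determinants.
\<close>
lemma zeta_presented_subshift:
  "zeta (presented_subshift Q G lam) =
    det_one_minus_gen G (code_zero Q G lam) /
    (det_one_minus_transition G (Sigma_neg Q G lam) * det_one_minus_gen G (code_neg Q G lam) *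
     det_one_minus_gen G (code_pos Q G lam) * det_one_minus_transition G (Sigma_pos Q G lam))"
proof -
  let ?X = "presented_subshift Q G lam"
  let ?L = "Abs_fps (\<lambda>n. if n = 0 then 0 else of_nat (num_periodic ?X n) / of_nat n) :: complex fps"
  let ?low = "descents hgt adm" and ?high = "ascents hgt adm" and ?zero = "code_zero Q G lam"
  let ?d = "det_one_minus_gen G" and ?l = "\<lambda>C. trace_log_deriv (verts G) (gen_matrix G C)"
  have nil: "[] \<notin> ?low" "[] \<notin> ?high" "[] \<notin> ?zero"
    by (auto simp: descents_def ascents_def code_zero_def)
  have L_deriv: "fps_deriv ?L = ?l ?low + ?l ?high - ?l ?zero"
  proof (rule fps_ext)
    fix n
    have "fps_nth (fps_deriv ?L) n = of_nat (num_periodic ?X (Suc n))"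
      by (simp del: of_nat_Suc)
    also have "\<dots> = fps_nth (?l ?low + ?l ?high - ?l ?zero) n"
      unfolding num_periodic_eq card_periodic_subshift[OF zero_less_Suc] code_zero_eq[symmetric]
      by (simp only: fps_add_nth fps_sub_nth trace_log_deriv_gen_matrix_nth[OF nil(1)]
        trace_log_deriv_gen_matrix_nth[OF nil(2)] trace_log_deriv_gen_matrix_nth[OF nil(3)])
    finally show "fps_nth (fps_deriv ?L) n = fps_nth (?l ?low + ?l ?high - ?l ?zero) n" .
  qed
  have zeta_deriv: "fps_deriv (zeta ?X) = zeta ?X * fps_deriv ?L"
    by (simp add: zeta_def fps_compose_deriv)
  have "zeta ?X * (?d ?low * ?d ?high) = ?d ?zero"
  proof (rule fps_linear_ode_unique)
    show "fps_deriv (zeta ?X * (?d ?low * ?d ?high)) = - ?l ?zero * (zeta ?X * (?d ?low * ?d ?high))"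
      by (simp add: zeta_deriv L_deriv fps_deriv_det_one_minus_gen algebra_simps)
    show "fps_deriv (?d ?zero) = - ?l ?zero * ?d ?zero" by (rule fps_deriv_det_one_minus_gen)
    show "fps_nth (zeta ?X * (?d ?low * ?d ?high)) 0 = fps_nth (?d ?zero) 0"
      by (simp add: det_one_minus_gen_nth_0 zeta_def)
  qed
  moreover have "?d ?low * ?d ?high \<noteq> 0"
  proof
    assume "?d ?low * ?d ?high = 0"
    moreover have "fps_nth (?d ?low * ?d ?high) 0 = 1" by (simp add: det_one_minus_gen_nth_0)
    ultimately show False by (simp only: fps_zero_nth) simp
  qed
  ultimately have "zeta ?X = ?d ?zero / (?d ?low * ?d ?high)"
    by (metis nonzero_mult_div_cancel_right)
  then show ?thesis unfolding det_code_neg[symmetric] det_code_pos[symmetric] by (simp only: mult_ac)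
qed

end

theorem theorem9p1:
  fixes Q :: "('p, 'e) r_graph"
    and G :: "('v, 's) pre_digraph"
    and lam :: "'s \<Rightarrow> ('p, 'e) selem"
  assumes "S_presentation Q G lam"
  shows "zeta (presented_subshift Q G lam) =
    det_one_minus_gen G (code_zero Q G lam) /
    (det_one_minus_transition G (Sigma_neg Q G lam) * det_one_minus_gen G (code_neg Q G lam) *
     det_one_minus_gen G (code_pos Q G lam) * det_one_minus_transition G (Sigma_pos Q G lam))"
  using assms by (intro presentation.zeta_presented_subshift presentation.intro)

end
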